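(* Let $p$ be a prime. Let $H$ and $K$ be finitely generated nilpotent groups which are conjugacy $p$-separable, let $A\leqslant H$ and $B\leqslant K$ be central subgroups which are $p'$-isolated in $H$ and in $K$ respectively, and let $\varphi:A\to B$ be an isomorphism. Then $G=\bigl(H*K;\ A=B,\ \varphi\bigr)$ is a conjugacy $p$-separable group.
   Context: $\bigl(H*K;\ A=B,\ \varphi\bigr)$ denotes the free product of $H$ and $K$ with subgroups $A$ and $B$ amalgamated via the isomorphism $\varphi$. A group $G$ is conjugacy $p$-separable if whenever $a,b\in G$ are not conjugate in $G$, there is a homomorphism $\psi$ of $G$ onto a finite $p$-group $X$ such that $a\psi$ and $b\psi$ are not conjugate in $X$. For a prime $q$, a subgroup $X$ of a group $Y$ is $q$-isolated if $y^q\in X$ implies $y\in X$ for every $y\in Y$; $X$ is $p'$-isolated if it is $q$-isolated for every prime $q\neq p$. A subgroup is central if it lies in the center of the group. *)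

theory Defs
  imports "HOL-Algebra.Algebra"
begin

definition fin_gen_group :: "('a, 'b) monoid_scheme \<Rightarrow> bool" where
  "fin_gen_group G \<longleftrightarrow> group G \<and>
     (\<exists>S. finite S \<and> S \<subseteq> carrier G \<and> generate G S = carrier G)"

fun lower_central :: "('a, 'b) monoid_scheme \<Rightarrow> nat \<Rightarrow> 'a set" where
  "lower_central G 0 = carrier G"
| "lower_central G (Suc i) =
     generate G {x \<otimes>\<^bsub>G\<^esub> y \<otimes>\<^bsub>G\<^esub> inv\<^bsub>G\<^esub> x \<otimes>\<^bsub>G\<^esub> inv\<^bsub>G\<^esub> y
                 | x y. x \<in> lower_central G i \<and> y \<in> carrier G}"

definition nilpotent_group :: "('a, 'b) monoid_scheme \<Rightarrow> bool" where
  "nilpotent_group G \<longleftrightarrow> group G \<and> (\<exists>n. lower_central G n = {\<one>\<^bsub>G\<^esub>})"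

definition central_subgroup :: "'a set \<Rightarrow> ('a, 'b) monoid_scheme \<Rightarrow> bool" where
  "central_subgroup A G \<longleftrightarrow> subgroup A G \<and>
     (\<forall>a\<in>A. \<forall>x\<in>carrier G. a \<otimes>\<^bsub>G\<^esub> x = x \<otimes>\<^bsub>G\<^esub> a)"

definition q_isolated :: "nat \<Rightarrow> 'a set \<Rightarrow> ('a, 'b) monoid_scheme \<Rightarrow> bool" where
  "q_isolated q Q G \<longleftrightarrow> (\<forall>y\<in>carrier G. pow G y q \<in> Q \<longrightarrow> y \<in> Q)"

definition p'_isolated :: "nat \<Rightarrow> 'a set \<Rightarrow> ('a, 'b) monoid_scheme \<Rightarrow> bool" where
  "p'_isolated p Q G \<longleftrightarrow> (\<forall>q. Factorial_Ring.prime q \<and> q \<noteq> p \<longrightarrow> q_isolated q Q G)"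

definition conjugate_in :: "('a, 'b) monoid_scheme \<Rightarrow> 'a \<Rightarrow> 'a \<Rightarrow> bool" where
  "conjugate_in G a b \<longleftrightarrow> (\<exists>g\<in>carrier G. b = inv\<^bsub>G\<^esub> g \<otimes>\<^bsub>G\<^esub> a \<otimes>\<^bsub>G\<^esub> g)"

definition finite_p_group :: "nat \<Rightarrow> ('a, 'b) monoid_scheme \<Rightarrow> bool" where
  "finite_p_group p Q \<longleftrightarrow> group Q \<and> finite (carrier Q) \<and> (\<exists>k. card (carrier Q) = p ^ k)"

text \<open>Conjugacy p-separability.  Finite p-group quotients are represented on the
  carrier type nat; every finite group is isomorphic to one with such a carrier.\<close>
definition conj_p_separable :: "nat \<Rightarrow> ('a, 'b) monoid_scheme \<Rightarrow> bool" where
  "conj_p_separable p G \<longleftrightarrow>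
     (\<forall>a\<in>carrier G. \<forall>b\<in>carrier G. \<not> conjugate_in G a b \<longrightarrow>
        (\<exists>(Q :: nat monoid) \<psi>. finite_p_group p Q \<and> \<psi> \<in> hom G Q \<and>
            \<psi> ` carrier G = carrier Q \<and> \<not> conjugate_in Q (\<psi> a) (\<psi> b)))"

inductive amal_eq ::
  "('h, 'c) monoid_scheme \<Rightarrow> ('k, 'd) monoid_scheme \<Rightarrow> 'h set \<Rightarrow> ('h \<Rightarrow> 'k)
     \<Rightarrow> ('h + 'k) list \<Rightarrow> ('h + 'k) list \<Rightarrow> bool"
  for H K A \<phi> where
  refl: "amal_eq H K A \<phi> w w"
| sym: "amal_eq H K A \<phi> u v \<Longrightarrow> amal_eq H K A \<phi> v u"
| trans: "amal_eq H K A \<phi> u v \<Longrightarrow> amal_eq H K A \<phi> v w \<Longrightarrow> amal_eq H K A \<phi> u w"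
| congr: "amal_eq H K A \<phi> u v \<Longrightarrow> amal_eq H K A \<phi> (x @ u @ y) (x @ v @ y)"
| multH: "h1 \<in> carrier H \<Longrightarrow> h2 \<in> carrier H \<Longrightarrow>
           amal_eq H K A \<phi> [Inl h1, Inl h2] [Inl (h1 \<otimes>\<^bsub>H\<^esub> h2)]"
| multK: "k1 \<in> carrier K \<Longrightarrow> k2 \<in> carrier K \<Longrightarrow>
           amal_eq H K A \<phi> [Inr k1, Inr k2] [Inr (k1 \<otimes>\<^bsub>K\<^esub> k2)]"
| oneH: "amal_eq H K A \<phi> [Inl \<one>\<^bsub>H\<^esub>] []"
| oneK: "amal_eq H K A \<phi> [Inr \<one>\<^bsub>K\<^esub>] []"
| amalg: "a \<in> A \<Longrightarrow> amal_eq H K A \<phi> [Inl a] [Inr (\<phi> a)]"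

definition amal_words :: "('h, 'c) monoid_scheme \<Rightarrow> ('k, 'd) monoid_scheme \<Rightarrow> ('h + 'k) list set" where
  "amal_words H K = {w. set w \<subseteq> Inl ` carrier H \<union> Inr ` carrier K}"

definition amal_class ::
  "('h, 'c) monoid_scheme \<Rightarrow> ('k, 'd) monoid_scheme \<Rightarrow> 'h set \<Rightarrow> ('h \<Rightarrow> 'k)
     \<Rightarrow> ('h + 'k) list \<Rightarrow> ('h + 'k) list set" where
  "amal_class H K A \<phi> w = {v. amal_eq H K A \<phi> w v}"

definition amalgamated_product ::
  "('h, 'c) monoid_scheme \<Rightarrow> ('k, 'd) monoid_scheme \<Rightarrow> 'h set \<Rightarrow> ('h \<Rightarrow> 'k)
     \<Rightarrow> ('h + 'k) list set monoid" where
  "amalgamated_product H K A \<phi> =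
     \<lparr> carrier = amal_class H K A \<phi> ` amal_words H K,
       monoid.mult = (\<lambda>Q Y. amal_class H K A \<phi> ((SOME x. x \<in> Q) @ (SOME y. y \<in> Y))),
       one = amal_class H K A \<phi> [] \<rparr>"

end

theory Submission
  imports Defs "HOL-Computational_Algebra.Polynomial"
begin

text \<open>Finite \<open>p\<close>-quotients of the amalgam \<open>G\<close> come from the nilpotent group \<open>H \<times> K\<close>: since \<open>A\<close> is
  central and \<open>p'\<close>-isolated, \<open>H \<times> K\<close> modulo \<open>{(a, (\<phi> a)\<^sup>-\<^sup>1)}\<close> and modulo \<open>A \<times> B\<close> are residually finite
  \<open>p\<close>-groups, because a normal \<open>p'\<close>-isolated subgroup of a finitely generated nilpotent group is an
  intersection of normal subgroups of \<open>p\<close>-power index. These quotients separate non-conjugate elements of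
  \<open>H \<union> K\<close>. Every other element of \<open>G\<close> is conjugate to a cyclically reduced word of even length \<open>n \<ge> 2\<close>,
  and two such words are conjugate iff one is a cyclic rotation of the other. Given a homomorphism
  \<open>\<theta> : G \<rightarrow> P\<close> to a finite \<open>p\<close>-group and a matrix \<open>M\<close> commuting with \<open>\<theta> A\<close> with \<open>M\<^sup>2 = 0\<close>, represent \<open>H\<close> by
  permutation matrices and \<open>K\<close> by permutation matrices conjugated by \<open>1 + t M\<close>. The trace of a
  word is then a polynomial in \<open>t\<close>, and \<open>M\<close> can be chosen such that up to sign the coefficient of \<open>t\<^sup>n\<close> counts the
  closed walks spelled by the word along the cycle labelled by a given word: it is nonzero for that word and
  vanishes for non-conjugate ones. Putting \<open>t = p\<^sup>e\<close> and reducing modulo a large power of \<open>p\<close> makes the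
  image a finite \<open>p\<close>-group, where the traces still differ.\<close>

section \<open>Commutators and nilpotent groups\<close>

text \<open>The obstacle is that a quotient factoring through \<open>H \<times>\<times> K\<close>
  makes letters of H commute with letters of K, so it cannot tell apart words that differ only in
  how the two kinds of letters are interleaved. The matrix M restores this information: it lets a
  walk pass only from one letter to the next. A trace is invariant under conjugation, so no
  conjugacy class of the resulting finite group has to be described.

  Isolation is forced by the problem: if y lies outside A and some power of y with exponent q prime
  to p lies in A, then every finite p-quotient maps y into the image of A. Centrality of A lets all
  discrepancies between two words be collected into one element of A.

  For one pair of words only finitely many elements have to be kept apart, namely the letters, the
  quotients of letters of the two words, and one element of A for each rotation, so a single finite
  quotient of \<open>H \<times>\<times> K\<close> suffices. The longer word serves as reference,
  which gives a shorter one a trace of smaller degree. Separability of H and K enters for pairs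
  inside one factor and for the absence of p'-torsion.\<close>

definition commutator :: "('a, 'b) monoid_scheme \<Rightarrow> 'a \<Rightarrow> 'a \<Rightarrow> 'a" where
  "commutator G x y = x \<otimes>\<^bsub>G\<^esub> y \<otimes>\<^bsub>G\<^esub> inv\<^bsub>G\<^esub> x \<otimes>\<^bsub>G\<^esub> inv\<^bsub>G\<^esub> y"

definition center :: "('a, 'b) monoid_scheme \<Rightarrow> 'a set" where
  "center G = {z \<in> carrier G. \<forall>g\<in>carrier G. z \<otimes>\<^bsub>G\<^esub> g = g \<otimes>\<^bsub>G\<^esub> z}"

lemma centerD:
  assumes "z \<in> center G"
  shows "z \<in> carrier G" and "g \<in> carrier G \<Longrightarrow> z \<otimes>\<^bsub>G\<^esub> g = g \<otimes>\<^bsub>G\<^esub> z"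
  using assms unfolding center_def by blast+

lemma center_subset: "center G \<subseteq> carrier G"
  unfolding center_def by blast

lemma centerI:
  assumes "z \<in> carrier G" "\<And>g. g \<in> carrier G \<Longrightarrow> z \<otimes>\<^bsub>G\<^esub> g = g \<otimes>\<^bsub>G\<^esub> z"
  shows "z \<in> center G"
  using assms unfolding center_def by blast

context group
begin

lemma mult_inv_cancel [simp]:
  assumes "x \<in> carrier G" "y \<in> carrier G"
  shows "x \<otimes> (inv x \<otimes> y) = y" "inv x \<otimes> (x \<otimes> y) = y"
  using assms by (simp_all flip: m_assoc)

lemma commutator_closed [simp, intro]:
  "x \<in> carrier G \<Longrightarrow> y \<in> carrier G \<Longrightarrow> commutator G x y \<in> carrier G"
  by (simp add: commutator_def)

lemma commutator_eq_one_iff: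
  assumes "x \<in> carrier G" "y \<in> carrier G"
  shows "commutator G x y = \<one> \<longleftrightarrow> x \<otimes> y = y \<otimes> x"
proof
  assume "commutator G x y = \<one>"
  then have "commutator G x y \<otimes> (y \<otimes> x) = y \<otimes> x" using assms by simp
  then show "x \<otimes> y = y \<otimes> x" using assms by (simp add: commutator_def m_assoc)
next
  assume "x \<otimes> y = y \<otimes> x"
  then show "commutator G x y = \<one>" using assms by (simp add: commutator_def m_assoc)
qed

lemma commutator_swap:
  assumes "x \<in> carrier G" "y \<in> carrier G"
  shows "inv (commutator G x y) = commutator G y x"
  using assms by (simp add: commutator_def inv_mult_group m_assoc)

lemma commutator_mult_left:
  assumes "x \<in> carrier G" "y \<in> carrier G" "z \<in> carrier G"
  shows "commutator G (x \<otimes> y) z = x \<otimes> commutator G y z \<otimes> inv x \<otimes> commutator G x z"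
  using assms by (simp add: commutator_def inv_mult_group m_assoc)

lemma commutator_conj:
  assumes "x \<in> carrier G" "y \<in> carrier G" "g \<in> carrier G"
  shows "g \<otimes> commutator G x y \<otimes> inv g = commutator G (g \<otimes> x \<otimes> inv g) (g \<otimes> y \<otimes> inv g)"
  using assms by (simp add: commutator_def inv_mult_group m_assoc)

text \<open>Since x commutes with c = [x, y], the conjugation by \<open>x [^] n\<close> in the
  expansion of the commutator of \<open>x [^] n \<otimes> x\<close> with y is trivial, and every
  factor x contributes one more c. This turns torsion of commutators into commutation of
  powers.\<close>

lemma commutator_power_left:
  assumes "x \<in> carrier G" "y \<in> carrier G"
    and "x \<otimes> commutator G x y = commutator G x y \<otimes> x"
  shows "commutator G (x [^] (n::nat)) y = commutator G x y [^] n"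
proof (induction n)
  case 0
  then show ?case using assms by (simp add: commutator_def)
next
  case (Suc n)
  define c where "c = commutator G x y"
  have c: "c \<in> carrier G" using assms by (simp add: c_def)
  have "x [^] n \<otimes> c = c \<otimes> x [^] n"
    using group_commutes_pow[of x c n] assms c by (simp add: c_def)
  moreover have "commutator G (x [^] Suc n) y = x [^] n \<otimes> c \<otimes> inv (x [^] n) \<otimes> c [^] n"
    using assms Suc commutator_mult_left[of "x [^] n" x y] by (simp add: c_def)
  ultimately show ?case
    using assms(1) c group_commutes_pow[of c c n] by (simp add: m_assoc flip: c_def)
qed

lemma inv_commutes:
  assumes "x \<in> carrier G" "g \<in> carrier G" "x \<otimes> g = g \<otimes> x"
  shows "inv x \<otimes> g = g \<otimes> inv x"
proof -
  have "inv x \<otimes> (x \<otimes> g) \<otimes> inv x = inv x \<otimes> (g \<otimes> x) \<otimes> inv x"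
    using assms(3) by (rule arg_cong)
  then show ?thesis using assms(1,2) by (simp add: m_assoc)
qed

lemma subgroup_center: "subgroup (center G) G"
proof
  show "center G \<subseteq> carrier G" by (auto dest: centerD)
  show "\<one> \<in> center G" by (rule centerI) simp_all
next
  fix x y assume xy: "x \<in> center G" "y \<in> center G"
  then have c: "x \<in> carrier G" "y \<in> carrier G" by (auto dest: centerD)
  show "x \<otimes> y \<in> center G"
  proof (rule centerI)
    fix g assume g: "g \<in> carrier G"
    have "x \<otimes> y \<otimes> g = x \<otimes> (g \<otimes> y)" using c g by (simp add: m_assoc centerD(2)[OF xy(2) g])
    also have "\<dots> = (x \<otimes> g) \<otimes> y" using c g by (simp add: m_assoc)
    also have "\<dots> = (g \<otimes> x) \<otimes> y" by (simp only: centerD(2)[OF xy(1) g])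
    finally show "x \<otimes> y \<otimes> g = g \<otimes> (x \<otimes> y)" using c g by (simp add: m_assoc)
  qed (use c in simp)
next
  fix x assume x: "x \<in> center G"
  show "inv x \<in> center G"
    by (rule centerI) (use centerD[OF x] inv_commutes in auto)
qed

lemma normal_if_central:
  assumes "subgroup N G" "N \<subseteq> center G"
  shows "N \<lhd> G"
proof -
  have "x \<otimes> h \<otimes> inv x = h" if x: "x \<in> carrier G" and h: "h \<in> N" for x h
  proof -
    have "x \<otimes> h = h \<otimes> x" "h \<in> carrier G" using centerD[of h G] assms(2) x h by auto
    then show ?thesis using x by (simp add: m_assoc)
  qed
  then show ?thesis unfolding normal_inv_iff using assms(1) by simp
qed

lemma nat_pow_mem:
  "subgroup N G \<Longrightarrow> x \<in> N \<Longrightarrow> x [^] (n::nat) \<in> N"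
  by (induction n) (auto simp: subgroup.one_closed subgroup.m_closed)

end

section \<open>Lower central series and the centre of a nilpotent group\<close>

declare lower_central.simps(2) [simp del]

context group
begin

lemma lower_central_Suc:
  "lower_central G (Suc i) =
     generate G {commutator G x y | x y. x \<in> lower_central G i \<and> y \<in> carrier G}"
  by (simp only: lower_central.simps(2) commutator_def)

lemma commutator_in_lower_central:
  "x \<in> lower_central G i \<Longrightarrow> y \<in> carrier G \<Longrightarrow> commutator G x y \<in> lower_central G (Suc i)"
  unfolding lower_central_Suc by (rule generate.incl) blast

lemma lower_central_normal: "lower_central G i \<lhd> G"
proof (induction i)
  case 0
  then show ?case by (simp add: normal_self)
next
  case (Suc i)
  let ?S = "{commutator G x y | x y. x \<in> lower_central G i \<and> y \<in> carrier G}"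
  have sub: "lower_central G i \<subseteq> carrier G"
    by (rule subgroup.subset[OF normal_imp_subgroup[OF Suc]])
  show ?case unfolding lower_central_Suc
  proof (rule normal_generateI)
    show "?S \<subseteq> carrier G" using sub by auto
  next
    fix h g assume "h \<in> ?S" and g: "g \<in> carrier G"
    then obtain x y where h: "h = commutator G x y" "x \<in> lower_central G i" "y \<in> carrier G"
      by auto
    then have "g \<otimes> h \<otimes> inv g = commutator G (g \<otimes> x \<otimes> inv g) (g \<otimes> y \<otimes> inv g)"
      using commutator_conj g sub by (simp add: subset_eq)
    moreover have "g \<otimes> x \<otimes> inv g \<in> lower_central G i"
      using Suc g h(2) by (simp add: normal.inv_op_closed2)
    ultimately show "g \<otimes> h \<otimes> inv g \<in> ?S" using g h by auto
  qed
qed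

lemma lower_central_subgroup: "subgroup (lower_central G i) G"
  by (simp add: lower_central_normal normal_imp_subgroup)

lemma lower_central_subset: "lower_central G i \<subseteq> carrier G"
  by (simp add: lower_central_subgroup subgroup.subset)

lemma lower_central_Suc_subset: "lower_central G (Suc i) \<subseteq> lower_central G i"
  unfolding lower_central_Suc
proof (rule generate_subgroup_incl)
  show "subgroup (lower_central G i) G" by (rule lower_central_subgroup)
  show "{commutator G x y | x y. x \<in> lower_central G i \<and> y \<in> carrier G} \<subseteq> lower_central G i"
  proof clarify
    fix x y assume x: "x \<in> lower_central G i" and y: "y \<in> carrier G"
    have "y \<otimes> inv x \<otimes> inv y \<in> lower_central G i"
      using x y by (simp add: lower_central_normal normal.inv_op_closed2 lower_central_subgroup subgroup.m_inv_closed)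
    then have "x \<otimes> (y \<otimes> inv x \<otimes> inv y) \<in> lower_central G i"
      using x by (simp add: lower_central_subgroup subgroup.m_closed)
    moreover have "x \<in> carrier G" using x lower_central_subset by blast
    ultimately show "commutator G x y \<in> lower_central G i"
      using y by (simp add: commutator_def m_assoc)
  qed
qed

lemma iterated_commutator_in_lower_central:
  assumes "x \<in> carrier G" "y \<in> carrier G"
  shows "((\<lambda>w. commutator G w y) ^^ i) x \<in> lower_central G i"
  using assms by (induction i) (auto intro: commutator_in_lower_central)

end

text \<open>If \<open>y\<^sup>q\<close> is central, then along the sequence \<open>w (i + 1) = [w i, y]\<close> triviality of \<open>w (i + 2)\<close>
  forces \<open>w (i + 1)\<^sup>q = [w i, y\<^sup>q] = 1\<close>, so triviality descends to \<open>w 1\<close>.\<close>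
lemma (in group) center_isolated:
  assumes nil: "nilpotent_group G"
    and tf: "\<And>x. x \<in> carrier G \<Longrightarrow> x [^] (q::nat) = \<one> \<Longrightarrow> x = \<one>"
    and y: "y \<in> carrier G" and yq: "y [^] q \<in> center G"
  shows "y \<in> center G"
proof -
  have "y \<otimes> g = g \<otimes> y" if g: "g \<in> carrier G" for g
  proof -
    define w where "w i = ((\<lambda>w. commutator G w y) ^^ i) g" for i
    have w: "w i \<in> carrier G" for i
      unfolding w_def using iterated_commutator_in_lower_central[OF g y] lower_central_subset by blast
    have w_Suc: "w (Suc i) = commutator G (w i) y" for i by (simp add: w_def)
    obtain n where n: "lower_central G n = {\<one>}" using nil by (auto simp: nilpotent_group_def)
    have "w n = \<one>"
      using iterated_commutator_in_lower_central[OF g y, of n] n by (simp add: w_def)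
    then have wn: "w (Suc n) = \<one>" using y by (simp add: w_Suc commutator_def)
    have step: "w (Suc i) = \<one>" if "w (Suc (Suc i)) = \<one>" for i
    proof -
      \<comment> \<open>The commutator is turned round because \<open>commutator_power_left\<close>
        takes powers in the first entry, where y has to stand.\<close>
      let ?c = "commutator G y (w i)"
      have c: "?c = inv (w (Suc i))" using commutator_swap[OF w y] by (simp add: w_Suc)
      have "w (Suc i) \<otimes> y = y \<otimes> w (Suc i)"
        using that commutator_eq_one_iff[OF w y] w_Suc by metis
      then have "y \<otimes> ?c = ?c \<otimes> y"
        unfolding c using y w by (metis inv_commutes)
      then have "commutator G (y [^] q) (w i) = ?c [^] q"
        using commutator_power_left[OF y w] by blast
      moreover have "commutator G (y [^] q) (w i) = \<one>"
        using commutator_eq_one_iff centerD(2)[OF yq w] w y by simp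
      ultimately have "?c = \<one>" using tf y w by simp
      then show ?thesis using c w by (metis inv_inv inv_one)
    qed
    have "w (Suc 0) = \<one>"
    proof -
      have "w (Suc (n - k)) = \<one>" if "k \<le> n" for k
        using that
      proof (induction k)
        case 0
        then show ?case using wn by simp
      next
        case (Suc k)
        then have "Suc (n - Suc k) = n - k" by simp
        then show ?case using Suc step[of "n - Suc k"] by simp
      qed
      from this[of n] show ?thesis by simp
    qed
    then have "g \<otimes> y = y \<otimes> g"
      using commutator_eq_one_iff[OF g y] by (simp add: w_def)
    then show ?thesis by simp
  qed
  then show ?thesis using y by (auto intro: centerI)
qed

text \<open>The last nontrivial term of the lower central series is central, because its commutators
  with G lie in the next term.\<close>

lemma (in group) center_nontrivial:
  assumes "nilpotent_group G" "x \<in> carrier G" "x \<noteq> \<one>"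
  obtains z where "z \<in> center G" "z \<noteq> \<one>"
proof -
  obtain n where n: "lower_central G n = {\<one>}" using assms by (auto simp: nilpotent_group_def)
  have "lower_central G 0 \<noteq> {\<one>}" using assms(2,3) by auto
  from ex_least_nat_less[of "\<lambda>m. lower_central G m = {\<one>}", OF n this]
  obtain k where k: "lower_central G k \<noteq> {\<one>}" "lower_central G (Suc k) = {\<one>}"
    by blast
  then obtain z where z: "z \<in> lower_central G k" "z \<noteq> \<one>"
    using subgroup.one_closed[OF lower_central_subgroup, of k] by blast
  have zc: "z \<in> carrier G" using z lower_central_subset by blast
  have "z \<otimes> g = g \<otimes> z" if "g \<in> carrier G" for g
    using commutator_in_lower_central[OF z(1) that] k(2) commutator_eq_one_iff[OF zc that] by simp
  then show ?thesis using that z zc by (blast intro: centerI)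
qed

section \<open>Images under homomorphisms and factor groups\<close>

lemma (in group_hom) hom_commutator:
  "x \<in> carrier G \<Longrightarrow> y \<in> carrier G \<Longrightarrow> h (commutator G x y) = commutator H (h x) (h y)"
  by (simp add: commutator_def)

lemma (in group_hom) lower_central_img:
  assumes "h ` carrier G = carrier H"
  shows "lower_central H i = h ` lower_central G i"
proof (induction i)
  case 0
  then show ?case using assms by simp
next
  case (Suc i)
  let ?S = "{commutator G x y | x y. x \<in> lower_central G i \<and> y \<in> carrier G}"
  have "{commutator H x y | x y. x \<in> lower_central H i \<and> y \<in> carrier H} = h ` ?S" (is "?L = ?R")
  proof
    show "?L \<subseteq> ?R"
    proof clarify
      fix x y assume "x \<in> lower_central H i" "y \<in> carrier H"
      then obtain a b where ab: "x = h a" "a \<in> lower_central G i" "y = h b" "b \<in> carrier G"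
        using Suc assms by (metis imageE)
      then have "h (commutator G a b) = commutator H x y"
        using hom_commutator[of a b] G.lower_central_subset[of i] by auto
      then show "commutator H x y \<in> h ` ?S" using ab by (metis (mono_tags, lifting) imageI mem_Collect_eq)
    qed
    show "?R \<subseteq> ?L"
    proof clarify
      fix x y assume xy: "x \<in> lower_central G i" "y \<in> carrier G"
      then have "h (commutator G x y) = commutator H (h x) (h y)"
        using hom_commutator[of x y] G.lower_central_subset[of i] by auto
      then show "\<exists>x' y'. h (commutator G x y) = commutator H x' y' \<and> x' \<in> lower_central H i \<and> y' \<in> carrier H"
        using Suc xy assms by blast
    qed
  qed
  moreover have "?S \<subseteq> carrier G" using G.lower_central_subset[of i] by auto
  ultimately show ?case
    unfolding G.lower_central_Suc H.lower_central_Suc using generate_img by simp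
qed

lemma (in group_hom) nilpotent_group_img:
  assumes "h ` carrier G = carrier H" "nilpotent_group G"
  shows "nilpotent_group H"
proof -
  obtain n where "lower_central G n = {\<one>}" using assms by (auto simp: nilpotent_group_def)
  then have "lower_central H n = {\<one>\<^bsub>H\<^esub>}" using lower_central_img[OF assms(1), of n] by simp
  then show ?thesis unfolding nilpotent_group_def using H.is_group by blast
qed

lemma (in group_hom) fin_gen_group_img:
  assumes "h ` carrier G = carrier H" "fin_gen_group G"
  shows "fin_gen_group H"
proof -
  obtain S where "finite S" "S \<subseteq> carrier G" "generate G S = carrier G"
    using assms by (auto simp: fin_gen_group_def)
  then have "finite (h ` S) \<and> h ` S \<subseteq> carrier H \<and> generate H (h ` S) = carrier H"
    using generate_img[of S] assms(1) by auto
  then show ?thesis unfolding fin_gen_group_def using H.is_group by blast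
qed

lemma (in normal) group_hom_Mod: "group_hom G (G Mod H) (\<lambda>a. H #> a)"
  by (simp add: factorgroup_is_group group_hom_axioms_def group_hom_def r_coset_hom_Mod is_group)

lemma (in normal) Mod_eq_one_iff:
  "a \<in> carrier G \<Longrightarrow> H #> a = H \<longleftrightarrow> a \<in> H"
proof
  assume "a \<in> carrier G" "H #> a = H"
  then show "a \<in> H" using rcos_self[OF _ subgroup_axioms, of a] by simp
next
  assume "a \<in> H"
  then show "H #> a = H" by (rule rcos_const[OF is_group])
qed

lemma (in group) power_prime_power_le:
  assumes "x \<in> carrier G" "x [^] (p ^ e) = \<one>" "e \<le> (f::nat)"
  shows "x [^] ((p::nat) ^ f) = \<one>"
proof -
  have "p ^ f = p ^ e * p ^ (f - e)" using assms(3) by (simp flip: power_add)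
  then show ?thesis using assms(1,2) nat_pow_pow[of x "p ^ e" "p ^ (f - e)"] by simp
qed

section \<open>Torsion spreading from the centre along the upper central series\<close>

lemma (in group) subgroup_commuting:
  assumes "y \<in> carrier G"
  shows "subgroup {g \<in> carrier G. y \<otimes> g = g \<otimes> y} G"
proof
  fix a b assume a: "a \<in> {g \<in> carrier G. y \<otimes> g = g \<otimes> y}" and b: "b \<in> {g \<in> carrier G. y \<otimes> g = g \<otimes> y}"
  have "y \<otimes> (a \<otimes> b) = a \<otimes> y \<otimes> b" using a b assms by (simp flip: m_assoc)
  also have "\<dots> = a \<otimes> (b \<otimes> y)" using a b assms by (simp add: m_assoc)
  finally show "a \<otimes> b \<in> {g \<in> carrier G. y \<otimes> g = g \<otimes> y}" using a b assms by (simp add: m_assoc)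
next
  fix a assume a: "a \<in> {g \<in> carrier G. y \<otimes> g = g \<otimes> y}"
  then have "inv a \<otimes> y = y \<otimes> inv a" using assms inv_commutes[of a y] by simp
  then show "inv a \<in> {g \<in> carrier G. y \<otimes> g = g \<otimes> y}" using a by simp
qed (use assms in auto)

text \<open>The commutators of y with the finitely many generators are central, hence each is killed
  by a power of p. A common exponent \<open>p ^ f\<close> kills all of them, and by
  \<open>commutator_power_left\<close> the element \<open>y [^] (p ^ f)\<close> commutes with every
  generator.\<close>

lemma (in group) prime_power_in_center:
  assumes fg: "fin_gen_group G"
    and tors: "\<And>z. z \<in> center G \<Longrightarrow> \<exists>e. z [^] ((p::nat) ^ e) = \<one>"
    and y: "y \<in> carrier G" and yc: "\<And>g. g \<in> carrier G \<Longrightarrow> commutator G y g \<in> center G"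
  shows "\<exists>e. y [^] (p ^ e) \<in> center G"
proof -
  obtain S where S: "finite S" "S \<subseteq> carrier G" "generate G S = carrier G"
    using fg unfolding fin_gen_group_def by blast
  have "\<forall>s\<in>S. \<exists>e. commutator G y s [^] (p ^ e) = \<one>" using tors yc S(2) by blast
  then obtain e where e: "\<And>s. s \<in> S \<Longrightarrow> commutator G y s [^] (p ^ e s) = \<one>" by metis
  define f where "f = sum e S"
  have ef: "e s \<le> f" if "s \<in> S" for s unfolding f_def using S(1) that by (simp add: member_le_sum)
  define y' where "y' = y [^] (p ^ f)"
  have y': "y' \<in> carrier G" using y by (simp add: y'_def)
  let ?C = "{g \<in> carrier G. y' \<otimes> g = g \<otimes> y'}"
  have "S \<subseteq> ?C"
  proof
    fix s assume s: "s \<in> S"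
    then have sG: "s \<in> carrier G" using S by blast
    have "commutator G y s [^] (p ^ f) = \<one>"
      using power_prime_power_le[OF _ e[OF s] ef[OF s]] y sG by blast
    moreover have "commutator G y' s = commutator G y s [^] (p ^ f)"
      unfolding y'_def
    proof (rule commutator_power_left[OF y sG])
      show "y \<otimes> commutator G y s = commutator G y s \<otimes> y"
        using centerD(2)[OF yc[OF sG] y] by simp
    qed
    ultimately show "s \<in> ?C" using commutator_eq_one_iff[OF y' sG] sG by simp
  qed
  then have "carrier G \<subseteq> ?C"
    using generate_subgroup_incl[OF _ subgroup_commuting[OF y']] S(3) by blast
  then have "y' \<in> center G" using y' by (intro centerI) auto
  then show ?thesis unfolding y'_def by blast
qed

text \<open>Centrality modulo the previous term is expressed by commutators, which keeps factor
  groups out of the recursion.\<close>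

fun upper_central :: "('a, 'b) monoid_scheme \<Rightarrow> nat \<Rightarrow> 'a set" where
  "upper_central G 0 = {\<one>\<^bsub>G\<^esub>}"
| "upper_central G (Suc j) = {y \<in> carrier G. \<forall>g\<in>carrier G. commutator G y g \<in> upper_central G j}"

context group
begin

lemma upper_central_normal: "upper_central G j \<lhd> G"
proof (induction j)
  case 0
  then show ?case by (simp add: one_is_normal)
next
  case (Suc j)
  interpret U: normal "upper_central G j" G by (rule Suc)
  show ?case unfolding normal_inv_iff
  proof (intro conjI ballI)
    show "subgroup (upper_central G (Suc j)) G"
    proof
      fix x y assume "x \<in> upper_central G (Suc j)" "y \<in> upper_central G (Suc j)"
      then show "x \<otimes> y \<in> upper_central G (Suc j)"
        by (auto simp: commutator_mult_left intro!: U.m_closed U.inv_op_closed2)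
    next
      fix x assume "x \<in> upper_central G (Suc j)"
      then have x: "x \<in> carrier G" "\<And>g. g \<in> carrier G \<Longrightarrow> commutator G x g \<in> upper_central G j" by auto
      have "commutator G (inv x) g \<in> upper_central G j" if g: "g \<in> carrier G" for g
      proof -
        have "commutator G (inv x) g = inv x \<otimes> inv (commutator G x g) \<otimes> x"
          using x(1) g by (simp add: commutator_def inv_mult_group m_assoc)
        then show ?thesis using x g U.inv_op_closed1 U.m_inv_closed by simp
      qed
      then show "inv x \<in> upper_central G (Suc j)" using x by simp
    qed (auto simp: commutator_def U.one_closed)
  next
    fix a y assume a: "a \<in> carrier G" and "y \<in> upper_central G (Suc j)"
    then have y: "y \<in> carrier G" "\<And>g. g \<in> carrier G \<Longrightarrow> commutator G y g \<in> upper_central G j" by auto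
    have "commutator G (a \<otimes> y \<otimes> inv a) g \<in> upper_central G j" if g: "g \<in> carrier G" for g
    proof -
      have "commutator G (a \<otimes> y \<otimes> inv a) g = a \<otimes> commutator G y (inv a \<otimes> g \<otimes> a) \<otimes> inv a"
        using a y(1) g by (simp add: commutator_def inv_mult_group m_assoc)
      then show ?thesis using y a g U.inv_op_closed2 by simp
    qed
    then show "a \<otimes> y \<otimes> inv a \<in> upper_central G (Suc j)" using a y by simp
  qed
qed

text \<open>The case i = n is the aim: it shows that the upper central series of a nilpotent group
  reaches the whole group.\<close>

lemma lower_central_subset_upper_central:
  assumes "lower_central G n = {\<one>}" "i \<le> n"
  shows "lower_central G (n - i) \<subseteq> upper_central G i"
  using assms(2)
proof (induction i)
  case 0
  then show ?case using assms(1) by simp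
next
  case (Suc i)
  then have *: "Suc (n - Suc i) = n - i" by simp
  show ?case
  proof
    fix x assume x: "x \<in> lower_central G (n - Suc i)"
    then have "x \<in> carrier G" using lower_central_subset by blast
    moreover have "commutator G x g \<in> upper_central G i" if "g \<in> carrier G" for g
      using commutator_in_lower_central[OF x that] * Suc by auto
    ultimately show "x \<in> upper_central G (Suc i)" by simp
  qed
qed

text \<open>Modulo the j-th term the centre is the image of the term j + 1, and by the induction
  hypothesis it is p-torsion. Then \<open>prime_power_in_center\<close>, applied in this factor
  group, pushes a p-power of every element of the term j + 2 into the term j + 1.\<close>

lemma upper_central_power:
  assumes fg: "fin_gen_group G"
    and tors: "\<And>z. z \<in> center G \<Longrightarrow> \<exists>e. z [^] ((p::nat) ^ e) = \<one>"
  shows "y \<in> upper_central G (Suc j) \<Longrightarrow> \<exists>e. y [^] (p ^ e) \<in> upper_central G j"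
proof (induction j arbitrary: y)
  case 0
  then have "y \<in> carrier G" "\<And>g. g \<in> carrier G \<Longrightarrow> commutator G y g = \<one>" by auto
  then have "y \<in> center G" using commutator_eq_one_iff centerI by metis
  then show ?case using tors by simp
next
  case (Suc j)
  interpret U: normal "upper_central G j" G by (rule upper_central_normal)
  interpret f: group_hom G "G Mod upper_central G j" "\<lambda>a. upper_central G j #> a" by (rule U.group_hom_Mod)
  let ?f = "\<lambda>a. upper_central G j #> a"
  have surj: "?f ` carrier G = carrier (G Mod upper_central G j)" by (simp add: carrier_FactGroup)
  have cen: "?f z \<in> center (G Mod upper_central G j) \<longleftrightarrow> z \<in> upper_central G (Suc j)"
    if z: "z \<in> carrier G" for z
  proof -
    have "?f z \<otimes>\<^bsub>G Mod upper_central G j\<^esub> ?f g = ?f g \<otimes>\<^bsub>G Mod upper_central G j\<^esub> ?f z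
        \<longleftrightarrow> commutator G z g \<in> upper_central G j" if g: "g \<in> carrier G" for g
      using f.H.commutator_eq_one_iff[of "?f z" "?f g"] f.hom_commutator[OF z g] z g
        U.Mod_eq_one_iff[of "commutator G z g"] by simp
    then show ?thesis using z unfolding center_def surj[symmetric] by auto
  qed
  have "\<exists>e. ?f y [^]\<^bsub>G Mod upper_central G j\<^esub> (p ^ e) \<in> center (G Mod upper_central G j)"
  proof (rule f.H.prime_power_in_center)
    show "fin_gen_group (G Mod upper_central G j)" by (rule f.fin_gen_group_img[OF surj fg])
    show "?f y \<in> carrier (G Mod upper_central G j)" using Suc.prems by auto
  next
    fix z assume z: "z \<in> center (G Mod upper_central G j)"
    then obtain x where x: "x \<in> carrier G" "z = ?f x" using centerD(1)[OF z] surj by auto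
    then obtain e where "x [^] (p ^ e) \<in> upper_central G j" using Suc.IH cen z by metis
    then have "z [^]\<^bsub>G Mod upper_central G j\<^esub> (p ^ e) = \<one>\<^bsub>G Mod upper_central G j\<^esub>"
      using x U.FactGroup_pow U.Mod_eq_one_iff by simp
    then show "\<exists>e. z [^]\<^bsub>G Mod upper_central G j\<^esub> (p ^ e) = \<one>\<^bsub>G Mod upper_central G j\<^esub>" by blast
  next
    fix g assume "g \<in> carrier (G Mod upper_central G j)"
    then obtain x where x: "x \<in> carrier G" "g = ?f x" using surj by auto
    have "y \<in> carrier G" "commutator G y x \<in> upper_central G (Suc j)" using Suc.prems x by auto
    then show "commutator (G Mod upper_central G j) (?f y) g \<in> center (G Mod upper_central G j)"
      using cen[of "commutator G y x"] x f.hom_commutator by simp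
  qed
  moreover have "y \<in> carrier G" using Suc.prems by simp
  ultimately show ?case using cen U.FactGroup_pow by simp
qed

text \<open>Descending the upper central series from G to the trivial group costs one power of p at
  each term, and the exponents add up.\<close>

lemma prime_power_torsion_if_center:
  assumes fg: "fin_gen_group G" and nil: "nilpotent_group G"
    and tors: "\<And>z. z \<in> center G \<Longrightarrow> \<exists>e. z [^] ((p::nat) ^ e) = \<one>"
    and y: "y \<in> carrier G"
  shows "\<exists>e. y [^] (p ^ e) = \<one>"
proof -
  obtain n where "lower_central G n = {\<one>}" using nil unfolding nilpotent_group_def by blast
  then have n: "y \<in> upper_central G n" using lower_central_subset_upper_central[of n n] y by auto
  have "z \<in> upper_central G j \<Longrightarrow> \<exists>e. z [^] (p ^ e) = \<one>" for j z
  proof (induction j arbitrary: z)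
    case 0
    then show ?case by simp
  next
    case (Suc j)
    then obtain e f where "(z [^] (p ^ e)) [^] (p ^ f) = \<one>"
      using upper_central_power[OF fg tors] by metis
    moreover have "z \<in> carrier G" using Suc.prems by simp
    ultimately have "z [^] (p ^ (e + f)) = \<one>" by (simp add: nat_pow_pow power_add)
    then show ?case by blast
  qed
  then show ?thesis using n by blast
qed

end

section \<open>Finiteness of finitely generated nilpotent torsion groups\<close>

context group
begin

text \<open>Adjoining a generator s with \<open>s [^] m = \<one>\<close> to a group W whose elements
  commute with s yields only the products of a power of s below m with an element of W.\<close>

lemma finite_generate_commuting:
  assumes "finite S" "S \<subseteq> carrier G"
    and "\<And>s t. s \<in> S \<Longrightarrow> t \<in> S \<Longrightarrow> s \<otimes> t = t \<otimes> s"
    and "\<And>s. s \<in> S \<Longrightarrow> \<exists>m>0. s [^] (m::nat) = \<one>"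
  shows "finite (generate G S)"
  using assms
proof (induction S rule: finite_induct)
  case empty
  then show ?case by (simp add: generate_empty)
next
  case (insert s S)
  obtain m :: nat where m: "m > 0" "s [^] m = \<one>" using insert.prems by blast
  have s: "s \<in> carrier G" and SG: "S \<subseteq> carrier G" using insert.prems by auto
  have "S \<subseteq> {g \<in> carrier G. s \<otimes> g = g \<otimes> s}" using insert.prems by auto
  then have comm: "generate G S \<subseteq> {g \<in> carrier G. s \<otimes> g = g \<otimes> s}"
    by (rule generate_subgroup_incl) (rule subgroup_commuting[OF s])
  have sub: "subgroup (generate G S) G" using SG by (rule generate_is_subgroup)
  let ?F = "(\<lambda>(i, w). s [^] (i::nat) \<otimes> w) ` ({..<m} \<times> generate G S)"
  have mem: "s [^] i \<otimes> w \<in> ?F" if w: "w \<in> generate G S" for i :: nat and w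
  proof -
    have "s [^] i = s [^] (m * (i div m) + i mod m)" by simp
    also have "\<dots> = s [^] (m * (i div m)) \<otimes> s [^] (i mod m)" using s by (simp only: nat_pow_mult)
    also have "s [^] (m * (i div m)) = \<one>" using s m(2) by (simp flip: nat_pow_pow)
    finally have "s [^] i = s [^] (i mod m)" using s by simp
    then show ?thesis using m(1) w by (auto intro!: image_eqI[of _ _ "(i mod m, w)"])
  qed
  have "generate G (insert s S) \<subseteq> ?F"
  proof
    fix x assume "x \<in> generate G (insert s S)"
    then show "x \<in> ?F"
    proof (induction rule: generate.induct)
      case one
      show ?case using mem[of \<one> 0] generate.one[of G S] by simp
    next
      case (incl h)
      show ?case
      proof (cases "h = s")
        case True
        then show ?thesis using mem[of \<one> 1] generate.one[of G S] s by simp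
      next
        case False
        then have "h \<in> S" using incl by simp
        then show ?thesis using mem[OF generate.incl, of h 0] SG by (simp only: nat_pow_0 l_one subsetD)
      qed
    next
      case (inv h)
      show ?case
      proof (cases "h = s")
        case True
        have "s [^] (m - 1) \<otimes> s = \<one>" using m s by (metis Suc_diff_1 nat_pow_Suc)
        then have "inv s = s [^] (m - 1)" using s by (simp add: inv_equality)
        then show ?thesis using mem[of \<one> "m - 1"] generate.one[of G S] s True by simp
      next
        case False
        then have "h \<in> S" using inv by simp
        then show ?thesis
          using mem[OF generate.inv, of h 0] SG by (simp only: nat_pow_0 l_one inv_closed subsetD)
      qed
    next
      case (eng x y)
      obtain a where "a \<in> {..<m} \<times> generate G S" "x = (\<lambda>(i, w). s [^] i \<otimes> w) a"
        using eng.IH(1) by (rule imageE)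
      then obtain i :: nat and v where x: "x = s [^] i \<otimes> v" "v \<in> generate G S" by (cases a) simp
      obtain b where "b \<in> {..<m} \<times> generate G S" "y = (\<lambda>(i, w). s [^] i \<otimes> w) b"
        using eng.IH(2) by (rule imageE)
      then obtain j :: nat and w where y: "y = s [^] j \<otimes> w" "w \<in> generate G S" by (cases b) simp
      have c: "v \<in> carrier G" "w \<in> carrier G" "s \<otimes> v = v \<otimes> s" using comm x y by auto
      have "s [^] j \<otimes> v = v \<otimes> s [^] j" by (rule group_commutes_pow[OF c(3) s c(1)])
      then have "v \<otimes> (s [^] j \<otimes> w) = s [^] j \<otimes> (v \<otimes> w)" using c s by (simp flip: m_assoc)
      then have "x \<otimes> y = s [^] (i + j) \<otimes> (v \<otimes> w)"
        using x y c s by (simp add: m_assoc flip: nat_pow_mult)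
      then show ?case using mem[of "v \<otimes> w" "i + j"] subgroup.m_closed[OF sub] x y by simp
    qed
  qed
  moreover have "finite (generate G S)" using insert by auto
  ultimately show ?case using finite_subset by blast
qed

lemma finite_transversal:
  assumes "subgroup N G" "finite (rcosets N)"
  obtains T where "finite T" "T \<subseteq> carrier G" "\<And>x. x \<in> carrier G \<Longrightarrow> \<exists>t\<in>T. \<exists>u\<in>N. x = u \<otimes> t"
proof
  let ?T = "(\<lambda>C. SOME c. c \<in> C) ` (rcosets N)"
  have rep: "(SOME c. c \<in> N #> x) \<in> N #> x" if "x \<in> carrier G" for x
    using rcos_self[OF that assms(1)] by (rule someI)
  show "finite ?T" using assms(2) by simp
  show "?T \<subseteq> carrier G"
    using rep r_coset_subset_G[OF subgroup.subset[OF assms(1)]] by (auto simp: RCOSETS_def)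
  show "\<exists>t\<in>?T. \<exists>u\<in>N. x = u \<otimes> t" if x: "x \<in> carrier G" for x
  proof -
    let ?t = "SOME c. c \<in> N #> x"
    have "N #> x = N #> ?t" by (rule repr_independence[OF rep[OF x] x assms(1)])
    then have "x \<in> N #> ?t" using rcos_self[OF x assms(1)] by simp
    then have "\<exists>u\<in>N. x = u \<otimes> ?t" by (auto simp: r_coset_def)
    moreover have "?t \<in> ?T" using x by (auto simp: RCOSETS_def)
    ultimately show ?thesis by blast
  qed
qed

text \<open>A commutator depends only on the classes of its entries modulo the centre, so finitely
  many classes of entries give finitely many commutators.\<close>

lemma commutator_mult_center:
  assumes "u \<in> center G" "v \<in> center G" "x \<in> carrier G" "y \<in> carrier G"
  shows "commutator G (u \<otimes> x) (v \<otimes> y) = commutator G x y"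
proof -
  have uv: "u \<in> carrier G" "v \<in> carrier G" by (rule centerD(1)[OF assms(1)] centerD(1)[OF assms(2)])+
  have "commutator G (u \<otimes> x) (v \<otimes> y) = u \<otimes> commutator G x (v \<otimes> y) \<otimes> inv u \<otimes> commutator G u (v \<otimes> y)"
    using commutator_mult_left uv assms by simp
  also have "commutator G u (v \<otimes> y) = \<one>"
    using commutator_eq_one_iff[of u "v \<otimes> y"] centerD(2)[OF assms(1), of "v \<otimes> y"] uv assms by simp
  also have "u \<otimes> commutator G x (v \<otimes> y) \<otimes> inv u \<otimes> \<one> = commutator G x (v \<otimes> y)"
    using centerD(2)[OF assms(1), of "commutator G x (v \<otimes> y)"] uv assms by (simp add: m_assoc)
  also have "commutator G x (v \<otimes> y) = inv (commutator G (v \<otimes> y) x)"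
    using commutator_swap[of "v \<otimes> y" x] uv assms by simp
  also have "commutator G (v \<otimes> y) x = v \<otimes> commutator G y x \<otimes> inv v \<otimes> commutator G v x"
    using commutator_mult_left uv assms by simp
  also have "commutator G v x = \<one>"
    using commutator_eq_one_iff[of v x] centerD(2)[OF assms(2), of x] uv assms by simp
  also have "v \<otimes> commutator G y x \<otimes> inv v \<otimes> \<one> = commutator G y x"
    using centerD(2)[OF assms(2), of "commutator G y x"] uv assms by (simp add: m_assoc)
  also have "inv (commutator G y x) = commutator G x y"
    using commutator_swap assms by simp
  finally show ?thesis .
qed

end

text \<open>In the step from i to i + 1 it suffices that the image of
  \<open>lower_central G i\<close> modulo \<open>lower_central G (Suc i)\<close> is finite. This
  image is central and torsion, so finitely many generators are enough: for i = 0 those of G, and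
  otherwise the commutators, which are finitely many because their entries matter only modulo
  \<open>lower_central G i\<close>, a subgroup of finite index by induction.\<close>

lemma (in group) finite_Mod_lower_central:
  assumes fg: "fin_gen_group G"
    and tors: "\<And>x. x \<in> carrier G \<Longrightarrow> \<exists>m>0. x [^] (m::nat) = \<one>"
  shows "finite (carrier (G Mod lower_central G i))"
proof (induction i)
  case 0
  have "N #> x = N" if "x \<in> carrier G" "N = carrier G" for x N
    using that subgroup.rcos_const[OF subgroup_self is_group] by simp
  then have "carrier (G Mod lower_central G 0) \<subseteq> {carrier G}" by (auto simp: carrier_FactGroup)
  then show ?case by (rule finite_subset) simp
next
  case (Suc i)
  let ?N = "lower_central G (Suc i)"
  let ?M = "G Mod ?N"
  let ?f = "\<lambda>a. ?N #> a"
  interpret N: normal ?N G by (rule lower_central_normal)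
  interpret f: group_hom G ?M ?f by (rule N.group_hom_Mod)
  have surj: "carrier ?M = ?f ` carrier G" by (rule carrier_FactGroup)
  have torsM: "\<exists>m>0. s [^]\<^bsub>?M\<^esub> (m::nat) = \<one>\<^bsub>?M\<^esub>" if s: "s \<in> carrier ?M" for s
  proof -
    obtain x where x: "s = ?f x" "x \<in> carrier G" using s unfolding surj by (rule imageE)
    then obtain m where "m > 0" "x [^] (m::nat) = \<one>" using tors by blast
    then show ?thesis using x N.FactGroup_pow N.Mod_eq_one_iff[of \<one>] N.one_closed by auto
  qed
  have cen: "?f u \<in> center ?M" if u: "u \<in> lower_central G i" for u
  proof (rule centerI)
    have uG: "u \<in> carrier G" using u lower_central_subset by blast
    then show "?f u \<in> carrier ?M" by simp
    fix g assume "g \<in> carrier ?M"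
    then obtain x where x: "g = ?f x" "x \<in> carrier G" unfolding surj by (rule imageE)
    then have "commutator ?M (?f u) g = \<one>\<^bsub>?M\<^esub>"
      using f.hom_commutator[OF uG x(2)] commutator_in_lower_central[OF u x(2)]
        N.Mod_eq_one_iff[of "commutator G u x"] uG by simp
    then show "?f u \<otimes>\<^bsub>?M\<^esub> g = g \<otimes>\<^bsub>?M\<^esub> ?f u"
      using f.H.commutator_eq_one_iff[of "?f u" g] x uG f.hom_closed by blast
  qed
  obtain T where T: "finite T" "T \<subseteq> carrier G"
    "\<And>x. x \<in> carrier G \<Longrightarrow> \<exists>t\<in>T. \<exists>u\<in>lower_central G i. x = u \<otimes> t"
    using finite_transversal[OF lower_central_subgroup, of i] Suc.IH
    by (auto simp: FactGroup_def)
  have "\<exists>S. finite S \<and> S \<subseteq> center ?M \<and> ?f ` lower_central G i = generate ?M S"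
  proof (cases i)
    case 0
    obtain S where S: "finite S" "S \<subseteq> carrier G" "generate G S = carrier G"
      using fg unfolding fin_gen_group_def by blast
    have "?f ` lower_central G i = generate ?M (?f ` S)"
      using 0 f.generate_img[OF S(2)] S(3) by simp
    moreover have "?f ` S \<subseteq> center ?M" using cen S(2) 0 by auto
    ultimately show ?thesis using S(1) by blast
  next
    case (Suc k)
    let ?S = "{commutator G x y | x y. x \<in> lower_central G k \<and> y \<in> carrier G}"
    have SG: "?S \<subseteq> carrier G" using lower_central_subset[of k] by auto
    have gen: "lower_central G i = generate G ?S" unfolding Suc by (rule lower_central_Suc)
    have "?f ` lower_central G i = generate ?M (?f ` ?S)"
      unfolding gen using f.generate_img[OF SG] by simp
    moreover have "?f ` ?S \<subseteq> center ?M" using cen gen generate.incl[of _ ?S G] by blast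
    moreover have "?f ` ?S \<subseteq> (\<lambda>(s, t). commutator ?M (?f s) (?f t)) ` (T \<times> T)"
    proof clarify
      fix x y assume "x \<in> lower_central G k" and y: "y \<in> carrier G"
      then have x: "x \<in> carrier G" using lower_central_subset by blast
      obtain s u where su: "s \<in> T" "u \<in> lower_central G i" "x = u \<otimes> s" using T(3)[OF x] by blast
      obtain t v where tv: "t \<in> T" "v \<in> lower_central G i" "y = v \<otimes> t" using T(3)[OF y] by blast
      have c: "u \<in> carrier G" "v \<in> carrier G" "s \<in> carrier G" "t \<in> carrier G"
        using su tv T(2) lower_central_subset by auto
      have "?f (commutator G x y) = commutator ?M (?f x) (?f y)" by (rule f.hom_commutator[OF x y])
      also have "\<dots> = commutator ?M (?f u \<otimes>\<^bsub>?M\<^esub> ?f s) (?f v \<otimes>\<^bsub>?M\<^esub> ?f t)"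
        using f.hom_mult c su tv by simp
      also have "\<dots> = commutator ?M (?f s) (?f t)"
        using f.H.commutator_mult_center[OF cen cen] su tv c f.hom_closed by blast
      finally show "?f (commutator G x y) \<in> (\<lambda>(s, t). commutator ?M (?f s) (?f t)) ` (T \<times> T)"
        using su tv by auto
    qed
    then have "finite (?f ` ?S)" by (rule finite_subset) (use T(1) in simp)
    ultimately show ?thesis by blast
  qed
  then obtain S where S: "finite S" "S \<subseteq> center ?M" "?f ` lower_central G i = generate ?M S"
    by blast
  have SM: "S \<subseteq> carrier ?M" using S(2) center_subset by (rule subset_trans)
  have fin: "finite (?f ` lower_central G i)" unfolding S(3)
  proof (rule f.H.finite_generate_commuting[OF S(1) SM])
    show "s \<otimes>\<^bsub>?M\<^esub> t = t \<otimes>\<^bsub>?M\<^esub> s" if "s \<in> S" "t \<in> S" for s t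
      by (rule centerD(2)[OF subsetD[OF S(2) that(1)] subsetD[OF SM that(2)]])
  qed (use torsM SM in blast)
  have "carrier ?M \<subseteq> (\<lambda>(a, t). a \<otimes>\<^bsub>?M\<^esub> ?f t) ` (?f ` lower_central G i \<times> T)"
  proof
    fix c assume "c \<in> carrier ?M"
    then obtain x where x: "c = ?f x" "x \<in> carrier G" unfolding surj by (rule imageE)
    obtain t u where tu: "t \<in> T" "u \<in> lower_central G i" "x = u \<otimes> t" using T(3)[OF x(2)] by blast
    have "c = ?f u \<otimes>\<^bsub>?M\<^esub> ?f t"
      using f.hom_mult[of u t] tu x(1) T(2) lower_central_subset[of i] by (simp add: subset_eq)
    then show "c \<in> (\<lambda>(a, t). a \<otimes>\<^bsub>?M\<^esub> ?f t) ` (?f ` lower_central G i \<times> T)"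
      using tu by blast
  qed
  then show ?case by (rule finite_subset) (use fin T(1) in simp)
qed

lemma (in group) finite_if_torsion_nilpotent:
  assumes "fin_gen_group G" "nilpotent_group G"
    and "\<And>x. x \<in> carrier G \<Longrightarrow> \<exists>m>0. x [^] (m::nat) = \<one>"
  shows "finite (carrier G)"
proof -
  obtain n where "lower_central G n = {\<one>}" using assms(2) unfolding nilpotent_group_def by blast
  then have "finite (carrier (G Mod {\<one>}))"
    using finite_Mod_lower_central[OF assms(1,3), of n] by simp
  moreover have "carrier (G Mod {\<one>}) = (\<lambda>x. {x}) ` carrier G"
    by (auto simp: carrier_FactGroup r_coset_def)
  ultimately show ?thesis by (simp add: finite_image_iff)
qed

section \<open>Normal subgroups of prime power index\<close>

context group
begin

text \<open>A prime factor q of m is different from p and can be removed by q-isolation; the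
  induction continues with m / q. The exponent 0 is excluded because it is a multiple of p.\<close>

lemma p'_isolated_not_dvd:
  assumes iso: "p'_isolated p N G" and p: "Factorial_Ring.prime p"
  shows "y \<in> carrier G \<Longrightarrow> y [^] (m::nat) \<in> N \<Longrightarrow> \<not> p dvd m \<Longrightarrow> y \<in> N"
proof (induction m arbitrary: y rule: less_induct)
  case (less m)
  show ?case
  proof (cases "m = 1")
    case True
    then show ?thesis using less.prems by simp
  next
    case False
    then obtain q where q: "Factorial_Ring.prime q" "q dvd m" using prime_factor_nat by blast
    then obtain k where k: "m = q * k" by blast
    have "m \<noteq> 0" using less.prems(3) by (metis dvd_0_right)
    then have "k < m" using k prime_gt_1_nat[OF q(1)] by simp
    have "y [^] m = (y [^] k) [^] q" using less.prems(1) k by (simp add: nat_pow_pow mult.commute)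
    moreover have "q \<noteq> p" using q(2) less.prems(3) by blast
    ultimately have "y [^] k \<in> N"
      using iso q(1) less.prems(1,2) unfolding p'_isolated_def q_isolated_def by simp
    moreover have "\<not> p dvd k" using less.prems(3) k dvd_mult by blast
    ultimately show ?thesis using less.IH[OF \<open>k < m\<close> less.prems(1)] by blast
  qed
qed

lemma int_pow_eq_one_abs:
  assumes "x \<in> carrier G" "x [^] (i::int) = \<one>"
  shows "x [^] (nat \<bar>i\<bar>) = \<one>"
proof (cases "i \<ge> 0")
  case True
  then show ?thesis using assms(2) by (simp add: pow_nat)
next
  case False
  then have "x [^] (- i) = \<one>" using assms by (simp add: int_pow_neg)
  then show ?thesis using False pow_nat[of "- i" G x] by simp
qed

text \<open>This is the p'-isolator of the cyclic group generated by z, taken inside the centre.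
  There powers are multiplicative, so that a subgroup results, and it is automatically
  normal.\<close>

definition isolator :: "nat \<Rightarrow> 'a \<Rightarrow> 'a set" where
  "isolator p z = {y \<in> center G. \<exists>m. \<not> p dvd m \<and> y [^] (m::nat) \<in> generate G {z}}"

lemma isolator_subgroup:
  assumes p: "Factorial_Ring.prime p" and z: "z \<in> carrier G"
  shows "subgroup (isolator p z) G"
proof -
  have gen: "subgroup (generate G {z}) G" using z generate_is_subgroup by simp
  show ?thesis
  proof
    show "isolator p z \<subseteq> carrier G" using center_subset[of G] by (auto simp: isolator_def)
    show "\<one> \<in> isolator p z" unfolding isolator_def
      using subgroup.one_closed[OF subgroup_center] subgroup.one_closed[OF gen] p
      by (auto intro!: exI[of _ 1] dest: prime_gt_1_nat)
  next
    fix x y assume "x \<in> isolator p z" "y \<in> isolator p z"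
    then obtain m n where x: "x \<in> center G" "\<not> p dvd m" "x [^] (m::nat) \<in> generate G {z}"
      and y: "y \<in> center G" "\<not> p dvd n" "y [^] (n::nat) \<in> generate G {z}"
      unfolding isolator_def by blast
    have c: "x \<in> carrier G" "y \<in> carrier G" using centerD(1)[OF x(1)] centerD(1)[OF y(1)] by auto
    have "(x \<otimes> y) [^] (m * n) = x [^] (m * n) \<otimes> y [^] (n * m)"
      using pow_mult_distrib[OF centerD(2)[OF x(1) c(2)] c] by (simp add: mult.commute)
    also have "\<dots> = (x [^] m) [^] n \<otimes> (y [^] n) [^] m" using c by (simp add: nat_pow_pow)
    finally have "(x \<otimes> y) [^] (m * n) \<in> generate G {z}"
      using nat_pow_mem[OF gen] x(3) y(3) subgroup.m_closed[OF gen] by simp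
    moreover have "\<not> p dvd m * n" using x(2) y(2) p by (simp add: prime_dvd_mult_iff)
    ultimately show "x \<otimes> y \<in> isolator p z"
      using subgroup.m_closed[OF subgroup_center x(1) y(1)] unfolding isolator_def by blast
  next
    fix x assume "x \<in> isolator p z"
    then obtain m where x: "x \<in> center G" "\<not> p dvd m" "x [^] (m::nat) \<in> generate G {z}"
      unfolding isolator_def by blast
    then have "inv x [^] m \<in> generate G {z}"
      using subgroup.m_inv_closed[OF gen x(3)] centerD(1)[OF x(1)] by (simp add: nat_pow_inv)
    then show "inv x \<in> isolator p z"
      using subgroup.m_inv_closed[OF subgroup_center x(1)] x(2) unfolding isolator_def by blast
  qed
qed

text \<open>The element x lies in the isolator of every nontrivial central w, so some power of x
  with exponent prime to p is a power of w. Taking w = \<open>x [^] p\<close> forces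
  \<open>x [^] p = \<one>\<close>. Taking w = z then gives z finite order, and the part of the
  exponent prime to p is removed by the absence of p'-torsion.\<close>

lemma prime_power_torsion_center_if_monolithic:
  assumes p: "Factorial_Ring.prime p" and nil: "nilpotent_group G"
    and tf: "p'_isolated p {\<one>} G"
    and x: "x \<in> carrier G" "x \<noteq> \<one>"
    and mono: "\<And>J. J \<lhd> G \<Longrightarrow> p'_isolated p J G \<Longrightarrow> J \<noteq> {\<one>} \<Longrightarrow> x \<in> J"
    and z: "z \<in> center G"
  shows "\<exists>e. z [^] (p ^ e) = \<one>"
proof -
  have tf': "y = \<one>" if "y \<in> carrier G" "y [^] (m::nat) = \<one>" "\<not> p dvd m" for y m
    using p'_isolated_not_dvd[OF tf p, of y m] that by simp
  have cen_iso: "p'_isolated p (center G) G"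
    unfolding p'_isolated_def q_isolated_def
  proof (intro allI impI ballI)
    fix q y assume q: "Factorial_Ring.prime q \<and> q \<noteq> p" and y: "y \<in> carrier G" "y [^] q \<in> center G"
    then have "\<not> p dvd q" using p by (auto dest: primes_dvd_imp_eq)
    then show "y \<in> center G" using center_isolated[OF nil _ y] tf' by blast
  qed
  have key: "\<exists>m j. \<not> p dvd m \<and> x [^] (m::nat) = w [^] (j::int)" if w: "w \<in> center G" "w \<noteq> \<one>" for w
  proof -
    have wG: "w \<in> carrier G" using centerD(1)[OF w(1)] .
    have "isolator p w \<lhd> G"
      using normal_if_central[OF isolator_subgroup[OF p wG]] by (auto simp: isolator_def)
    moreover have "p'_isolated p (isolator p w) G"
      unfolding p'_isolated_def q_isolated_def
    proof (intro allI impI ballI)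
      fix q y assume q: "Factorial_Ring.prime q \<and> q \<noteq> p" and y: "y \<in> carrier G" "y [^] q \<in> isolator p w"
      then obtain m where m: "y [^] q \<in> center G" "\<not> p dvd m" "(y [^] q) [^] (m::nat) \<in> generate G {w}"
        unfolding isolator_def by blast
      have "y \<in> center G" using cen_iso q y(1) m(1) unfolding p'_isolated_def q_isolated_def by blast
      moreover have "\<not> p dvd q * m"
        using m(2) q p by (auto simp: prime_dvd_mult_iff dest: primes_dvd_imp_eq)
      moreover have "y [^] (q * m) \<in> generate G {w}" using m(3) y(1) by (simp add: nat_pow_pow)
      ultimately show "y \<in> isolator p w" unfolding isolator_def by blast
    qed
    moreover have "w \<in> isolator p w"
      unfolding isolator_def using w generate.incl[of w "{w}" G] p
      by (auto intro!: exI[of _ 1] simp: wG dest: prime_gt_1_nat)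
    ultimately have "x \<in> isolator p w" using mono w(2) by blast
    then show ?thesis unfolding isolator_def generate_pow[OF wG] by blast
  qed
  \<comment> \<open>The centre is itself a nontrivial p'-isolated normal subgroup, so it contains
    x.\<close>
  have xc: "x \<in> center G"
  proof -
    obtain w where w: "w \<in> center G" "w \<noteq> \<one>" using center_nontrivial[OF nil x] .
    have "center G \<lhd> G" by (rule normal_if_central[OF subgroup_center order_refl])
    then show ?thesis using mono[OF _ cen_iso] w by blast
  qed
  have xp: "x [^] p = \<one>"
  proof (rule ccontr)
    assume "x [^] p \<noteq> \<one>"
    moreover have "x [^] p \<in> center G" using nat_pow_mem[OF subgroup_center xc] .
    ultimately obtain m j where m: "\<not> p dvd m" "x [^] (m::nat) = (x [^] p) [^] (j::int)"
      using key by blast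
    \<comment> \<open>The relation annihilates x by the exponent m - p * j, which is prime to p,
      although x is nontrivial and there is no p'-torsion.\<close>
    have "x [^] (int m) = x [^] (int p * j)"
      using m(2) x(1) by (simp add: int_pow_int int_pow_pow[symmetric])
    then have "x [^] (int m - int p * j) = \<one>" using x(1) by (simp add: int_pow_diff)
    then have "x [^] nat \<bar>int m - int p * j\<bar> = \<one>" using int_pow_eq_one_abs x(1) by blast
    moreover have "\<not> p dvd nat \<bar>int m - int p * j\<bar>"
    proof
      assume "p dvd nat \<bar>int m - int p * j\<bar>"
      then have "int p dvd int m - int p * j" by (simp add: dvd_nat_abs_iff int_dvd_int_iff)
      then have "int p dvd (int m - int p * j) + int p * j" by (rule dvd_add) simp
      then show False using m(1) by simp
    qed
    ultimately show False using tf' x by blast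
  qed
  show ?thesis
  proof (cases "z = \<one>")
    case True
    then show ?thesis by simp
  next
    case False
    have zG: "z \<in> carrier G" using centerD(1)[OF z] .
    obtain m j where m: "\<not> p dvd m" "x [^] (m::nat) = z [^] (j::int)" using key[OF z False] by blast
    have "j \<noteq> 0"
    proof
      assume "j = 0"
      then have "x [^] m = \<one>" using m(2) by simp
      then show False using tf' m(1) x by blast
    qed
    have "z [^] (j * int p) = (x [^] m) [^] p"
      unfolding m(2) using zG by (simp add: int_pow_pow[symmetric] int_pow_int)
    also have "\<dots> = (x [^] p) [^] m" using x(1) by (simp add: nat_pow_pow mult.commute)
    finally have "z [^] nat \<bar>j * int p\<bar> = \<one>" using int_pow_eq_one_abs zG xp by simp
    moreover have n0: "nat \<bar>j * int p\<bar> \<noteq> 0" using \<open>j \<noteq> 0\<close> prime_gt_0_nat[OF p] by simp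
    moreover have "\<not> is_unit p" using p by auto
    ultimately obtain e r where "nat \<bar>j * int p\<bar> = p ^ e * r" "\<not> p dvd r"
      "(z [^] (p ^ e)) [^] r = \<one>"
      using multiplicity_decompose'[of "nat \<bar>j * int p\<bar>" p] nat_pow_pow[OF zG] by metis
    then have "z [^] (p ^ e) = \<one>" using tf' zG by blast
    then show ?thesis by blast
  qed
qed

end

text \<open>The factor group is a finite p-group, but this is said through orders of elements
  instead of a cardinality. In this form the property passes easily to intersections, and
  \<open>card_eq_prime_power\<close> recovers the cardinality where it is wanted.\<close>

definition p_normal :: "nat \<Rightarrow> 'a set \<Rightarrow> ('a, 'b) monoid_scheme \<Rightarrow> bool" where
  "p_normal p N G \<longleftrightarrow> N \<lhd> G \<and> finite (carrier (G Mod N)) \<and>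
     (\<forall>y\<in>carrier G. \<exists>e. y [^]\<^bsub>G\<^esub> (p ^ e) \<in> N)"

lemma (in group) normal_Union_chain:
  assumes "C \<noteq> {}" and N: "\<And>N. N \<in> C \<Longrightarrow> N \<lhd> G"
    and ch: "\<And>M N. M \<in> C \<Longrightarrow> N \<in> C \<Longrightarrow> M \<subseteq> N \<or> N \<subseteq> M"
  shows "\<Union>C \<lhd> G"
  unfolding normal_inv_iff
proof (intro conjI ballI)
  have sub: "subgroup N G" if "N \<in> C" for N using N[OF that] normal_imp_subgroup by blast
  show "subgroup (\<Union>C) G"
  proof
    show "\<Union>C \<subseteq> carrier G" using subgroup.subset[OF sub] by blast
    show "\<one> \<in> \<Union>C" using assms(1) subgroup.one_closed[OF sub] by blast
    show "inv x \<in> \<Union>C" if "x \<in> \<Union>C" for x using that subgroup.m_inv_closed[OF sub] by blast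
    fix x y assume "x \<in> \<Union>C" "y \<in> \<Union>C"
    then obtain M N where MN: "M \<in> C" "x \<in> M" "N \<in> C" "y \<in> N" by blast
    then have "\<exists>L\<in>C. x \<in> L \<and> y \<in> L" using ch[of M N] by blast
    then show "x \<otimes> y \<in> \<Union>C" using subgroup.m_closed[OF sub] by blast
  qed
  show "a \<otimes> h \<otimes> inv a \<in> \<Union>C" if "a \<in> carrier G" "h \<in> \<Union>C" for a h
    using that N normal.inv_op_closed2 by (metis Union_iff)
qed

lemma (in group_hom) vimage_normal:
  assumes "J \<lhd> H"
  shows "{g \<in> carrier G. h g \<in> J} \<lhd> G"
proof -
  interpret J: normal J H by (rule assms)
  show ?thesis unfolding G.normal_inv_iff
  proof (intro conjI ballI)
    show "subgroup {g \<in> carrier G. h g \<in> J} G"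
      by standard (auto simp: J.m_closed J.one_closed J.m_inv_closed)
  qed (auto simp: J.inv_op_closed2)
qed

text \<open>A normal \<open>p'\<close>-isolated subgroup \<open>N\<close> maximal subject to \<open>M \<subseteq> N\<close> and \<open>x \<notin> N\<close> works:
  the isolator of any nontrivial central element of \<open>G / N\<close> contains \<open>x\<close>.\<close>
theorem (in group) p_normal_separation:
  assumes p: "Factorial_Ring.prime p" and fg: "fin_gen_group G" and nil: "nilpotent_group G"
    and M: "M \<lhd> G" "p'_isolated p M G" and x: "x \<in> carrier G" "x \<notin> M"
  obtains N where "p_normal p N G" "M \<subseteq> N" "x \<notin> N"
proof -
  define F where "F = {N. N \<lhd> G \<and> M \<subseteq> N \<and> x \<notin> N \<and> p'_isolated p N G}"
  have "\<exists>N\<in>F. \<forall>Y\<in>F. N \<subseteq> Y \<longrightarrow> Y = N"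
  proof (rule subset_Zorn_nonempty)
    show "F \<noteq> {}" using M x by (auto simp: F_def)
    fix C assume C: "C \<noteq> {}" "subset.chain F C"
    then have CF: "C \<subseteq> F" by (simp add: subset.chain_def)
    have "\<Union>C \<lhd> G"
    proof (rule normal_Union_chain[OF C(1)])
      show "N \<lhd> G" if "N \<in> C" for N using that CF by (auto simp: F_def)
      show "M \<subseteq> N \<or> N \<subseteq> M" if "M \<in> C" "N \<in> C" for M N
        using C(2) that by (auto simp: subset_chain_def)
    qed
    moreover have "p'_isolated p (\<Union>C) G"
      using CF unfolding p'_isolated_def q_isolated_def F_def by blast
    ultimately show "\<Union>C \<in> F" using CF C(1) unfolding F_def by blast
  qed
  then obtain N where N: "N \<in> F" and max: "\<And>Y. Y \<in> F \<Longrightarrow> N \<subseteq> Y \<Longrightarrow> Y = N" by blast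
  have NG: "N \<lhd> G" and MN: "M \<subseteq> N" and xN: "x \<notin> N" and iso: "p'_isolated p N G"
    using N by (auto simp: F_def)
  let ?Q = "G Mod N" and ?f = "\<lambda>a. N #> a"
  interpret N: normal N G by (rule NG)
  interpret f: group_hom G ?Q ?f by (rule N.group_hom_Mod)
  have surj: "?f ` carrier G = carrier ?Q" by (simp add: carrier_FactGroup)
  have fgQ: "fin_gen_group ?Q" by (rule f.fin_gen_group_img[OF surj fg])
  have nilQ: "nilpotent_group ?Q" by (rule f.nilpotent_group_img[OF surj nil])
  have tf: "p'_isolated p {\<one>\<^bsub>?Q\<^esub>} ?Q"
    unfolding p'_isolated_def q_isolated_def
  proof (intro allI impI ballI)
    fix q y assume q: "Factorial_Ring.prime q \<and> q \<noteq> p" and y: "y \<in> carrier ?Q" "y [^]\<^bsub>?Q\<^esub> q \<in> {\<one>\<^bsub>?Q\<^esub>}"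
    obtain g where g: "y = ?f g" "g \<in> carrier G" using y(1) unfolding surj[symmetric] by (rule imageE)
    then have "g [^] q \<in> N" using y(2) N.FactGroup_pow N.Mod_eq_one_iff[of "g [^] q"] by simp
    then have "g \<in> N" using iso q g(2) unfolding p'_isolated_def q_isolated_def by blast
    then show "y \<in> {\<one>\<^bsub>?Q\<^esub>}" using g N.Mod_eq_one_iff by simp
  qed
  have mono: "?f x \<in> J" if J: "J \<lhd> ?Q" "p'_isolated p J ?Q" "J \<noteq> {\<one>\<^bsub>?Q\<^esub>}" for J
  proof (rule ccontr)
    assume xJ: "?f x \<notin> J"
    \<comment> \<open>If the class of x avoided J, the preimage of J would be a member of F above N,
      hence N itself, and J would be trivial.\<close>
    let ?J = "{g \<in> carrier G. ?f g \<in> J}"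
    have oneJ: "N \<in> J" using subgroup.one_closed[OF normal_imp_subgroup[OF J(1)]] by simp
    have NJ: "N \<subseteq> ?J"
    proof
      fix a assume "a \<in> N"
      then show "a \<in> ?J" using oneJ N.rcos_const[OF is_group] N.subset by auto
    qed
    have "p'_isolated p ?J G"
      unfolding p'_isolated_def q_isolated_def
    proof (intro allI impI ballI)
      fix q y assume q: "Factorial_Ring.prime q \<and> q \<noteq> p" and y: "y \<in> carrier G" "y [^] q \<in> ?J"
      then have "?f y [^]\<^bsub>?Q\<^esub> q \<in> J" using N.FactGroup_pow by simp
      then have "?f y \<in> J" using J(2) q f.hom_closed[OF y(1)] unfolding p'_isolated_def q_isolated_def by blast
      then show "y \<in> ?J" using y(1) by blast
    qed
    then have "?J \<in> F" unfolding F_def using f.vimage_normal[OF J(1)] NJ MN xJ by blast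
    then have "?J = N" using max NJ by blast
    moreover obtain c where c: "c \<in> J" "c \<noteq> \<one>\<^bsub>?Q\<^esub>" using J(3) oneJ by auto
    moreover obtain g where "c = ?f g" "g \<in> carrier G"
      using c(1) subgroup.subset[OF normal_imp_subgroup[OF J(1)]] unfolding surj[symmetric] by blast
    ultimately have "g \<in> N" "?f g \<noteq> N" by auto
    then show False using N.Mod_eq_one_iff N.subset by blast
  qed
  have fx: "?f x \<in> carrier ?Q" "?f x \<noteq> \<one>\<^bsub>?Q\<^esub>" using x(1) xN N.Mod_eq_one_iff by auto
  have tors: "\<exists>e. y [^]\<^bsub>?Q\<^esub> (p ^ e) = \<one>\<^bsub>?Q\<^esub>" if "y \<in> carrier ?Q" for y
    by (rule f.H.prime_power_torsion_if_center[OF fgQ nilQ _ that])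
      (rule f.H.prime_power_torsion_center_if_monolithic[OF p nilQ tf fx mono])
  have "finite (carrier ?Q)"
    by (rule f.H.finite_if_torsion_nilpotent[OF fgQ nilQ])
      (metis tors prime_gt_0_nat[OF p] zero_less_power)
  moreover have "\<exists>e. y [^] (p ^ e) \<in> N" if y: "y \<in> carrier G" for y
  proof -
    obtain e where "?f y [^]\<^bsub>?Q\<^esub> (p ^ e) = \<one>\<^bsub>?Q\<^esub>" using tors f.hom_closed[OF y] by blast
    then show ?thesis using N.FactGroup_pow[OF y] N.Mod_eq_one_iff y by auto
  qed
  ultimately have "p_normal p N G" unfolding p_normal_def using NG by blast
  then show ?thesis using that MN xN by blast
qed

text \<open>Any other prime q dividing the order would give, by Sylow, a subgroup of order q; a
  nontrivial element of it would have an order dividing both q and a power of p.\<close>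

lemma (in group) card_eq_prime_power:
  assumes p: "Factorial_Ring.prime p" and fin: "finite (carrier G)"
    and tors: "\<And>x. x \<in> carrier G \<Longrightarrow> \<exists>e. x [^] (p ^ e) = \<one>"
  shows "\<exists>k. card (carrier G) = p ^ k"
proof -
  have n0: "card (carrier G) \<noteq> 0" using fin one_closed by auto
  have only_p: "q = p" if q: "Factorial_Ring.prime q" "q dvd card (carrier G)" for q
  proof (rule ccontr)
    assume "q \<noteq> p"
    obtain m where "Coset.order G = q ^ 1 * m" using q(2) unfolding Coset.order_def by auto
    then obtain H where H: "subgroup H G" "card H = q"
      using sylow_thm[OF q(1) is_group _ fin] by fastforce
    have "H \<noteq> {\<one>}" using H(2) prime_gt_1_nat[OF q(1)] by auto
    then obtain y where y: "y \<in> H" "y \<noteq> \<one>" using subgroup.one_closed[OF H(1)] by blast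
    have yG: "y \<in> carrier G" using subgroup.subset[OF H(1)] y(1) by blast
    interpret H: group "G\<lparr>carrier := H\<rparr>" using H(1) subgroup_imp_group by blast
    have "y [^]\<^bsub>G\<lparr>carrier := H\<rparr>\<^esub> Coset.order (G\<lparr>carrier := H\<rparr>) = \<one>\<^bsub>G\<lparr>carrier := H\<rparr>\<^esub>"
      by (rule H.pow_order_eq_1) (use y(1) in simp)
    then have "y [^] q = \<one>" using H(2) by (simp add: Coset.order_def flip: nat_pow_consistent)
    then have "ord y dvd q" using pow_eq_id[OF yG] by simp
    moreover obtain e where "y [^] (p ^ e) = \<one>" using tors yG by blast
    then have "ord y dvd p ^ e" using pow_eq_id[OF yG] by simp
    moreover have "coprime q (p ^ e)" using primes_coprime[OF q(1) p \<open>q \<noteq> p\<close>] by simp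
    ultimately have "ord y = 1" using coprime_common_divisor_nat by blast
    then show False using y(2) yG pow_ord_eq_1[OF yG] by simp
  qed
  have "\<not> is_unit p" using p by auto
  then obtain r where r: "card (carrier G) = p ^ multiplicity p (card (carrier G)) * r" "\<not> p dvd r"
    using multiplicity_decompose'[OF n0] by blast
  have "r = 1"
  proof (rule ccontr)
    assume "r \<noteq> 1"
    then obtain q where "Factorial_Ring.prime q" "q dvd r" using prime_factor_nat by blast
    then show False using only_p[of q] r by (metis dvd_mult)
  qed
  then show ?thesis using r(1) by auto
qed

text \<open>The target of \<rho> carries no group structure: the fibres of \<rho> only have to form
  a congruence. The quotient is built on codes of the values. This serves both for homomorphisms
  with cosets as values and for integer matrices reduced modulo m.\<close>

lemma (in group) finite_p_group_of_fun:
  fixes \<rho> :: "'a \<Rightarrow> 'm"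
  assumes p: "Factorial_Ring.prime p" and fin: "finite (\<rho> ` carrier G)"
    and compat: "\<And>x x' y y'. \<lbrakk>x \<in> carrier G; x' \<in> carrier G; y \<in> carrier G; y' \<in> carrier G;
      \<rho> x = \<rho> x'; \<rho> y = \<rho> y'\<rbrakk> \<Longrightarrow> \<rho> (x \<otimes> y) = \<rho> (x' \<otimes> y')"
    and tors: "\<And>x. x \<in> carrier G \<Longrightarrow> \<exists>e. \<rho> (x [^] (p ^ e)) = \<rho> \<one>"
    and a: "a \<in> carrier G"
    and nconj: "\<And>g. g \<in> carrier G \<Longrightarrow> \<rho> (inv g \<otimes> a \<otimes> g) \<noteq> \<rho> b" and b: "b \<in> carrier G"
  shows "\<exists>(Q :: nat monoid) \<psi>. finite_p_group p Q \<and> \<psi> \<in> hom G Q \<and>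
            \<psi> ` carrier G = carrier Q \<and> \<not> conjugate_in Q (\<psi> a) (\<psi> b)"
proof -
  define f where "f x = to_nat_on (\<rho> ` carrier G) (\<rho> x)" for x
  have f_eq: "f x = f y \<longleftrightarrow> \<rho> x = \<rho> y" if "x \<in> carrier G" "y \<in> carrier G" for x y
    unfolding f_def using that fin by (simp add: countable_finite)
  \<comment> \<open>A code is multiplied through a chosen preimage in G, and \<open>compat\<close>
    makes the choice immaterial.\<close>
  define s where "s = inv_into (carrier G) f"
  define Q :: "nat monoid" where
    "Q = \<lparr>carrier = f ` carrier G, monoid.mult = \<lambda>u v. f (s u \<otimes> s v), one = f \<one>\<rparr>"
  have s: "s (f x) \<in> carrier G" "f (s (f x)) = f x" if "x \<in> carrier G" for x
    unfolding s_def using that by (auto intro: inv_into_into f_inv_into_f)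
  have mult: "f x \<otimes>\<^bsub>Q\<^esub> f y = f (x \<otimes> y)" if "x \<in> carrier G" "y \<in> carrier G" for x y
  proof -
    have "\<rho> (s (f x) \<otimes> s (f y)) = \<rho> (x \<otimes> y)"
      using compat s that f_eq by metis
    then show ?thesis unfolding Q_def using s that f_eq by simp
  qed
  have car: "carrier Q = f ` carrier G" and one: "\<one>\<^bsub>Q\<^esub> = f \<one>" by (auto simp: Q_def)
  interpret Q: group Q
  proof (rule groupI)
    show "\<one>\<^bsub>Q\<^esub> \<in> carrier Q" by (simp add: car one)
  next
    fix u v assume "u \<in> carrier Q" "v \<in> carrier Q"
    then show "u \<otimes>\<^bsub>Q\<^esub> v \<in> carrier Q" unfolding car by (auto simp: mult)
  next
    fix u v w assume "u \<in> carrier Q" "v \<in> carrier Q" "w \<in> carrier Q"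
    then show "u \<otimes>\<^bsub>Q\<^esub> v \<otimes>\<^bsub>Q\<^esub> w = u \<otimes>\<^bsub>Q\<^esub> (v \<otimes>\<^bsub>Q\<^esub> w)"
      unfolding car by (auto simp: mult m_assoc)
  next
    fix u assume "u \<in> carrier Q"
    then show "\<one>\<^bsub>Q\<^esub> \<otimes>\<^bsub>Q\<^esub> u = u" unfolding car one by (auto simp: mult)
  next
    fix u assume "u \<in> carrier Q"
    then obtain x where x: "u = f x" "x \<in> carrier G" unfolding car by (rule imageE)
    then have "f (inv x) \<otimes>\<^bsub>Q\<^esub> u = \<one>\<^bsub>Q\<^esub>" by (simp add: mult one)
    then show "\<exists>y\<in>carrier Q. y \<otimes>\<^bsub>Q\<^esub> u = \<one>\<^bsub>Q\<^esub>" using x unfolding car by blast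
  qed
  interpret f: group_hom G Q f
    by standard (auto simp: hom_def car mult)
  have "finite (carrier Q)" unfolding car f_def using fin by (simp flip: image_image)
  moreover have "\<exists>e. u [^]\<^bsub>Q\<^esub> (p ^ e) = \<one>\<^bsub>Q\<^esub>" if "u \<in> carrier Q" for u
  proof -
    obtain x where x: "u = f x" "x \<in> carrier G" using \<open>u \<in> carrier Q\<close> unfolding car by (rule imageE)
    obtain e where "\<rho> (x [^] (p ^ e)) = \<rho> \<one>" using tors x(2) by blast
    then have "f (x [^] (p ^ e)) = f \<one>" by (metis f_eq nat_pow_closed one_closed x(2))
    then show ?thesis using x f.hom_nat_pow by (metis one)
  qed
  ultimately have "finite_p_group p Q"
    unfolding finite_p_group_def using Q.is_group Q.card_eq_prime_power[OF p] by blast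
  moreover have "\<not> conjugate_in Q (f a) (f b)"
  proof
    assume "conjugate_in Q (f a) (f b)"
    then obtain u where u: "u \<in> carrier Q" "f b = inv\<^bsub>Q\<^esub> u \<otimes>\<^bsub>Q\<^esub> f a \<otimes>\<^bsub>Q\<^esub> u"
      unfolding conjugate_in_def by blast
    obtain g where g: "u = f g" "g \<in> carrier G" using u(1) unfolding car by (rule imageE)
    have "f b = f (inv g \<otimes> a \<otimes> g)" using u g a by (simp add: mult)
    then have "\<rho> (inv g \<otimes> a \<otimes> g) = \<rho> b" using f_eq[of "inv g \<otimes> a \<otimes> g" b] a b g by simp
    then show False using nconj g by blast
  qed
  moreover have "f \<in> hom G Q" by (rule f.homh)
  ultimately show ?thesis using car by metis
qed

section \<open>Amalgamated products and cyclically reduced words\<close>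

context group
begin

lemma conjugate_in_refl: "a \<in> carrier G \<Longrightarrow> conjugate_in G a a"
  unfolding conjugate_in_def by (rule bexI[of _ \<one>]) auto

lemma conjugate_in_trans:
  assumes "a \<in> carrier G" "conjugate_in G a b" "conjugate_in G b c"
  shows "conjugate_in G a c"
proof -
  obtain g h where g: "g \<in> carrier G" "b = inv g \<otimes> a \<otimes> g" and h: "h \<in> carrier G" "c = inv h \<otimes> b \<otimes> h"
    using assms(2,3) unfolding conjugate_in_def by blast
  have "c = inv (g \<otimes> h) \<otimes> a \<otimes> (g \<otimes> h)" using g h assms(1) by (simp add: inv_mult_group m_assoc)
  then show ?thesis unfolding conjugate_in_def using g(1) h(1) by blast
qed

lemma conjugate_in_sym:
  assumes "a \<in> carrier G" "conjugate_in G a b"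
  shows "conjugate_in G b a"
proof -
  obtain g where g: "g \<in> carrier G" "b = inv g \<otimes> a \<otimes> g"
    using assms(2) unfolding conjugate_in_def by blast
  have "a = inv (inv g) \<otimes> b \<otimes> inv g" using g assms(1) by (simp add: m_assoc)
  then show ?thesis unfolding conjugate_in_def using g(1) by blast
qed

lemma conjugate_in_mult_commute:
  assumes "x \<in> carrier G" "y \<in> carrier G"
  shows "conjugate_in G (x \<otimes> y) (y \<otimes> x)"
  unfolding conjugate_in_def using assms by (intro bexI[of _ x]) (simp_all add: m_assoc)

end

section \<open>Words and their classes in the amalgamated product\<close>

lemma amal_eq_append:
  assumes "amal_eq H K A \<phi> u u'" "amal_eq H K A \<phi> v v'"
  shows "amal_eq H K A \<phi> (u @ v) (u' @ v')"
proof -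
  have "amal_eq H K A \<phi> ([] @ u @ v) ([] @ u' @ v)" using assms(1) by (rule amal_eq.congr)
  moreover have "amal_eq H K A \<phi> (u' @ v @ []) (u' @ v' @ [])" using assms(2) by (rule amal_eq.congr)
  ultimately show ?thesis using amal_eq.trans by fastforce
qed

lemma amal_class_eq_iff:
  "amal_class H K A \<phi> u = amal_class H K A \<phi> v \<longleftrightarrow> amal_eq H K A \<phi> u v"
proof
  assume "amal_class H K A \<phi> u = amal_class H K A \<phi> v"
  moreover have "v \<in> amal_class H K A \<phi> v" by (simp add: amal_class_def amal_eq.refl)
  ultimately show "amal_eq H K A \<phi> u v" by (auto simp: amal_class_def)
next
  assume "amal_eq H K A \<phi> u v"
  then show "amal_class H K A \<phi> u = amal_class H K A \<phi> v"
    unfolding amal_class_def using amal_eq.sym amal_eq.trans by fast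
qed

lemma amal_class_some: "amal_eq H K A \<phi> w (SOME x. x \<in> amal_class H K A \<phi> w)"
proof -
  have "w \<in> amal_class H K A \<phi> w" by (simp add: amal_class_def amal_eq.refl)
  then have "(SOME x. x \<in> amal_class H K A \<phi> w) \<in> amal_class H K A \<phi> w" by (rule someI)
  then show ?thesis by (simp add: amal_class_def)
qed

lemma amal_words_simps [simp]:
  "[] \<in> amal_words H K"
  "Inl h # w \<in> amal_words H K \<longleftrightarrow> h \<in> carrier H \<and> w \<in> amal_words H K"
  "Inr k # w \<in> amal_words H K \<longleftrightarrow> k \<in> carrier K \<and> w \<in> amal_words H K"
  "u @ v \<in> amal_words H K \<longleftrightarrow> u \<in> amal_words H K \<and> v \<in> amal_words H K"
  "rotate i w \<in> amal_words H K \<longleftrightarrow> w \<in> amal_words H K"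
  by (auto simp: amal_words_def)

locale amalgam = H: group H + K: group K
  for H :: "('h, 'c) monoid_scheme" and K :: "('k, 'd) monoid_scheme" and A B and \<phi> +
  assumes A: "central_subgroup A H" and B: "central_subgroup B K"
    and \<phi>: "\<phi> \<in> iso (H\<lparr>carrier := A\<rparr>) (K\<lparr>carrier := B\<rparr>)"
begin

abbreviation "G \<equiv> amalgamated_product H K A \<phi>"
abbreviation "cl \<equiv> amal_class H K A \<phi>"
abbreviation "words \<equiv> amal_words H K"

lemma A_subgroup: "subgroup A H" and B_subgroup: "subgroup B K"
  using A B by (auto simp: central_subgroup_def)

lemma A_subset: "A \<subseteq> carrier H" and B_subset: "B \<subseteq> carrier K"
  by (rule subgroup.subset[OF A_subgroup] subgroup.subset[OF B_subgroup])+

lemma \<phi>_image: "\<phi> ` A = B" and \<phi>_inj: "inj_on \<phi> A"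
  using \<phi> by (auto simp: iso_def bij_betw_def)

lemma \<phi>_in_B: "a \<in> A \<Longrightarrow> \<phi> a \<in> B"
  using \<phi>_image by blast

lemma \<phi>_in_K: "a \<in> A \<Longrightarrow> \<phi> a \<in> carrier K"
  using \<phi>_in_B B_subset by blast

lemma \<phi>_mult: "a \<in> A \<Longrightarrow> b \<in> A \<Longrightarrow> \<phi> (a \<otimes>\<^bsub>H\<^esub> b) = \<phi> a \<otimes>\<^bsub>K\<^esub> \<phi> b"
  using \<phi> by (auto simp: iso_def hom_def)

text \<open>The rules \<open>refl\<close> and \<open>congr\<close> admit letters outside the
  carriers, so it has to be checked that no class mixes words over the carriers with other
  lists.\<close>

lemma amal_eq_words: "amal_eq H K A \<phi> u v \<Longrightarrow> u \<in> words \<longleftrightarrow> v \<in> words"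
  by (induction rule: amal_eq.induct) (use A_subset \<phi>_in_K in auto)

lemma carrier_amalgam: "carrier G = cl ` words"
  and one_amalgam: "\<one>\<^bsub>G\<^esub> = cl []"
  by (auto simp: amalgamated_product_def)

lemma mult_amalgam: "cl u \<otimes>\<^bsub>G\<^esub> cl v = cl (u @ v)"
proof -
  have "cl (u @ v) = cl ((SOME x. x \<in> cl u) @ (SOME y. y \<in> cl v))"
    unfolding amal_class_eq_iff by (rule amal_eq_append[OF amal_class_some amal_class_some])
  then show ?thesis by (simp add: amalgamated_product_def)
qed

lemma cl_closed [simp, intro]: "w \<in> words \<Longrightarrow> cl w \<in> carrier G"
  by (auto simp: carrier_amalgam)

lemma cl_cong: "amal_eq H K A \<phi> u v \<Longrightarrow> cl (u @ w) = cl (v @ w)"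
  unfolding amal_class_eq_iff by (rule amal_eq_append[OF _ amal_eq.refl])

lemma cl_multH: "h \<in> carrier H \<Longrightarrow> h' \<in> carrier H \<Longrightarrow> cl (Inl h # Inl h' # w) = cl (Inl (h \<otimes>\<^bsub>H\<^esub> h') # w)"
  using cl_cong[OF amal_eq.multH, of h h' w] by simp

lemma cl_multK: "k \<in> carrier K \<Longrightarrow> k' \<in> carrier K \<Longrightarrow> cl (Inr k # Inr k' # w) = cl (Inr (k \<otimes>\<^bsub>K\<^esub> k') # w)"
  using cl_cong[OF amal_eq.multK, of k k' w] by simp

lemma cl_oneH: "cl (Inl \<one>\<^bsub>H\<^esub> # w) = cl w"
  using cl_cong[OF amal_eq.oneH, of w] by simp

lemma cl_oneK: "cl (Inr \<one>\<^bsub>K\<^esub> # w) = cl w"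
  using cl_cong[OF amal_eq.oneK, of w] by simp

lemma cl_amalg: "a \<in> A \<Longrightarrow> cl (Inl a # w) = cl (Inr (\<phi> a) # w)"
  using cl_cong[OF amal_eq.amalg, of a w] by simp

lemma group_amalgam: "group G"
proof (rule groupI)
  show "\<one>\<^bsub>G\<^esub> \<in> carrier G" by (simp add: one_amalgam cl_closed)
next
  fix x y assume "x \<in> carrier G" "y \<in> carrier G"
  then show "x \<otimes>\<^bsub>G\<^esub> y \<in> carrier G" unfolding carrier_amalgam by (auto simp: mult_amalgam)
next
  fix x y z assume "x \<in> carrier G" "y \<in> carrier G" "z \<in> carrier G"
  then show "x \<otimes>\<^bsub>G\<^esub> y \<otimes>\<^bsub>G\<^esub> z = x \<otimes>\<^bsub>G\<^esub> (y \<otimes>\<^bsub>G\<^esub> z)"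
    unfolding carrier_amalgam by (auto simp: mult_amalgam)
next
  fix x assume "x \<in> carrier G"
  then show "\<one>\<^bsub>G\<^esub> \<otimes>\<^bsub>G\<^esub> x = x" unfolding carrier_amalgam by (auto simp: mult_amalgam one_amalgam)
next
  fix x assume "x \<in> carrier G"
  then obtain w where w: "x = cl w" "w \<in> words" unfolding carrier_amalgam by (rule imageE)
  \<comment> \<open>A left inverse is built letter by letter: the inverse of the new first letter is
    appended on the right.\<close>
  have "\<exists>v\<in>words. cl (v @ w) = cl []"
    using w(2)
  proof (induction w)
    case Nil
    then show ?case by (intro bexI[of _ "[]"]) auto
  next
    case (Cons l w)
    show ?case
    proof (cases l)
      case (Inl h)
      then obtain v where v: "v \<in> words" "cl (v @ w) = cl []" using Cons by auto
      have "h \<in> carrier H" using Cons.prems Inl by simp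
      have "cl (v @ [Inl (inv\<^bsub>H\<^esub> h)] @ l # w) = cl v \<otimes>\<^bsub>G\<^esub> cl (Inl (inv\<^bsub>H\<^esub> h) # Inl h # w)"
        by (simp add: mult_amalgam Inl)
      also have "\<dots> = cl v \<otimes>\<^bsub>G\<^esub> cl w" using \<open>h \<in> carrier H\<close> by (simp add: cl_multH cl_oneH)
      finally have "cl ((v @ [Inl (inv\<^bsub>H\<^esub> h)]) @ l # w) = cl []" using v by (simp add: mult_amalgam)
      then show ?thesis using v(1) \<open>h \<in> carrier H\<close> by (intro bexI[of _ "v @ [Inl (inv\<^bsub>H\<^esub> h)]"]) simp_all
    next
      case (Inr k)
      then obtain v where v: "v \<in> words" "cl (v @ w) = cl []" using Cons by auto
      have "k \<in> carrier K" using Cons.prems Inr by simp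
      have "cl (v @ [Inr (inv\<^bsub>K\<^esub> k)] @ l # w) = cl v \<otimes>\<^bsub>G\<^esub> cl (Inr (inv\<^bsub>K\<^esub> k) # Inr k # w)"
        by (simp add: mult_amalgam Inr)
      also have "\<dots> = cl v \<otimes>\<^bsub>G\<^esub> cl w" using \<open>k \<in> carrier K\<close> by (simp add: cl_multK cl_oneK)
      finally have "cl ((v @ [Inr (inv\<^bsub>K\<^esub> k)]) @ l # w) = cl []" using v by (simp add: mult_amalgam)
      then show ?thesis using v(1) \<open>k \<in> carrier K\<close> by (intro bexI[of _ "v @ [Inr (inv\<^bsub>K\<^esub> k)]"]) simp_all
    qed
  qed
  then show "\<exists>y\<in>carrier G. y \<otimes>\<^bsub>G\<^esub> x = \<one>\<^bsub>G\<^esub>"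
    unfolding w(1) one_amalgam by (metis cl_closed mult_amalgam)
qed

sublocale G: group G by (rule group_amalgam)

definition ev :: "('m, 'z) monoid_scheme \<Rightarrow> ('h \<Rightarrow> 'm) \<Rightarrow> ('k \<Rightarrow> 'm) \<Rightarrow> ('h + 'k) list \<Rightarrow> 'm" where
  "ev M \<alpha> \<beta> w = foldr (\<lambda>l m. case_sum \<alpha> \<beta> l \<otimes>\<^bsub>M\<^esub> m) w \<one>\<^bsub>M\<^esub>"

lemma ev_simps [simp]:
  "ev M \<alpha> \<beta> [] = \<one>\<^bsub>M\<^esub>"
  "ev M \<alpha> \<beta> (l # w) = case_sum \<alpha> \<beta> l \<otimes>\<^bsub>M\<^esub> ev M \<alpha> \<beta> w"
  by (simp_all add: ev_def)

text \<open>The target is only a monoid, so matrices can serve as images with no discussion of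
  invertibility. Preservation of the unit is therefore assumed, since a multiplicative map into a
  monoid does not give it.\<close>

lemma amalgam_universal:
  assumes M: "monoid M" and \<alpha>: "\<alpha> \<in> hom H M" "\<alpha> \<one>\<^bsub>H\<^esub> = \<one>\<^bsub>M\<^esub>"
    and \<beta>: "\<beta> \<in> hom K M" "\<beta> \<one>\<^bsub>K\<^esub> = \<one>\<^bsub>M\<^esub>"
    and eq: "\<And>a. a \<in> A \<Longrightarrow> \<alpha> a = \<beta> (\<phi> a)"
  obtains \<Phi> where "\<Phi> \<in> hom G M" "\<Phi> \<one>\<^bsub>G\<^esub> = \<one>\<^bsub>M\<^esub>" "\<And>w. w \<in> words \<Longrightarrow> \<Phi> (cl w) = ev M \<alpha> \<beta> w"
proof -
  interpret M: monoid M by (rule M)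
  let ?ev = "ev M \<alpha> \<beta>"
  have \<alpha>c: "\<alpha> h \<in> carrier M" if "h \<in> carrier H" for h using \<alpha>(1) that by (auto simp: hom_def)
  have \<beta>c: "\<beta> k \<in> carrier M" if "k \<in> carrier K" for k using \<beta>(1) that by (auto simp: hom_def)
  have closed: "?ev w \<in> carrier M" if "w \<in> words" for w
    using that
  proof (induction w)
    case (Cons l w)
    then show ?case by (cases l) (auto intro!: M.m_closed \<alpha>c \<beta>c)
  qed simp
  have app: "?ev (u @ v) = ?ev u \<otimes>\<^bsub>M\<^esub> ?ev v" if "u \<in> words" "v \<in> words" for u v
    using that(1)
  proof (induction u)
    case Nil
    then show ?case using closed[OF that(2)] by simp
  next
    case (Cons l u)
    then show ?case using closed that(2) by (cases l) (auto simp: M.m_assoc \<alpha>c \<beta>c)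
  qed
  have inv: "?ev u = ?ev v" if "amal_eq H K A \<phi> u v" "u \<in> words" for u v
    using that
  proof (induction rule: amal_eq.induct)
    case (sym u v)
    then show ?case using amal_eq_words by metis
  next
    case (trans u v w)
    then show ?case using amal_eq_words by metis
  next
    case (congr u v x y)
    then have "u \<in> words" "v \<in> words" "x \<in> words" "y \<in> words" using amal_eq_words by auto
    then show ?case using congr.IH by (simp add: app)
  next
    case (multH h1 h2)
    then show ?case using \<alpha> \<alpha>c by (simp add: hom_def)
  next
    case (multK k1 k2)
    then show ?case using \<beta> \<beta>c by (simp add: hom_def)
  next
    case (amalg a)
    then show ?case using eq by simp
  qed (use \<alpha> \<beta> in simp_all)
  define \<Phi> where "\<Phi> Q = ?ev (SOME x. x \<in> Q)" for Q
  have \<Phi>: "\<Phi> (cl w) = ?ev w" if "w \<in> words" for w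
    unfolding \<Phi>_def using inv[OF amal_class_some that] by simp
  have "\<Phi> \<in> hom G M"
    unfolding hom_def carrier_amalgam by (auto simp: mult_amalgam \<Phi> closed app)
  moreover have "\<Phi> \<one>\<^bsub>G\<^esub> = \<one>\<^bsub>M\<^esub>" using \<Phi>[of "[]"] by (simp add: one_amalgam)
  ultimately show ?thesis using that \<Phi> by blast
qed

end

section \<open>Cyclic reduction of words\<close>

context amalgam
begin

text \<open>These are the cyclically reduced words of length at least 2, rotated so as to begin in
  H. Even length means that the last letter lies in K, so that it cannot be merged with the first
  one.\<close>

definition cyc_reduced :: "('h + 'k) list \<Rightarrow> bool" where
  "cyc_reduced w \<longleftrightarrow> w \<in> words \<and> 2 \<le> length w \<and> even (length w) \<and>
     (\<forall>j<length w. w ! j \<in> (if even j then Inl ` (carrier H - A) else Inr ` (carrier K - B)))"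

lemma conjugate_rotate:
  assumes "w \<in> words"
  shows "conjugate_in G (cl w) (cl (rotate i w))"
proof -
  let ?i = "i mod length w"
  have *: "take ?i w @ drop ?i w \<in> words" using assms by simp
  then have "take ?i w \<in> words" "drop ?i w \<in> words" by (simp_all only: amal_words_simps)
  then have "conjugate_in G (cl (take ?i w) \<otimes>\<^bsub>G\<^esub> cl (drop ?i w)) (cl (drop ?i w) \<otimes>\<^bsub>G\<^esub> cl (take ?i w))"
    by (intro G.conjugate_in_mult_commute cl_closed)
  then show ?thesis by (simp add: mult_amalgam rotate_drop_take)
qed

text \<open>Among all words that represent conjugates of g a shortest one is chosen. Its rotations
  are shortest too, so no two cyclically adjacent letters can be merged: in length at least 2 they
  come from different factors, and none lies in the amalgamated subgroups.\<close>

lemma conjugate_to_cyc_reduced: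
  assumes g: "g \<in> carrier G"
  shows "\<exists>w\<in>words. conjugate_in G g (cl w) \<and> (length w = 1 \<or> cyc_reduced w)"
proof -
  define S where "S w \<longleftrightarrow> w \<in> words \<and> conjugate_in G g (cl w)" for w
  obtain w0 where "S w0"
    using g G.conjugate_in_refl[OF g] unfolding S_def carrier_amalgam by auto
  then obtain w1 where w1: "S w1" and min: "\<And>v. S v \<Longrightarrow> length w1 \<le> length v"
    using ex_has_least_nat[of S w0 length] by blast
  have rot: "S (rotate i w)" if "S w" for i w
    using that conjugate_rotate G.conjugate_in_trans[OF g] unfolding S_def by (metis amal_words_simps(5))
  \<comment> \<open>The first two letters could be merged if they came from one factor, or if the
    first could be carried to the other factor through \<phi>; either would shorten the
    word.\<close>
  have key: "l1 \<in> Inl ` (carrier H - A) \<and> \<not> isl l2 \<or> l1 \<in> Inr ` (carrier K - B) \<and> isl l2"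
    if S: "S (l1 # l2 # r)" and len: "length w1 = length (l1 # l2 # r)" for l1 l2 r
  proof -
    have short: False if "v \<in> words" "cl v = cl (l1 # l2 # r)" "length v < length w1" for v
      using min[of v] that S unfolding S_def by auto
    have w: "l1 # l2 # r \<in> words" using S by (simp add: S_def)
    show ?thesis
    proof (cases l1)
      case l1: (Inl h)
      show ?thesis
      proof (cases l2)
        case (Inl h')
        then show ?thesis using short[of "Inl (h \<otimes>\<^bsub>H\<^esub> h') # r"] w l1 len by (simp add: cl_multH)
      next
        case (Inr k)
        have "h \<notin> A"
        proof
          assume h: "h \<in> A"
          then have "cl (Inr (\<phi> h \<otimes>\<^bsub>K\<^esub> k) # r) = cl (l1 # l2 # r)"
            using w l1 Inr by (simp add: cl_amalg cl_multK \<phi>_in_K)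
          then show False using short[of "Inr (\<phi> h \<otimes>\<^bsub>K\<^esub> k) # r"] w l1 Inr len h
            by (simp add: \<phi>_in_K)
        qed
        then show ?thesis using l1 Inr w by simp
      qed
    next
      case l1: (Inr k)
      show ?thesis
      proof (cases l2)
        case (Inr k')
        then show ?thesis using short[of "Inr (k \<otimes>\<^bsub>K\<^esub> k') # r"] w l1 len by (simp add: cl_multK)
      next
        case (Inl h)
        have "k \<notin> B"
        proof
          assume "k \<in> B"
          then obtain a where a: "a \<in> A" "k = \<phi> a" using \<phi>_image by blast
          then have "a \<in> carrier H" using A_subset by blast
          then have "cl (Inl (a \<otimes>\<^bsub>H\<^esub> h) # r) = cl (l1 # l2 # r)"
            using w l1 Inl a by (simp add: cl_amalg[symmetric] cl_multH)
          then show False using short[of "Inl (a \<otimes>\<^bsub>H\<^esub> h) # r"] w l1 Inl len \<open>a \<in> carrier H\<close> by simp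
        qed
        then show ?thesis using l1 Inl w by simp
      qed
    qed
  qed
  show ?thesis
  proof (cases "length w1 \<ge> 2")
    case False
    then have "length w1 = 0 \<or> length w1 = 1" by linarith
    then consider "w1 = []" | "length w1 = 1" by blast
    then show ?thesis
    proof cases
      case 1
      \<comment> \<open>The empty word is replaced by the unit of H, so that the short case always
        has length exactly 1.\<close>
      then have "conjugate_in G g (cl [Inl \<one>\<^bsub>H\<^esub>])" using w1 by (simp add: S_def cl_oneH)
      then show ?thesis by (intro bexI[of _ "[Inl \<one>\<^bsub>H\<^esub>]"]) auto
    next
      case 2
      then show ?thesis using w1 unfolding S_def by blast
    qed
  next
    case True
    \<comment> \<open>Letters alternate cyclically between the factors, so at most one rotation is
      needed to begin in H.\<close>
    define w where "w = (if isl (w1 ! 0) then w1 else rotate 1 w1)"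
    have w: "S w" "length w = length w1" using w1 rot[OF w1, of 1] by (auto simp: w_def)
    let ?n = "length w"
    have n2: "?n \<ge> 2" using True w by simp
    have cyc: "l \<in> Inl ` (carrier H - A) \<and> \<not> isl l' \<or> l \<in> Inr ` (carrier K - B) \<and> isl l'"
      if v: "S v" "length v = length w1" "j < length v" "l = v ! j" "l' = v ! (Suc j mod length v)" for v j l l'
    proof -
      have "length (rotate j v) \<ge> 2" using v(2) True by simp
      then obtain l1 l2 r where r: "rotate j v = l1 # l2 # r"
        by (metis One_nat_def Suc_1 Suc_le_length_iff)
      have pos: "0 < length v" "1 < length v" using v(2) True by linarith+
      have l1: "l1 = v ! j" using v(3) nth_rotate[OF pos(1), of j] r by simp
      have l2: "l2 = v ! (Suc j mod length v)" using nth_rotate[OF pos(2), of j] r by simp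
      have "length w1 = length (l1 # l2 # r)" using v(2) length_rotate[of j v] by (simp only: r)
      then show ?thesis using key[of l1 l2 r] rot[OF v(1), of j] unfolding r v(4,5) l1 l2 by blast
    qed
    have "isl (w ! 0)"
    proof (cases "isl (w1 ! 0)")
      case False
      have pos: "0 < length w1" "1 < length w1" using True by linarith+
      then have "isl (w1 ! 1)"
        using cyc[OF w1 HOL.refl pos(1), of "w1 ! 0" "w1 ! 1"] False by auto
      then show ?thesis using False nth_rotate[OF pos(1), of 1] pos(2) by (simp add: w_def)
    qed (simp add: w_def)
    then have par: "isl (w ! j) \<longleftrightarrow> even j" if "j < ?n" for j
      using that
    proof (induction j)
      case (Suc j)
      then show ?case using cyc[OF w, of j "w ! j" "w ! Suc j"] by (auto simp: mod_less)
    qed simp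
    \<comment> \<open>The last and the first letter are cyclically adjacent, hence from different
      factors; together with the alternation this makes the length even.\<close>
    obtain m where m: "?n = Suc m" using n2 by (cases ?n) auto
    then have "isl (w ! m) \<longleftrightarrow> \<not> isl (w ! 0)"
      using cyc[OF w, of m "w ! m" "w ! 0"] by auto
    then have "even ?n" using par[of m] par[of 0] m by auto
    moreover have "w ! j \<in> (if even j then Inl ` (carrier H - A) else Inr ` (carrier K - B))" if "j < ?n" for j
      using cyc[OF w that HOL.refl HOL.refl] par[OF that] by auto
    ultimately have "cyc_reduced w" unfolding cyc_reduced_def using n2 w(1) by (auto simp: S_def)
    then show ?thesis using w(1) unfolding S_def by blast
  qed
qed

end

section \<open>Matrices and polynomial traces\<close>

definition mat_mult :: "'s set \<Rightarrow> ('s \<Rightarrow> 's \<Rightarrow> int) \<Rightarrow> ('s \<Rightarrow> 's \<Rightarrow> int) \<Rightarrow> 's \<Rightarrow> 's \<Rightarrow> int" where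
  "mat_mult S M N = (\<lambda>x y. \<Sum>z\<in>S. M x z * N z y)"

definition mat_one :: "'s set \<Rightarrow> 's \<Rightarrow> 's \<Rightarrow> int" where
  "mat_one S = (\<lambda>x y. if x \<in> S \<and> x = y then 1 else 0)"

text \<open>Entries outside S are required to vanish, so that equality of matrices is equality of
  functions and \<open>mat_one S\<close> is a unit on both sides for finite S.\<close>

definition mats :: "'s set \<Rightarrow> ('s \<Rightarrow> 's \<Rightarrow> int) set" where
  "mats S = {M. \<forall>x y. M x y \<noteq> 0 \<longrightarrow> x \<in> S \<and> y \<in> S}"

definition mat_monoid :: "'s set \<Rightarrow> ('s \<Rightarrow> 's \<Rightarrow> int) monoid" where
  "mat_monoid S = \<lparr>carrier = mats S, monoid.mult = mat_mult S, one = mat_one S\<rparr>"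

definition mat_trace :: "'s set \<Rightarrow> ('s \<Rightarrow> 's \<Rightarrow> int) \<Rightarrow> int" where
  "mat_trace S M = (\<Sum>x\<in>S. M x x)"

definition mat_cong :: "int \<Rightarrow> ('s \<Rightarrow> 's \<Rightarrow> int) \<Rightarrow> ('s \<Rightarrow> 's \<Rightarrow> int) \<Rightarrow> bool" where
  "mat_cong m M N \<longleftrightarrow> (\<forall>x y. m dvd M x y - N x y)"

lemma mat_monoid_simps [simp]:
  "carrier (mat_monoid S) = mats S" "monoid.mult (mat_monoid S) = mat_mult S"
  "one (mat_monoid S) = mat_one S"
  by (simp_all add: mat_monoid_def)

lemma mat_mult_assoc: "mat_mult S (mat_mult S L M) N = mat_mult S L (mat_mult S M N)"
proof (intro ext)
  fix x y
  have "(\<Sum>z\<in>S. (\<Sum>w\<in>S. L x w * M w z) * N z y) = (\<Sum>z\<in>S. \<Sum>w\<in>S. L x w * M w z * N z y)"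
    by (simp add: sum_distrib_right)
  also have "\<dots> = (\<Sum>w\<in>S. \<Sum>z\<in>S. L x w * M w z * N z y)" by (rule sum.swap)
  also have "\<dots> = (\<Sum>w\<in>S. L x w * (\<Sum>z\<in>S. M w z * N z y))"
    by (simp add: sum_distrib_left mult.assoc)
  finally show "mat_mult S (mat_mult S L M) N x y = mat_mult S L (mat_mult S M N) x y"
    by (simp add: mat_mult_def)
qed

lemma mat_one_in_mats: "mat_one S \<in> mats S"
  by (simp add: mats_def mat_one_def)

lemma mat_mult_in_mats: "M \<in> mats S \<Longrightarrow> N \<in> mats S \<Longrightarrow> mat_mult S M N \<in> mats S"
  unfolding mats_def mat_mult_def
  by (simp, metis (mono_tags, lifting) mult_zero_left mult_zero_right sum.neutral)

lemma mat_mult_one_left: "finite S \<Longrightarrow> M \<in> mats S \<Longrightarrow> mat_mult S (mat_one S) M = M"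
proof (intro ext)
  fix x y assume S: "finite S" and M: "M \<in> mats S"
  have "(\<Sum>z\<in>S. mat_one S x z * M z y) = (\<Sum>z\<in>S. if x = z then M x y else 0)"
    by (intro sum.cong) (auto simp: mat_one_def)
  also have "\<dots> = M x y" using S M by (auto simp: mats_def)
  finally show "mat_mult S (mat_one S) M x y = M x y" by (simp add: mat_mult_def)
qed

lemma mat_mult_one_right: "finite S \<Longrightarrow> M \<in> mats S \<Longrightarrow> mat_mult S M (mat_one S) = M"
proof (intro ext)
  fix x y assume S: "finite S" and M: "M \<in> mats S"
  have "(\<Sum>z\<in>S. M x z * mat_one S z y) = (\<Sum>z\<in>S. if z = y then M x y else 0)"
    by (intro sum.cong) (auto simp: mat_one_def)
  also have "\<dots> = M x y" using S M by (auto simp: mats_def)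
  finally show "mat_mult S M (mat_one S) x y = M x y" by (simp add: mat_mult_def)
qed

lemma monoid_mat_monoid: "finite S \<Longrightarrow> monoid (mat_monoid S)"
  by standard
    (simp_all add: mat_one_in_mats mat_mult_in_mats mat_mult_assoc mat_mult_one_left mat_mult_one_right)

lemma mat_trace_commute: "mat_trace S (mat_mult S M N) = mat_trace S (mat_mult S N M)"
  unfolding mat_trace_def mat_mult_def by (subst sum.swap) (simp add: mult.commute)

lemma mat_cong_refl: "mat_cong m M M"
  by (simp add: mat_cong_def)

lemma mat_cong_mult:
  assumes "mat_cong m M M'" "mat_cong m N N'"
  shows "mat_cong m (mat_mult S M N) (mat_mult S M' N')"
  unfolding mat_cong_def
proof (intro allI)
  fix x y
  have "mat_mult S M N x y - mat_mult S M' N' x y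
      = (\<Sum>z\<in>S. (M x z - M' x z) * N z y + M' x z * (N z y - N' z y))"
    by (simp add: mat_mult_def algebra_simps flip: sum_subtractf)
  then show "m dvd mat_mult S M N x y - mat_mult S M' N' x y"
    using assms unfolding mat_cong_def by (simp add: dvd_sum)
qed

lemma mat_cong_trace: "mat_cong m M N \<Longrightarrow> m dvd mat_trace S M - mat_trace S N"
  unfolding mat_cong_def mat_trace_def by (auto simp flip: sum_subtractf intro: dvd_sum)

section \<open>Congruences for powers of matrices\<close>

context
  fixes S :: "'s set" and p :: nat
  assumes S: "finite S"
begin

interpretation M: monoid "mat_monoid S" by (rule monoid_mat_monoid[OF S])

lemma mat_pow_closed: "M \<in> mats S \<Longrightarrow> M [^]\<^bsub>mat_monoid S\<^esub> (i::nat) \<in> mats S"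
  using M.nat_pow_closed by simp

text \<open>With M = 1 + X and X divisible by \<open>p ^ j\<close>, the i-th power of M is 1 + i X
  up to products of two deviations. Such products are divisible by \<open>p ^ (j + j)\<close>, hence
  by \<open>p ^ Suc j\<close> because j is positive.\<close>

lemma mat_pow_cong_one:
  assumes M: "M \<in> mats S" and j: "j \<ge> 1" and c: "mat_cong (int p ^ j) M (mat_one S)"
  shows "int p ^ Suc j dvd (M [^]\<^bsub>mat_monoid S\<^esub> i) x y - mat_one S x y - int i * (M x y - mat_one S x y)"
proof (induction i arbitrary: x y)
  case 0
  then show ?case by simp
next
  case (Suc i)
  let ?P = "M [^]\<^bsub>mat_monoid S\<^esub> i" and ?I = "mat_one S"
  have dM: "int p ^ j dvd M z w - ?I z w" for z w
    using c by (simp add: mat_cong_def)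
  have "int p ^ j dvd int p ^ Suc j" by simp
  then have dP: "int p ^ j dvd ?P z w - ?I z w" for z w
    using dvd_add[OF dvd_trans[OF _ Suc[of z w]] dvd_mult[OF dM[of z w], of "int i"]] by simp
  have "int p ^ Suc j dvd int p ^ (j + j)" using j by (intro le_imp_power_dvd) simp
  then have d: "int p ^ Suc j dvd (\<Sum>z\<in>S. (?P x z - ?I x z) * (M z y - ?I z y))"
    using mult_dvd_mono[OF dP dM] by (intro dvd_sum) (metis dvd_trans power_add)
  \<comment> \<open>The error added in this step is the product of the two deviations from the unit
    matrix.\<close>
  have "(\<Sum>z\<in>S. (?P x z - ?I x z) * (M z y - ?I z y))
      = mat_mult S ?P M x y - mat_mult S ?P ?I x y - mat_mult S ?I M x y + mat_mult S ?I ?I x y"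
    unfolding mat_mult_def by (simp add: algebra_simps sum.distrib sum_subtractf)
  also have "\<dots> = (M [^]\<^bsub>mat_monoid S\<^esub> Suc i) x y - ?P x y - M x y + ?I x y"
    using S M mat_pow_closed[OF M, of i]
    by (simp add: mat_mult_one_left mat_mult_one_right mat_one_in_mats)
  finally have "(M [^]\<^bsub>mat_monoid S\<^esub> Suc i) x y - ?I x y - int (Suc i) * (M x y - ?I x y)
      = (\<Sum>z\<in>S. (?P x z - ?I x z) * (M z y - ?I z y)) + (?P x y - ?I x y - int i * (M x y - ?I x y))"
    by (simp add: algebra_simps)
  then show ?case by (simp only: dvd_add[OF d Suc[of x y]])
qed

text \<open>A p-th power multiplies the linear deviation by p, so each p-th power raises the modulus
  by one factor p. Thus matrices congruent to 1 modulo p satisfy a p-power torsion law modulo every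
  power of p.\<close>

lemma mat_pow_prime_power_cong_one:
  assumes M: "M \<in> mats S" and c: "mat_cong (int p) M (mat_one S)"
  shows "mat_cong (int p ^ Suc k) (M [^]\<^bsub>mat_monoid S\<^esub> (p ^ k)) (mat_one S)"
proof (induction k)
  case 0
  then show ?case using M c by (simp add: mat_mult_one_left[OF S])
next
  case (Suc k)
  let ?N = "M [^]\<^bsub>mat_monoid S\<^esub> (p ^ k)"
  have N: "?N \<in> mats S" by (rule mat_pow_closed[OF M])
  have "int p ^ Suc (Suc k) dvd (?N [^]\<^bsub>mat_monoid S\<^esub> p) x y - mat_one S x y" for x y
  proof -
    have "int p ^ Suc k dvd ?N x y - mat_one S x y"
      using Suc by (simp add: mat_cong_def)
    then have "int p ^ Suc (Suc k) dvd int p * (?N x y - mat_one S x y)" by simp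
    from dvd_add[OF mat_pow_cong_one[OF N _ Suc, of p x y] this] show ?thesis by simp
  qed
  moreover have "?N [^]\<^bsub>mat_monoid S\<^esub> p = M [^]\<^bsub>mat_monoid S\<^esub> (p ^ Suc k)"
    using M by (simp add: M.nat_pow_pow mult.commute)
  ultimately show ?case by (simp add: mat_cong_def)
qed

end

section \<open>Residues of matrices and matrices of partial maps\<close>

definition mat_mod :: "int \<Rightarrow> ('s \<Rightarrow> 's \<Rightarrow> int) \<Rightarrow> 's \<Rightarrow> 's \<Rightarrow> int" where
  "mat_mod m M = (\<lambda>x y. M x y mod m)"

lemma mat_mod_eq_iff: "mat_mod m M = mat_mod m N \<longleftrightarrow> mat_cong m M N"
  by (auto simp: mat_mod_def mat_cong_def mod_eq_dvd_iff fun_eq_iff)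

lemma finite_mat_mod:
  assumes "finite S" "m > 0"
  shows "finite (mat_mod m ` mats S)"
proof -
  let ?F = "{f. \<forall>z. (z \<in> S \<times> S \<longrightarrow> f z \<in> {0..<m}) \<and> (z \<notin> S \<times> S \<longrightarrow> f z = (0::int))}"
  have "finite ?F" using assms(1) by (intro finite_set_of_finite_funs) auto
  moreover have "mat_mod m ` mats S \<subseteq> curry ` ?F"
  proof
    fix M assume "M \<in> mat_mod m ` mats S"
    then obtain N where N: "M = mat_mod m N" "N \<in> mats S" by (rule imageE)
    have "N a b = 0" if "\<not> (a \<in> S \<and> b \<in> S)" for a b using N(2) that by (auto simp: mats_def)
    then have "case_prod M \<in> ?F" using assms(2) N(1) by (auto simp: mat_mod_def)
    then have "curry (case_prod M) \<in> curry ` ?F" by (rule imageI)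
    then show "M \<in> curry ` ?F" by simp
  qed
  ultimately show ?thesis using finite_surj by blast
qed

text \<open>Rows are arguments and columns are values, so a product of matrices applies the left map
  first, an undefined value gives a zero row, and the trace counts fixed points.\<close>

definition pmat :: "'s set \<Rightarrow> ('s \<Rightarrow> 's option) \<Rightarrow> 's \<Rightarrow> 's \<Rightarrow> int" where
  "pmat S f = (\<lambda>x y. if x \<in> S \<and> y \<in> S \<and> f x = Some y then 1 else 0)"

lemma pmat_in_mats: "pmat S f \<in> mats S"
  by (simp add: pmat_def mats_def)

lemma pmat_cong: "(\<And>x. x \<in> S \<Longrightarrow> f x = g x) \<Longrightarrow> pmat S f = pmat S g"
  by (auto simp: pmat_def fun_eq_iff)

lemma pmat_Some: "pmat S Some = mat_one S"
  by (auto simp: pmat_def mat_one_def fun_eq_iff)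

lemma mat_mult_pmat:
  assumes "finite S" "\<And>x y. x \<in> S \<Longrightarrow> f x = Some y \<Longrightarrow> y \<in> S"
  shows "mat_mult S (pmat S f) (pmat S g) = pmat S (\<lambda>x. Option.bind (f x) g)"
proof (intro ext)
  fix x y
  show "mat_mult S (pmat S f) (pmat S g) x y = pmat S (\<lambda>x. Option.bind (f x) g) x y"
  proof (cases "x \<in> S \<and> f x \<noteq> None")
    case True
    then obtain z where z: "f x = Some z" "z \<in> S" "x \<in> S" using assms(2) by auto
    have "mat_mult S (pmat S f) (pmat S g) x y = (\<Sum>w\<in>S. if w = z then pmat S g z y else 0)"
      unfolding mat_mult_def using z by (intro sum.cong) (auto simp: pmat_def)
    then show ?thesis using z assms(1) by (simp add: pmat_def)
  next
    case False
    then have "pmat S f x z = 0" for z by (auto simp: pmat_def)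
    then show ?thesis using False by (auto simp: mat_mult_def pmat_def)
  qed
qed

lemma mat_trace_pmat: "finite S \<Longrightarrow> mat_trace S (pmat S f) = int (card {x \<in> S. f x = Some x})"
  unfolding mat_trace_def pmat_def by (simp add: sum.If_cases Int_def conj_commute)

text \<open>The coefficient c in degree n may be 0, which allows traces of words of different
  lengths to be compared in one fixed degree.\<close>

definition poly_fun :: "nat \<Rightarrow> int \<Rightarrow> (int \<Rightarrow> int) \<Rightarrow> bool" where
  "poly_fun n c f \<longleftrightarrow> (\<exists>q. degree q \<le> n \<and> coeff q n = c \<and> (\<forall>t. f t = poly q t))"

lemma poly_fun_const: "poly_fun 0 c (\<lambda>t. c)"
  unfolding poly_fun_def by (rule exI[of _ "[:c:]"]) simp

lemma poly_fun_add:
  assumes "poly_fun n c f" "poly_fun n d g"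
  shows "poly_fun n (c + d) (\<lambda>t. f t + g t)"
proof -
  obtain q r where "degree q \<le> n" "coeff q n = c" "\<forall>t. f t = poly q t"
    "degree r \<le> n" "coeff r n = d" "\<forall>t. g t = poly r t"
    using assms unfolding poly_fun_def by blast
  then show ?thesis unfolding poly_fun_def by (intro exI[of _ "q + r"]) (simp add: degree_add_le)
qed

lemma poly_fun_cmult:
  assumes "poly_fun n c f"
  shows "poly_fun n (a * c) (\<lambda>t. a * f t)"
proof -
  obtain q where "degree q \<le> n" "coeff q n = c" "\<forall>t. f t = poly q t"
    using assms unfolding poly_fun_def by blast
  then show ?thesis unfolding poly_fun_def
    by (intro exI[of _ "smult a q"]) (auto intro: order_trans[OF degree_smult_le])
qed

lemma poly_fun_diff: "poly_fun n c f \<Longrightarrow> poly_fun n d g \<Longrightarrow> poly_fun n (c - d) (\<lambda>t. f t - g t)"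
  using poly_fun_add[OF _ poly_fun_cmult[of n d g "-1"], of c f] by simp

lemma poly_fun_less:
  assumes "poly_fun m c f" "m < n"
  shows "poly_fun n 0 f"
proof -
  obtain q where "degree q \<le> m" "\<forall>t. f t = poly q t"
    using assms(1) unfolding poly_fun_def by blast
  then show ?thesis using assms(2) unfolding poly_fun_def
    by (intro exI[of _ q]) (auto intro: coeff_eq_0)
qed

lemma poly_fun_var: "poly_fun n c f \<Longrightarrow> poly_fun (Suc n) c (\<lambda>t. t * f t)"
proof -
  assume "poly_fun n c f"
  then obtain q where "degree q \<le> n" "coeff q n = c" "\<forall>t. f t = poly q t" by (auto simp: poly_fun_def)
  then show ?thesis unfolding poly_fun_def
    by (intro exI[of _ "pCons 0 q"]) (auto intro: order_trans[OF degree_pCons_le])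
qed

lemma poly_fun_sum:
  "finite S \<Longrightarrow> (\<And>z. z \<in> S \<Longrightarrow> poly_fun n (c z) (f z)) \<Longrightarrow> poly_fun n (\<Sum>z\<in>S. c z) (\<lambda>t. \<Sum>z\<in>S. f z t)"
proof (induction S rule: finite_induct)
  case empty
  show ?case unfolding poly_fun_def by (rule exI[of _ 0]) simp
next
  case (insert z S)
  then show ?case using poly_fun_add[of n "c z" "f z"] by simp
qed

text \<open>A nonzero polynomial has finitely many roots, while there are infinitely many powers of
  p. The exponent is kept positive so that p divides the chosen value of t, which makes the twists
  trivial modulo p.\<close>

lemma poly_fun_nonzero_prime_power:
  assumes "poly_fun n c f" "c \<noteq> 0" "p > (1::nat)"
  obtains e where "e > 0" "f (int p ^ e) \<noteq> 0"
proof -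
  obtain q where q: "coeff q n = c" "\<And>t. f t = poly q t" using assms(1) by (auto simp: poly_fun_def)
  have "finite {t. poly q t = 0}" using q(1) assms(2) by (intro poly_roots_finite) auto
  moreover have "infinite ((\<lambda>e. int p ^ e) ` {0<..})"
  proof
    assume "finite ((\<lambda>e. int p ^ e) ` {0<..})"
    moreover have "inj_on (\<lambda>e. int p ^ e) {0<..}" using assms(3) by (auto simp: inj_on_def)
    ultimately have "finite {0::nat<..}" by (rule finite_imageD)
    then show False using infinite_Ioi by blast
  qed
  ultimately have "\<not> (\<lambda>e. int p ^ e) ` {0<..} \<subseteq> {t. poly q t = 0}"
    by (metis finite_subset)
  then obtain t where "t \<in> (\<lambda>e. int p ^ e) ` {0<..}" "t \<notin> {t. poly q t = 0}"
    by blast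
  then show ?thesis using that q(2) by auto
qed

section \<open>A matrix representation detecting cyclic words\<close>

text \<open>P stands for a finite quotient of H x K, C for the image of A in it, and u for the
  letters of the reference word, read cyclically with period n.\<close>

locale cyclic_rep = group P for P (structure) +
  fixes C :: "'a set" and u :: "nat \<Rightarrow> 'a" and n :: nat
  assumes fin: "finite (carrier P)" and C: "central_subgroup C P" and n: "n > 0"
    and u: "\<And>j. j < n \<Longrightarrow> u j \<in> carrier P - C"
begin

lemma C_subgroup: "subgroup C P" using C by (simp add: central_subgroup_def)

lemma C_carrier: "c \<in> C \<Longrightarrow> c \<in> carrier P"
  using subgroup.subset[OF C_subgroup] by blast

lemma C_commute: "c \<in> C \<Longrightarrow> x \<in> carrier P \<Longrightarrow> c \<otimes> x = x \<otimes> c"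
  using C unfolding central_subgroup_def by blast

lemma C_mult_iff:
  assumes "c \<in> C" "x \<in> carrier P"
  shows "c \<otimes> x \<in> C \<longleftrightarrow> x \<in> C"
proof
  assume "c \<otimes> x \<in> C"
  then have "inv c \<otimes> (c \<otimes> x) \<in> C"
    using assms(1) subgroup.m_closed[OF C_subgroup] subgroup.m_inv_closed[OF C_subgroup] by blast
  then show "x \<in> C" using assms C_carrier by simp
qed (use assms subgroup.m_closed[OF C_subgroup] in blast)

text \<open>The index set of n copies of the regular representation of P; the second component is
  the position reached in u.\<close>

definition S :: "('a \<times> nat) set" where "S = carrier P \<times> {..<n}"

lemma finite_S: "finite S" by (simp add: S_def fin)

text \<open>The inverse is there because matrix products apply the left map first: with it
  \<open>pm\<close> preserves products instead of reversing them.\<close>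

definition pf :: "'a \<Rightarrow> 'a \<times> nat \<Rightarrow> ('a \<times> nat) option" where
  "pf g = (\<lambda>(x, i). Some (inv g \<otimes> x, i))"

text \<open>\<open>pf g\<close> and \<open>xf\<close> are partial maps from row to column indices: the former gives the permutation matrix of
  \<open>g\<close>, the latter the nilpotent matrix \<open>M\<close>. Composing \<open>pf g\<close> with \<open>xf\<close> advances from \<open>u i\<close> to
  \<open>u (i + 1)\<close> exactly if \<open>g\<close> agrees with \<open>u i\<close> modulo \<open>C\<close>, carrying along the discrepancy in \<open>C\<close>.\<close>
definition xf :: "'a \<times> nat \<Rightarrow> ('a \<times> nat) option" where
  "xf = (\<lambda>(x, i). if x \<in> C then Some (x \<otimes> u (Suc i mod n), Suc i mod n) else None)"

abbreviation "mm \<equiv> mat_mult S"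
abbreviation "pm g \<equiv> pmat S (pf g)"
abbreviation "xm \<equiv> pmat S xf"

text \<open>As the square of \<open>xm\<close> vanishes, this is the exponential of t times
  \<open>xm\<close>, with inverse \<open>twist (- t)\<close>.\<close>

definition twist :: "int \<Rightarrow> 'a \<times> nat \<Rightarrow> 'a \<times> nat \<Rightarrow> int" where
  "twist t = (\<lambda>x y. mat_one S x y + t * xm x y)"

lemma u_carrier: "u (k mod n) \<in> carrier P" "u (k mod n) \<notin> C"
  using u n by auto

lemma pf_S: "g \<in> carrier P \<Longrightarrow> z \<in> S \<Longrightarrow> pf g z = Some y \<Longrightarrow> y \<in> S"
  by (auto simp: pf_def S_def)

lemma xf_S: "z \<in> S \<Longrightarrow> xf z = Some y \<Longrightarrow> y \<in> S"
  using n by (auto simp: xf_def S_def u_carrier C_carrier split: if_splits)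

lemma pm_one: "pm \<one> = mat_one S"
  unfolding pmat_Some[symmetric] by (rule pmat_cong) (auto simp: pf_def S_def)

lemma pm_mult: "g \<in> carrier P \<Longrightarrow> h \<in> carrier P \<Longrightarrow> mm (pm g) (pm h) = pm (g \<otimes> h)"
  by (subst mat_mult_pmat[OF finite_S pf_S], assumption+, rule pmat_cong)
    (auto simp: pf_def S_def inv_mult_group m_assoc)

text \<open>A step of \<open>xf\<close> ends at an element of C times a letter of u. No letter of u
  lies in C, so a second step is undefined.\<close>

lemma xm_square: "mm xm xm = (\<lambda>x y. 0)"
proof -
  have "Option.bind (xf z) xf = None" if "z \<in> S" for z
    using that C_mult_iff u_carrier by (auto simp: xf_def S_def)
  then have "pmat S (\<lambda>z. Option.bind (xf z) xf) = (\<lambda>x y. 0)" by (auto simp: pmat_def fun_eq_iff)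
  then show ?thesis using mat_mult_pmat[OF finite_S xf_S] by simp
qed

text \<open>The map \<open>pf c\<close> multiplies from the left by an element of C and
  \<open>xf\<close> from the right by a letter of u, while a left factor from C does not affect
  membership in C.\<close>

lemma xm_pi: "c \<in> C \<Longrightarrow> mm xm (pm c) = mm (pm c) xm"
proof -
  assume c: "c \<in> C"
  then have cP: "c \<in> carrier P" "inv c \<in> C"
    using C_carrier subgroup.m_inv_closed[OF C_subgroup] by auto
  have "Option.bind (xf z) (pf c) = Option.bind (pf c z) xf" if "z \<in> S" for z
    using that cP C_mult_iff[OF cP(2)] by (auto simp: xf_def pf_def S_def m_assoc u_carrier C_carrier)
  then have "pmat S (\<lambda>z. Option.bind (xf z) (pf c)) = pmat S (\<lambda>z. Option.bind (pf c z) xf)"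
    by (rule pmat_cong)
  then show ?thesis
    using mat_mult_pmat[OF finite_S xf_S] mat_mult_pmat[OF finite_S pf_S[OF cP(1)]] by simp
qed

lemma twist_in_mats: "twist t \<in> mats S"
  by (auto simp: mats_def twist_def mat_one_def pmat_def split: if_splits)

lemma mm_twist_left: "M \<in> mats S \<Longrightarrow> mm (twist t) M = (\<lambda>x y. M x y + t * mm xm M x y)"
  using mat_mult_one_left[OF finite_S, of M]
  by (auto simp: mat_mult_def twist_def fun_eq_iff algebra_simps sum.distrib sum_distrib_left)

lemma mm_twist_right: "M \<in> mats S \<Longrightarrow> mm M (twist t) = (\<lambda>x y. M x y + t * mm M xm x y)"
  using mat_mult_one_right[OF finite_S, of M]
  by (auto simp: mat_mult_def twist_def fun_eq_iff algebra_simps sum.distrib sum_distrib_left)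

lemma twist_inverse: "mm (twist t) (twist (- t)) = mat_one S"
proof -
  have "mm xm (twist (- t)) = xm"
    using mm_twist_right[OF pmat_in_mats[of S xf], of "- t"] by (simp add: xm_square)
  then show ?thesis using mm_twist_left[OF twist_in_mats, of t "- t"] by (simp add: twist_def)
qed

lemma twist_pi: "c \<in> C \<Longrightarrow> mm (twist t) (pm c) = mm (pm c) (twist t)"
  using mm_twist_left[OF pmat_in_mats[of S "pf c"], of t] mm_twist_right[OF pmat_in_mats[of S "pf c"], of t]
  by (simp add: xm_pi)

definition tpi :: "int \<Rightarrow> 'a \<Rightarrow> 'a \<times> nat \<Rightarrow> 'a \<times> nat \<Rightarrow> int" where
  "tpi t g = mm (twist (- t)) (mm (pm g) (twist t))"

lemma tpi_in_mats: "tpi t g \<in> mats S"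
  unfolding tpi_def by (intro mat_mult_in_mats twist_in_mats pmat_in_mats)

lemma tpi_mult:
  assumes "g \<in> carrier P" "h \<in> carrier P"
  shows "mm (tpi t g) (tpi t h) = tpi t (g \<otimes> h)"
proof -
  have "mm (tpi t g) (tpi t h)
      = mm (twist (- t)) (mm (pm g) (mm (mm (twist t) (twist (- t))) (mm (pm h) (twist t))))"
    by (simp add: tpi_def mat_mult_assoc)
  also have "\<dots> = mm (twist (- t)) (mm (mm (pm g) (pm h)) (twist t))"
    using mat_mult_one_left[OF finite_S mat_mult_in_mats[OF pmat_in_mats twist_in_mats]]
    by (simp add: twist_inverse mat_mult_assoc)
  finally show ?thesis using assms by (simp add: pm_mult tpi_def)
qed

text \<open>This is the gluing condition: \<open>pm\<close> on H and \<open>tpi t\<close> on K agree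
  on the image of A, so they define a representation of the amalgam for every t.\<close>

lemma tpi_central:
  assumes "c \<in> C"
  shows "tpi t c = pm c"
proof -
  have "tpi t c = mm (mm (twist (- t)) (pm c)) (twist t)" by (simp only: tpi_def mat_mult_assoc)
  also have "\<dots> = mm (pm c) (mm (twist (- t)) (twist t))" by (simp only: twist_pi[OF assms] mat_mult_assoc)
  also have "mm (twist (- t)) (twist t) = mat_one S" using twist_inverse[of "- t"] by simp
  finally show ?thesis by (simp only: mat_mult_one_right[OF finite_S pmat_in_mats])
qed

lemma tpi_one: "tpi t \<one> = mat_one S"
  using tpi_central[OF subgroup.one_closed[OF C_subgroup]] pm_one by simp

text \<open>Each permutation matrix is followed by a twist, with alternating signs. For s = -1 and a
  word of even length alternating from H this is the image of the word, because \<open>tpi t\<close>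
  puts \<open>twist (- t)\<close> before and \<open>twist t\<close> after a letter of K.\<close>

fun wmat :: "int \<Rightarrow> int \<Rightarrow> 'a list \<Rightarrow> 'a \<times> nat \<Rightarrow> 'a \<times> nat \<Rightarrow> int" where
  "wmat t s [] = mat_one S"
| "wmat t s (g # gs) = mm (pm g) (mm (twist (s * t)) (wmat t (- s) gs))"

text \<open>The partial map whose matrix is the leading coefficient of \<open>wmat t s gs\<close> as a polynomial in \<open>t\<close>,
  up to the sign \<open>wsign s gs\<close>.\<close>
fun walk :: "'a list \<Rightarrow> 'a \<times> nat \<Rightarrow> ('a \<times> nat) option" where
  "walk [] z = Some z"
| "walk (g # gs) z = Option.bind (Option.bind (pf g z) xf) (walk gs)"

fun wsign :: "int \<Rightarrow> 'a list \<Rightarrow> int" where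
  "wsign s [] = 1"
| "wsign s (g # gs) = s * wsign (- s) gs"

lemma wmat_in_mats: "wmat t s gs \<in> mats S"
  by (induction gs arbitrary: s)
    (simp_all add: mat_one_in_mats mat_mult_in_mats pmat_in_mats twist_in_mats)

text \<open>Expanding the leftmost twist as 1 + s t \<open>xm\<close> gives a term of degree at most
  \<open>length gs\<close> and t times a product involving the remaining word. So the top
  coefficient takes \<open>xm\<close> from every twist, and this composition is
  \<open>walk\<close>.\<close>

lemma wmat_poly_fun:
  assumes "set gs \<subseteq> carrier P"
  shows "poly_fun (length gs) (wsign s gs * pmat S (walk gs) x y) (\<lambda>t. wmat t s gs x y)"
  using assms
proof (induction gs arbitrary: s x y)
  case Nil
  have "walk [] = Some" by auto
  then show ?case using poly_fun_const[of "mat_one S x y"] by (simp add: pmat_Some)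
next
  case (Cons g gs)
  have g: "g \<in> carrier P" and gs: "set gs \<subseteq> carrier P" using Cons.prems by auto
  let ?W = "\<lambda>t. wmat t (- s) gs" and ?Y = "pmat S (walk gs)" and ?c = "wsign (- s) gs"
  let ?h = "\<lambda>z. Option.bind (pf g z) xf"
  have hS: "w \<in> S" if z: "z \<in> S" and w: "?h z = Some w" for z w
  proof -
    obtain v where "pf g z = Some v" "xf v = Some w" using w by (cases "pf g z") auto
    then show ?thesis using pf_S[OF g z] xf_S by blast
  qed
  have gx: "mm (pm g) xm = pmat S ?h" by (rule mat_mult_pmat[OF finite_S pf_S[OF g]])
  have Y: "mm (pmat S ?h) ?Y = pmat S (walk (g # gs))"
  proof -
    have "walk (g # gs) = (\<lambda>z. Option.bind (?h z) (walk gs))" by (rule ext) simp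
    then show ?thesis using mat_mult_pmat[OF finite_S, of ?h "walk gs", OF hS] by (simp only:)
  qed
  have W: "wmat t s (g # gs) x y = mm (pm g) (?W t) x y + t * (s * mm (pmat S ?h) (?W t) x y)" for t
  proof -
    have "mm (pm g) (\<lambda>x y. M x y + a * N x y) x y = mm (pm g) M x y + a * mm (pm g) N x y" for M N a
      by (simp add: mat_mult_def algebra_simps sum.distrib sum_distrib_left)
    then have "wmat t s (g # gs) x y = mm (pm g) (?W t) x y + s * t * mm (pm g) (mm xm (?W t)) x y"
      using mm_twist_left[OF wmat_in_mats] by simp
    then show ?thesis by (simp add: mat_mult_assoc[symmetric] gx)
  qed
  have IH: "poly_fun (length gs) (?c * ?Y z w) (\<lambda>t. ?W t z w)" for z w
    by (rule Cons.IH[OF gs])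
  have "poly_fun (length gs) (mm (pm g) (\<lambda>z w. ?c * ?Y z w) x y) (\<lambda>t. mm (pm g) (?W t) x y)"
    unfolding mat_mult_def by (intro poly_fun_sum poly_fun_cmult IH finite_S)
  then have 1: "poly_fun (Suc (length gs)) 0 (\<lambda>t. mm (pm g) (?W t) x y)"
    by (rule poly_fun_less) simp
  have "poly_fun (length gs) (mm (pmat S ?h) (\<lambda>z w. ?c * ?Y z w) x y) (\<lambda>t. mm (pmat S ?h) (?W t) x y)"
    unfolding mat_mult_def by (intro poly_fun_sum poly_fun_cmult IH finite_S)
  then have "poly_fun (Suc (length gs)) (s * mm (pmat S ?h) (\<lambda>z w. ?c * ?Y z w) x y)
      (\<lambda>t. t * (s * mm (pmat S ?h) (?W t) x y))"
    by (intro poly_fun_var poly_fun_cmult)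
  moreover have "mm (pmat S ?h) (\<lambda>z w. ?c * ?Y z w) x y = ?c * mm (pmat S ?h) ?Y x y"
    by (simp add: mat_mult_def sum_distrib_left algebra_simps)
  ultimately have "poly_fun (Suc (length gs)) (s * (?c * pmat S (walk (g # gs)) x y))
      (\<lambda>t. t * (s * mm (pmat S ?h) (?W t) x y))"
    unfolding Y by simp
  from poly_fun_add[OF 1 this] show ?case
    unfolding W by (simp only: wsign.simps length_Cons mult.assoc add_0)
qed

lemma wmat_trace_poly_fun:
  assumes "set gs \<subseteq> carrier P"
  shows "poly_fun (length gs) (wsign s gs * int (card {z \<in> S. walk gs z = Some z}))
    (\<lambda>t. mat_trace S (wmat t s gs))"
proof -
  have "poly_fun (length gs) (\<Sum>z\<in>S. wsign s gs * pmat S (walk gs) z z) (\<lambda>t. \<Sum>z\<in>S. wmat t s gs z z)"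
    by (intro poly_fun_sum finite_S wmat_poly_fun assms)
  moreover have "(\<Sum>z\<in>S. wsign s gs * pmat S (walk gs) z z)
      = wsign s gs * int (card {z \<in> S. walk gs z = Some z})"
    unfolding mat_trace_pmat[OF finite_S, symmetric] mat_trace_def by (simp add: sum_distrib_left)
  ultimately show ?thesis by (simp only: mat_trace_def)
qed

lemma wsign_nonzero: "s \<noteq> 0 \<Longrightarrow> wsign s gs \<noteq> 0"
  by (induction gs arbitrary: s) auto

text \<open>From (u j, j) the letter u j leads to (1, j), where \<open>xf\<close> is defined since
  the unit lies in C, and \<open>xf\<close> moves on to the next letter. After the last letter the
  position wraps round to 0.\<close>

lemma walk_self:
  assumes "j < n"
  shows "walk (map u [j..<n]) (u j, j) = Some (u 0, 0)"
  using assms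
proof (induction "n - j" arbitrary: j)
  case (Suc k)
  have step: "walk (u j # gs) (u j, j) = walk gs (u (Suc j mod n), Suc j mod n)" for gs
    using u[OF Suc.prems] u_carrier subgroup.one_closed[OF C_subgroup] by (simp add: pf_def xf_def)
  show ?case
  proof (cases "Suc j = n")
    case True
    then show ?thesis using step[of "[]"] Suc.prems by (simp add: upt_conv_Cons)
  next
    case False
    then show ?thesis using Suc step[of "map u [Suc j..<n]"] by (simp add: upt_conv_Cons)
  qed
qed simp

definition lprod :: "'a list \<Rightarrow> 'a" where "lprod gs = foldr (\<otimes>) gs \<one>"

lemma lprod_simps [simp]: "lprod [] = \<one>" "lprod (g # gs) = g \<otimes> lprod gs"
  by (simp_all add: lprod_def)

lemma lprod_closed: "set gs \<subseteq> carrier P \<Longrightarrow> lprod gs \<in> carrier P"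
  by (induction gs) auto

text \<open>At each stage the walk stands at c v, where c is in C and v is the current letter of u.
  A letter g replaces c by e = g^(-1) c v, which must lie in C for \<open>xf\<close> to be defined,
  and the relations g e = v c accumulate to the formula for the products.\<close>

lemma walk_closes:
  assumes "set gs \<subseteq> carrier P" "c \<in> C" "walk gs (c \<otimes> u (i mod n), i mod n) = Some (y, k)"
  shows "\<exists>d\<in>C. y = d \<otimes> u ((i + length gs) mod n) \<and> k = (i + length gs) mod n \<and>
    (\<forall>m<length gs. inv (u ((i + m) mod n)) \<otimes> gs ! m \<in> C) \<and>
    lprod gs \<otimes> d = lprod (map (\<lambda>m. u ((i + m) mod n)) [0..<length gs]) \<otimes> c"
  using assms
proof (induction gs arbitrary: c i)
  case Nil
  then show ?case using C_carrier by auto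
next
  case (Cons g gs)
  have g: "g \<in> carrier P" and gs: "set gs \<subseteq> carrier P" using Cons.prems by auto
  have cP: "c \<in> carrier P" using C_carrier Cons.prems by blast
  let ?v = "u (i mod n)" and ?R = "lprod (map (\<lambda>m. u ((Suc i + m) mod n)) [0..<length gs])"
  define e where "e = inv g \<otimes> (c \<otimes> ?v)"
  have e: "e \<in> C" and walk': "walk gs (e \<otimes> u (Suc i mod n), Suc i mod n) = Some (y, k)"
    using Cons.prems(3) by (auto simp: pf_def xf_def e_def mod_Suc_eq split: if_splits)
  have eP: "e \<in> carrier P" by (rule C_carrier[OF e])
  obtain d where d: "d \<in> C" "y = d \<otimes> u ((Suc i + length gs) mod n)" "k = (Suc i + length gs) mod n"
    "\<forall>m<length gs. inv (u ((Suc i + m) mod n)) \<otimes> gs ! m \<in> C" "lprod gs \<otimes> d = ?R \<otimes> e"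
    using Cons.IH[OF gs e walk'] by blast
  have RP: "?R \<in> carrier P" by (rule lprod_closed) (auto simp: u_carrier)
  have ge: "g \<otimes> e = ?v \<otimes> c"
    using g cP C_commute[OF Cons.prems(2) u_carrier(1)[of i]] by (simp add: e_def u_carrier)
  have "g = ?v \<otimes> c \<otimes> inv e" using ge g eP by (metis inv_solve_right m_closed)
  then have "inv ?v \<otimes> g = c \<otimes> inv e" using cP eP u_carrier(1)[of i] by (simp add: m_assoc)
  then have vg: "inv ?v \<otimes> g \<in> C"
    using Cons.prems(2) e subgroup.m_closed[OF C_subgroup] subgroup.m_inv_closed[OF C_subgroup] by simp
  have "\<forall>m<length (g # gs). inv (u ((i + m) mod n)) \<otimes> (g # gs) ! m \<in> C"
  proof (intro allI impI)
    fix m assume "m < length (g # gs)"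
    then show "inv (u ((i + m) mod n)) \<otimes> (g # gs) ! m \<in> C" using vg d(4) by (cases m) auto
  qed
  moreover have "lprod (g # gs) \<otimes> d = lprod (map (\<lambda>m. u ((i + m) mod n)) [0..<length (g # gs)]) \<otimes> c"
  proof -
    have "lprod (g # gs) \<otimes> d = g \<otimes> (lprod gs \<otimes> d)"
      using g lprod_closed[OF gs] C_carrier[OF d(1)] by (simp add: m_assoc)
    also have "\<dots> = g \<otimes> (e \<otimes> ?R)" using d(5) C_commute[OF e RP] by simp
    also have "\<dots> = (g \<otimes> e) \<otimes> ?R" using g eP RP by (simp add: m_assoc)
    also have "\<dots> = ?v \<otimes> ?R \<otimes> c"
      unfolding ge using C_commute[OF Cons.prems(2) RP] u_carrier(1)[of i] cP RP by (simp add: m_assoc)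
    also have "?v \<otimes> ?R = lprod (map (\<lambda>m. u ((i + m) mod n)) [0..<length (g # gs)])"
      by (simp add: upt_rec[of 0] map_Suc_upt[symmetric] comp_def del: upt_Suc)
    finally show ?thesis .
  qed
  ultimately show ?case using d(1-3) by auto
qed

text \<open>A closed walk spelled by \<open>gs\<close> forces \<open>gs\<close> to be, letter by letter modulo \<open>C\<close> and
  with equal product, a cyclic rotation of \<open>u\<close>.\<close>
lemma closed_walk:
  assumes gs: "set gs \<subseteq> carrier P" "length gs = n" and x: "x \<in> carrier P" "i < n"
    and closed: "walk gs (x, i) = Some (x, i)"
  shows "(\<forall>m<n. inv (u ((i + m) mod n)) \<otimes> gs ! m \<in> C) \<and>
    lprod gs = lprod (map (\<lambda>m. u ((i + m) mod n)) [0..<n])"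
proof -
  \<comment> \<open>Every step ends at an element of C times a letter of u, and a closed walk starts
    where it ends; so its start has the form that \<open>walk_closes\<close> expects.\<close>
  have last: "\<exists>c\<in>C. y = c \<otimes> u (k mod n) \<and> k < n"
    if "set gs \<subseteq> carrier P" "gs \<noteq> []" "x \<in> carrier P" "walk gs (x, i) = Some (y, k)" for gs x i y k
    using that
  proof (induction gs arbitrary: x i)
    case (Cons g gs)
    define e where "e = inv g \<otimes> x"
    have e: "e \<in> C" "walk gs (e \<otimes> u (Suc i mod n), Suc i mod n) = Some (y, k)"
      using Cons.prems(4) by (auto simp: pf_def xf_def e_def split: if_splits)
    show ?case
    proof (cases gs)
      case Nil
      then show ?thesis using e n by auto
    next
      case (Cons a list)
      then show ?thesis
        using Cons.IH[of "e \<otimes> u (Suc i mod n)" "Suc i mod n"] Cons.prems e C_carrier u_carrier(1)[of "Suc i"]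
        by auto
    qed
  qed simp
  obtain c where c: "c \<in> C" "x = c \<otimes> u (i mod n)"
    using last[OF gs(1) _ x(1) closed] gs(2) n by auto
  have "walk gs (c \<otimes> u (i mod n), i mod n) = Some (x, i)" using closed c(2) x(2) by simp
  from walk_closes[OF gs(1) c(1) this]
  obtain d where d: "d \<in> C" "x = d \<otimes> u (i mod n)" "\<forall>m<n. inv (u ((i + m) mod n)) \<otimes> gs ! m \<in> C"
    "lprod gs \<otimes> d = lprod (map (\<lambda>m. u ((i + m) mod n)) [0..<n]) \<otimes> c"
    unfolding gs(2) by auto
  \<comment> \<open>Start and end coincide, so the initial and the final discrepancy agree and
    cancel from the product formula.\<close>
  have "d = c" using c(2) d(2) C_carrier[OF c(1)] C_carrier[OF d(1)] u_carrier(1)[of i] by simp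
  moreover have "lprod (map (\<lambda>m. u ((i + m) mod n)) [0..<n]) \<in> carrier P"
    by (rule lprod_closed) (auto simp: u_carrier)
  ultimately show ?thesis using d(3,4) lprod_closed[OF gs(1)] C_carrier[OF c(1)] by simp
qed

end

section \<open>Separating cyclically reduced words\<close>

context group
begin

lemma p_normal_carrier: "p_normal p (carrier G) G"
proof -
  have "carrier (G Mod carrier G) \<subseteq> {carrier G}"
    using subgroup.rcos_const[OF subgroup_self is_group] by (auto simp: carrier_FactGroup)
  then have "finite (carrier (G Mod carrier G))" by (rule finite_subset) simp
  then show ?thesis unfolding p_normal_def by (auto simp: normal_self)
qed

text \<open>A coset of the intersection is an intersection of cosets, so there are finitely many of
  them, and the two exponents of p add up.\<close>

lemma p_normal_Int:
  assumes M: "p_normal p M G" and N: "p_normal p N G"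
  shows "p_normal p (M \<inter> N) G"
proof -
  have MG: "M \<lhd> G" and NG: "N \<lhd> G" using M N by (auto simp: p_normal_def)
  have coset: "(M \<inter> N) #> x = (M #> x) \<inter> (N #> x)" if "x \<in> carrier G" for x
  proof -
    have "h = k" if "h \<in> M" "k \<in> N" "h \<otimes> x = k \<otimes> x" for h k
      using that \<open>x \<in> carrier G\<close> subgroup.subset[OF normal_imp_subgroup[OF MG]]
        subgroup.subset[OF normal_imp_subgroup[OF NG]] by (metis r_cancel subsetD)
    then show ?thesis unfolding r_coset_def by blast
  qed
  have "carrier (G Mod (M \<inter> N)) \<subseteq> (\<lambda>(a, b). a \<inter> b) ` (carrier (G Mod M) \<times> carrier (G Mod N))"
    unfolding carrier_FactGroup using coset by auto
  then have "finite (carrier (G Mod (M \<inter> N)))"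
    by (rule finite_subset) (use M N in \<open>simp add: p_normal_def\<close>)
  moreover have "\<exists>e. y [^] (p ^ e) \<in> M \<inter> N" if y: "y \<in> carrier G" for y
  proof -
    obtain e f where "y [^] (p ^ e) \<in> M" "y [^] (p ^ f) \<in> N" using M N y unfolding p_normal_def by blast
    then have "(y [^] (p ^ e)) [^] (p ^ f) \<in> M" "(y [^] (p ^ f)) [^] (p ^ e) \<in> N"
      using nat_pow_mem normal_imp_subgroup MG NG by blast+
    then have "y [^] (p ^ (e + f)) \<in> M \<inter> N"
      using y by (simp add: nat_pow_pow power_add mult.commute)
    then show ?thesis by blast
  qed
  ultimately show ?thesis
    unfolding p_normal_def using normal_subgroup_intersect[OF MG NG] by blast
qed

lemma p_normal_finite_Inter:
  assumes "finite F" "\<And>N. N \<in> F \<Longrightarrow> p_normal p N G \<and> D \<subseteq> N" "D \<subseteq> carrier G"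
  obtains N where "p_normal p N G" "D \<subseteq> N" "\<And>M. M \<in> F \<Longrightarrow> N \<subseteq> M"
proof -
  have "\<exists>N. p_normal p N G \<and> D \<subseteq> N \<and> (\<forall>M\<in>F. N \<subseteq> M)"
    using assms(1,2)
  proof (induction F rule: finite_induct)
    case empty
    then show ?case using p_normal_carrier assms(3) by blast
  next
    case (insert M F)
    then obtain N where "p_normal p N G" "D \<subseteq> N" "\<forall>M\<in>F. N \<subseteq> M" by blast
    then show ?case using insert.prems[of M] p_normal_Int[of p M N] by blast
  qed
  then show ?thesis using that by blast
qed

end

section \<open>The direct product of the factors as a source of quotients\<close>

context amalgam
begin

abbreviation "\<Gamma> \<equiv> H \<times>\<times> K"

lemma group_\<Gamma>: "group \<Gamma>" by (rule DirProd_group[OF H.is_group K.is_group])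

sublocale \<Gamma>: group \<Gamma> by (rule group_\<Gamma>)

text \<open>Killing these elements identifies (a, 1) with (1, \<phi> a), so a quotient of H x K in
  which they vanish receives a homomorphism from the amalgam.\<close>

definition antidiag :: "('h \<times> 'k) set" where "antidiag = (\<lambda>a. (a, inv\<^bsub>K\<^esub> \<phi> a)) ` A"

fun emb :: "'h + 'k \<Rightarrow> 'h \<times> 'k" where
  "emb (Inl h) = (h, \<one>\<^bsub>K\<^esub>)"
| "emb (Inr k) = (\<one>\<^bsub>H\<^esub>, k)"

lemma emb_closed: "[l] \<in> words \<Longrightarrow> emb l \<in> carrier \<Gamma>"
  by (cases l) auto

lemma antidiag_subset: "antidiag \<subseteq> A \<times> B"
proof -
  have "inv\<^bsub>K\<^esub> \<phi> a \<in> B" if "a \<in> A" for a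
    by (rule subgroup.m_inv_closed[OF B_subgroup \<phi>_in_B[OF that]])
  then show ?thesis unfolding antidiag_def by blast
qed

text \<open>The first half keeps elements outside A x B away from the image of A. The second keeps
  nontrivial elements of A alive while the two copies of A stay identified.\<close>

definition p_residual :: "nat \<Rightarrow> bool" where
  "p_residual p \<longleftrightarrow>
    (\<forall>z\<in>carrier \<Gamma> - A \<times> B. \<exists>N. p_normal p N \<Gamma> \<and> A \<times> B \<subseteq> N \<and> z \<notin> N) \<and>
    (\<forall>a\<in>A - {\<one>\<^bsub>H\<^esub>}. \<exists>N. p_normal p N \<Gamma> \<and> antidiag \<subseteq> N \<and> (a, \<one>\<^bsub>K\<^esub>) \<notin> N)"

text \<open>The finitely many subgroups supplied by \<open>p_residual\<close> are intersected. Those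
  chosen for Z contain A x B, so an element z congruent to some (a, 1) modulo N would lie in the
  very subgroup chosen to exclude it.\<close>

lemma separating_p_normal:
  assumes res: "p_residual p"
    and Z: "finite Z" "Z \<subseteq> carrier \<Gamma> - A \<times> B" and W: "finite W" "W \<subseteq> A - {\<one>\<^bsub>H\<^esub>}"
  obtains N where "p_normal p N \<Gamma>" "antidiag \<subseteq> N"
    "\<And>z a. z \<in> Z \<Longrightarrow> a \<in> A \<Longrightarrow> N #>\<^bsub>\<Gamma>\<^esub> z \<noteq> N #>\<^bsub>\<Gamma>\<^esub> (a, \<one>\<^bsub>K\<^esub>)"
    "\<And>a. a \<in> W \<Longrightarrow> (a, \<one>\<^bsub>K\<^esub>) \<notin> N"
proof -
  have "\<forall>z\<in>Z. \<exists>N. p_normal p N \<Gamma> \<and> A \<times> B \<subseteq> N \<and> z \<notin> N"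
    using res Z(2) unfolding p_residual_def by blast
  then obtain f where f: "\<And>z. z \<in> Z \<Longrightarrow> p_normal p (f z) \<Gamma> \<and> A \<times> B \<subseteq> f z \<and> z \<notin> f z" by metis
  have "\<forall>a\<in>W. \<exists>N. p_normal p N \<Gamma> \<and> antidiag \<subseteq> N \<and> (a, \<one>\<^bsub>K\<^esub>) \<notin> N"
    using res W(2) unfolding p_residual_def by blast
  then obtain g where g: "\<And>a. a \<in> W \<Longrightarrow> p_normal p (g a) \<Gamma> \<and> antidiag \<subseteq> g a \<and> (a, \<one>\<^bsub>K\<^esub>) \<notin> g a" by metis
  have "antidiag \<subseteq> carrier \<Gamma>" using antidiag_subset A_subset B_subset by auto
  moreover have "p_normal p M \<Gamma> \<and> antidiag \<subseteq> M" if "M \<in> f ` Z \<union> g ` W" for M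
    using that f g antidiag_subset by blast
  moreover have "finite (f ` Z \<union> g ` W)" using Z(1) W(1) by simp
  ultimately obtain N where N: "p_normal p N \<Gamma>" "antidiag \<subseteq> N" "\<And>M. M \<in> f ` Z \<union> g ` W \<Longrightarrow> N \<subseteq> M"
    using \<Gamma>.p_normal_finite_Inter[of "f ` Z \<union> g ` W" p antidiag] by blast
  have sub: "subgroup N \<Gamma>" using N(1) normal_imp_subgroup unfolding p_normal_def by metis
  show ?thesis
  proof (rule that[OF N(1,2)])
    fix z a assume z: "z \<in> Z" and a: "a \<in> A"
    show "N #>\<^bsub>\<Gamma>\<^esub> z \<noteq> N #>\<^bsub>\<Gamma>\<^esub> (a, \<one>\<^bsub>K\<^esub>)"
    proof
      assume eq: "N #>\<^bsub>\<Gamma>\<^esub> z = N #>\<^bsub>\<Gamma>\<^esub> (a, \<one>\<^bsub>K\<^esub>)"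
      have "z \<in> carrier \<Gamma>" using Z(2) z by blast
      then have "z \<in> N #>\<^bsub>\<Gamma>\<^esub> (a, \<one>\<^bsub>K\<^esub>)"
        using \<Gamma>.rcos_self[OF _ sub] by (simp only: eq[symmetric])
      then have "\<exists>m\<in>N. z = m \<otimes>\<^bsub>\<Gamma>\<^esub> (a, \<one>\<^bsub>K\<^esub>)" by (simp only: r_coset_def UN_iff singleton_iff)
      then obtain m where m: "m \<in> N" "z = m \<otimes>\<^bsub>\<Gamma>\<^esub> (a, \<one>\<^bsub>K\<^esub>)" by (rule bexE)
      have "(a, \<one>\<^bsub>K\<^esub>) \<in> f z" using f[OF z] a subgroup.one_closed[OF B_subgroup] by blast
      moreover have "m \<in> f z" using N(3)[of "f z"] z m(1) by blast
      moreover have "subgroup (f z) \<Gamma>"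
        using f[OF z] normal_imp_subgroup unfolding p_normal_def by metis
      ultimately have "m \<otimes>\<^bsub>\<Gamma>\<^esub> (a, \<one>\<^bsub>K\<^esub>) \<in> f z" by (intro subgroup.m_closed)
      then have "z \<in> f z" by (simp only: m(2))
      then show False using f[OF z] by blast
    qed
  next
    fix a assume "a \<in> W"
    then show "(a, \<one>\<^bsub>K\<^esub>) \<notin> N" using g N(3) by blast
  qed
qed

end

section \<open>Homomorphisms from the amalgam to finite quotients of the direct product\<close>

locale amalgam_quotient = amalgam H K A B \<phi> for H :: "('h, 'c) monoid_scheme" and K :: "('k, 'd) monoid_scheme" and A B \<phi> +
  fixes p :: nat and N
  assumes p_normal: "p_normal p N (H \<times>\<times> K)" and anti: "antidiag \<subseteq> N"
begin

abbreviation "P \<equiv> \<Gamma> Mod N"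

definition \<theta> :: "'h + 'k \<Rightarrow> ('h \<times> 'k) set" where "\<theta> l = N #>\<^bsub>\<Gamma>\<^esub> emb l"

lemma N_normal: "N \<lhd> \<Gamma>" using p_normal by (simp add: p_normal_def)

sublocale N: normal N \<Gamma> by (rule N_normal)
sublocale P: group P by (rule N.factorgroup_is_group)
sublocale f: group_hom \<Gamma> P "\<lambda>z. N #>\<^bsub>\<Gamma>\<^esub> z" by (rule N.group_hom_Mod)

lemma \<theta>_closed: "[l] \<in> words \<Longrightarrow> \<theta> l \<in> carrier P"
  unfolding \<theta>_def by (intro f.hom_closed emb_closed)

lemma \<theta>_hom_H: "(\<lambda>h. \<theta> (Inl h)) \<in> hom H P"
proof (rule homI)
  fix x y assume x: "x \<in> carrier H" "y \<in> carrier H"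
  then have "emb (Inl (x \<otimes>\<^bsub>H\<^esub> y)) = emb (Inl x) \<otimes>\<^bsub>\<Gamma>\<^esub> emb (Inl y)" by simp
  then show "\<theta> (Inl (x \<otimes>\<^bsub>H\<^esub> y)) = \<theta> (Inl x) \<otimes>\<^bsub>P\<^esub> \<theta> (Inl y)"
    unfolding \<theta>_def using f.hom_mult[of "emb (Inl x)" "emb (Inl y)"] x by (simp del: mult_FactGroup)
qed (rule \<theta>_closed, simp)

lemma \<theta>_hom_K: "(\<lambda>k. \<theta> (Inr k)) \<in> hom K P"
proof (rule homI)
  fix x y assume x: "x \<in> carrier K" "y \<in> carrier K"
  then have "emb (Inr (x \<otimes>\<^bsub>K\<^esub> y)) = emb (Inr x) \<otimes>\<^bsub>\<Gamma>\<^esub> emb (Inr y)" by simp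
  then show "\<theta> (Inr (x \<otimes>\<^bsub>K\<^esub> y)) = \<theta> (Inr x) \<otimes>\<^bsub>P\<^esub> \<theta> (Inr y)"
    unfolding \<theta>_def using f.hom_mult[of "emb (Inr x)" "emb (Inr y)"] x by (simp del: mult_FactGroup)
qed (rule \<theta>_closed, simp)

lemma \<theta>_one: "\<theta> (Inl \<one>\<^bsub>H\<^esub>) = \<one>\<^bsub>P\<^esub>" "\<theta> (Inr \<one>\<^bsub>K\<^esub>) = \<one>\<^bsub>P\<^esub>"
  using f.hom_one by (simp_all add: \<theta>_def)

lemma \<theta>_amalg:
  assumes a: "a \<in> A"
  shows "\<theta> (Inl a) = \<theta> (Inr (\<phi> a))"
proof -
  have c: "a \<in> carrier H" "\<phi> a \<in> carrier K" using a A_subset \<phi>_in_K by auto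
  have "(a, inv\<^bsub>K\<^esub> \<phi> a) \<in> N" using anti a by (auto simp: antidiag_def)
  then have "N #>\<^bsub>\<Gamma>\<^esub> (a, inv\<^bsub>K\<^esub> \<phi> a) = \<one>\<^bsub>P\<^esub>" using N.rcos_const[OF \<Gamma>.is_group] by simp
  moreover have d: "(a, inv\<^bsub>K\<^esub> \<phi> a) \<in> carrier \<Gamma>" "emb (Inr (\<phi> a)) \<in> carrier \<Gamma>" using c by auto
  ultimately have "N #>\<^bsub>\<Gamma>\<^esub> ((a, inv\<^bsub>K\<^esub> \<phi> a) \<otimes>\<^bsub>\<Gamma>\<^esub> emb (Inr (\<phi> a)))
      = \<one>\<^bsub>P\<^esub> \<otimes>\<^bsub>P\<^esub> (N #>\<^bsub>\<Gamma>\<^esub> emb (Inr (\<phi> a)))"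
    by (simp only: f.hom_mult)
  also have "\<dots> = \<theta> (Inr (\<phi> a))" unfolding \<theta>_def by (rule P.l_one[OF f.hom_closed[OF d(2)]])
  also have "(a, inv\<^bsub>K\<^esub> \<phi> a) \<otimes>\<^bsub>\<Gamma>\<^esub> emb (Inr (\<phi> a)) = emb (Inl a)" using c by simp
  finally show ?thesis by (simp only: \<theta>_def)
qed

definition C :: "('h \<times> 'k) set set" where "C = (\<lambda>a. \<theta> (Inl a)) ` A"

lemma C_central: "central_subgroup C P"
proof -
  interpret a: group_hom H P "\<lambda>h. \<theta> (Inl h)"
    using \<theta>_hom_H by unfold_locales
  have "subgroup C P" unfolding C_def by (rule a.subgroup_img_is_subgroup[OF A_subgroup])
  moreover have "c \<otimes>\<^bsub>P\<^esub> x = x \<otimes>\<^bsub>P\<^esub> c" if c: "c \<in> C" and x: "x \<in> carrier P" for c x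
  proof -
    obtain a where a: "a \<in> A" "c = \<theta> (Inl a)" using c by (auto simp: C_def)
    have "x \<in> (\<lambda>z. N #>\<^bsub>\<Gamma>\<^esub> z) ` carrier \<Gamma>" using x by (simp only: carrier_FactGroup)
    then obtain z where z: "x = N #>\<^bsub>\<Gamma>\<^esub> z" "z \<in> carrier \<Gamma>" by (rule imageE)
    have aH: "a \<in> carrier H" using a(1) A_subset by blast
    then have e: "emb (Inl a) \<in> carrier \<Gamma>" by simp
    obtain h k where hk: "z = (h, k)" "h \<in> carrier H" "k \<in> carrier K" using z(2) by auto
    have "a \<otimes>\<^bsub>H\<^esub> h = h \<otimes>\<^bsub>H\<^esub> a" using A a(1) hk(2) unfolding central_subgroup_def by blast
    then have "emb (Inl a) \<otimes>\<^bsub>\<Gamma>\<^esub> z = z \<otimes>\<^bsub>\<Gamma>\<^esub> emb (Inl a)" using hk by simp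
    then show ?thesis unfolding a(2) z(1) \<theta>_def f.hom_mult[OF e z(2), symmetric] f.hom_mult[OF z(2) e, symmetric]
      by (rule arg_cong)
  qed
  ultimately show ?thesis unfolding central_subgroup_def by blast
qed

lemma finite_P: "finite (carrier P)"
  using p_normal by (simp add: p_normal_def)

lemma P_power:
  assumes "x \<in> carrier P"
  shows "\<exists>e. x [^]\<^bsub>P\<^esub> (p ^ e) = \<one>\<^bsub>P\<^esub>"
proof -
  have "x \<in> (\<lambda>z. N #>\<^bsub>\<Gamma>\<^esub> z) ` carrier \<Gamma>" using assms by (simp only: carrier_FactGroup)
  then obtain z where z: "x = N #>\<^bsub>\<Gamma>\<^esub> z" "z \<in> carrier \<Gamma>" by (rule imageE)
  obtain e where "z [^]\<^bsub>\<Gamma>\<^esub> (p ^ e) \<in> N" using p_normal z(2) unfolding p_normal_def by blast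
  then have "x [^]\<^bsub>P\<^esub> (p ^ e) = \<one>\<^bsub>P\<^esub>"
    using z N.FactGroup_pow[OF z(2)] N.rcos_const[OF \<Gamma>.is_group] by simp
  then show ?thesis by blast
qed

definition lprodP :: "('h + 'k) list \<Rightarrow> ('h \<times> 'k) set" where
  "lprodP w = ev P (\<lambda>h. \<theta> (Inl h)) (\<lambda>k. \<theta> (Inr k)) w"

lemma lprodP_eq: "lprodP w = foldr (\<otimes>\<^bsub>P\<^esub>) (map \<theta> w) \<one>\<^bsub>P\<^esub>"
proof (induction w)
  case (Cons l w)
  then show ?case by (cases l) (simp_all add: lprodP_def del: mult_FactGroup)
qed (simp add: lprodP_def)

lemma quotient_hom:
  obtains \<Theta> where "\<Theta> \<in> hom G P" "\<Theta> \<one>\<^bsub>G\<^esub> = \<one>\<^bsub>P\<^esub>" "\<And>w. w \<in> words \<Longrightarrow> \<Theta> (cl w) = lprodP w"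
  unfolding lprodP_def
  by (rule amalgam_universal[OF P.is_monoid \<theta>_hom_H \<theta>_one(1) \<theta>_hom_K \<theta>_one(2)])
    (use \<theta>_amalg in blast)+

end

section \<open>The twisted matrix representation of the amalgam\<close>

locale amalgam_rep = amalgam_quotient H K A B \<phi> p N
  for H :: "('h, 'c) monoid_scheme" and K :: "('k, 'd) monoid_scheme" and A B \<phi> p N +
  fixes w :: "('h + 'k) list"
  assumes w: "cyc_reduced w" and w_C: "\<And>j. j < length w \<Longrightarrow> \<theta> (w ! j) \<notin> C"
begin

lemma nth_words: "v \<in> words \<Longrightarrow> j < length v \<Longrightarrow> [v ! j] \<in> words"
  unfolding amal_words_def using nth_mem by fastforce

lemma set_\<theta>: "v \<in> words \<Longrightarrow> set (map \<theta> v) \<subseteq> carrier P"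
  using nth_words \<theta>_closed by (auto simp: in_set_conv_nth)

lemma w_words: "w \<in> words" and w_length: "0 < length w"
  using w by (auto simp: cyc_reduced_def)

sublocale R: cyclic_rep P C "\<lambda>j. \<theta> (w ! j)" "length w"
proof
  show "finite (carrier P)" by (rule finite_P)
  show "central_subgroup C P" by (rule C_central)
  show "0 < length w" by (rule w_length)
  show "\<theta> (w ! j) \<in> carrier P - C" if "j < length w" for j
    using that w_C \<theta>_closed nth_words[OF w_words] by blast
qed

definition emat :: "int \<Rightarrow> ('h + 'k) list \<Rightarrow> ('h \<times> 'k) set \<times> nat \<Rightarrow> ('h \<times> 'k) set \<times> nat \<Rightarrow> int" where
  "emat t v = ev (mat_monoid R.S) (\<lambda>h. R.pm (\<theta> (Inl h))) (\<lambda>k. R.tpi t (\<theta> (Inr k))) v"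

lemma emat_simps [simp]:
  "emat t [] = mat_one R.S"
  "emat t (Inl h # v) = R.mm (R.pm (\<theta> (Inl h))) (emat t v)"
  "emat t (Inr k # v) = R.mm (R.tpi t (\<theta> (Inr k))) (emat t v)"
  by (simp_all add: emat_def)

lemma rep_hom:
  obtains \<rho> where "\<rho> \<in> hom G (mat_monoid R.S)" "\<rho> \<one>\<^bsub>G\<^esub> = mat_one R.S"
    "\<And>v. v \<in> words \<Longrightarrow> \<rho> (cl v) = emat t v"
proof -
  have c: "\<theta> (Inl h) \<in> carrier P" if "h \<in> carrier H" for h using \<theta>_closed[of "Inl h"] that by simp
  have c': "\<theta> (Inr k) \<in> carrier P" if "k \<in> carrier K" for k using \<theta>_closed[of "Inr k"] that by simp
  have 1: "(\<lambda>h. R.pm (\<theta> (Inl h))) \<in> hom H (mat_monoid R.S)"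
  proof (rule homI)
    fix x y assume "x \<in> carrier H" "y \<in> carrier H"
    then show "R.pm (\<theta> (Inl (x \<otimes>\<^bsub>H\<^esub> y))) = R.pm (\<theta> (Inl x)) \<otimes>\<^bsub>mat_monoid R.S\<^esub> R.pm (\<theta> (Inl y))"
      using hom_mult[OF \<theta>_hom_H] R.pm_mult[OF c c] by (simp only: mat_monoid_simps)
  qed (simp add: pmat_in_mats)
  have 2: "(\<lambda>k. R.tpi t (\<theta> (Inr k))) \<in> hom K (mat_monoid R.S)"
  proof (rule homI)
    fix x y assume "x \<in> carrier K" "y \<in> carrier K"
    then show "R.tpi t (\<theta> (Inr (x \<otimes>\<^bsub>K\<^esub> y))) = R.tpi t (\<theta> (Inr x)) \<otimes>\<^bsub>mat_monoid R.S\<^esub> R.tpi t (\<theta> (Inr y))"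
      using hom_mult[OF \<theta>_hom_K] R.tpi_mult[OF c' c'] by (simp only: mat_monoid_simps)
  qed (simp add: R.tpi_in_mats)
  have 3: "R.pm (\<theta> (Inl a)) = R.tpi t (\<theta> (Inr (\<phi> a)))" if "a \<in> A" for a
    using R.tpi_central[of "\<theta> (Inl a)" t] that unfolding \<theta>_amalg[OF that, symmetric] C_def by simp
  have 4: "R.pm (\<theta> (Inl \<one>\<^bsub>H\<^esub>)) = \<one>\<^bsub>mat_monoid R.S\<^esub>" "R.tpi t (\<theta> (Inr \<one>\<^bsub>K\<^esub>)) = \<one>\<^bsub>mat_monoid R.S\<^esub>"
    using R.pm_one R.tpi_one by (simp_all only: \<theta>_one mat_monoid_simps)
  show ?thesis
    by (rule amalgam_universal[OF monoid_mat_monoid[OF R.finite_S] 1 4(1) 2 4(2) 3])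
      (use that in \<open>simp_all add: emat_def\<close>)
qed

text \<open>Letters are consumed in pairs from H and K, after which the sign in \<open>wmat\<close>
  is back at -1.\<close>

lemma emat_wmat:
  "even (length v) \<Longrightarrow> (\<And>j. j < length v \<Longrightarrow> isl (v ! j) \<longleftrightarrow> even j) \<Longrightarrow>
    emat t v = R.wmat t (- 1) (map \<theta> v)"
proof (induction v rule: induct_list012)
  case (3 l1 l2 v)
  have "isl l1" using 3(4)[of 0] by simp
  then obtain h where h: "l1 = Inl h" by (cases l1) auto
  have "\<not> isl l2" using 3(4)[of 1] by simp
  then obtain k where k: "l2 = Inr k" by (cases l2) auto
  have "isl (v ! j) \<longleftrightarrow> even j" if "j < length v" for j using 3(4)[of "Suc (Suc j)"] that by simp
  then have "emat t v = R.wmat t (- 1) (map \<theta> v)" using 3 by simp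
  then show ?case by (simp add: h k R.tpi_def mat_mult_assoc)
qed simp_all

lemma cyc_reduced_isl: "cyc_reduced v \<Longrightarrow> j < length v \<Longrightarrow> isl (v ! j) \<longleftrightarrow> even j"
  unfolding cyc_reduced_def by (cases "even j") fastforce+

definition closed_walks :: "('h + 'k) list \<Rightarrow> (('h \<times> 'k) set \<times> nat) set" where
  "closed_walks v = {z \<in> R.S. R.walk (map \<theta> v) z = Some z}"

lemma trace_cyc_reduced:
  assumes "cyc_reduced v"
  shows "poly_fun (length v) (R.wsign (- 1) (map \<theta> v) * int (card (closed_walks v)))
    (\<lambda>t. mat_trace R.S (emat t v))"
proof -
  have v: "v \<in> words" "even (length v)" using assms by (auto simp: cyc_reduced_def)
  have "emat t v = R.wmat t (- 1) (map \<theta> v)" for t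
    by (rule emat_wmat[OF v(2) cyc_reduced_isl[OF assms]])
  then show ?thesis
    using R.wmat_trace_poly_fun[OF set_\<theta>[OF v(1)], of "- 1"] by (simp add: closed_walks_def)
qed

text \<open>Twisting a letter of K only conjugates its matrix, so the trace of a single letter does
  not depend on t.\<close>

lemma trace_single:
  assumes "length v = 1"
  shows "poly_fun 0 (mat_trace R.S (R.pm (\<theta> (v ! 0)))) (\<lambda>t. mat_trace R.S (emat t v))"
proof -
  obtain l where l: "v = [l]" using assms by (metis One_nat_def length_0_conv length_Suc_conv)
  have "mat_trace R.S (emat t v) = mat_trace R.S (R.pm (\<theta> l))" for t
  proof (cases l)
    case (Inl h)
    then show ?thesis by (simp add: l mat_mult_one_right[OF R.finite_S pmat_in_mats])
  next
    case (Inr k)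
    have "mat_trace R.S (emat t v) = mat_trace R.S (R.tpi t (\<theta> l))"
      by (simp add: l Inr mat_mult_one_right[OF R.finite_S R.tpi_in_mats])
    also have "\<dots> = mat_trace R.S (R.mm (R.mm (R.pm (\<theta> l)) (R.twist t)) (R.twist (- t)))"
      unfolding R.tpi_def by (rule mat_trace_commute)
    also have "\<dots> = mat_trace R.S (R.pm (\<theta> l))"
      by (simp only: mat_mult_assoc R.twist_inverse mat_mult_one_right[OF R.finite_S pmat_in_mats])
    finally show ?thesis .
  qed
  then show ?thesis using poly_fun_const by (simp add: l)
qed

lemma closed_walks_self: "card (closed_walks w) \<noteq> 0"
proof -
  have "map (\<lambda>j. \<theta> (w ! j)) [0..<length w] = map \<theta> w"
    by (intro nth_equalityI) auto
  then have "R.walk (map \<theta> w) (\<theta> (w ! 0), 0) = Some (\<theta> (w ! 0), 0)"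
    using R.walk_self[OF w_length] by simp
  moreover have "(\<theta> (w ! 0), 0) \<in> R.S"
    using w_length \<theta>_closed nth_words[OF w_words] by (simp add: R.S_def)
  ultimately have "(\<theta> (w ! 0), 0) \<in> closed_walks w" by (simp add: closed_walks_def)
  moreover have "finite (closed_walks w)" using R.finite_S by (simp add: closed_walks_def)
  ultimately show ?thesis by auto
qed

text \<open>For t divisible by p every twist is the unit matrix modulo p, so modulo p the
  representation factors through the finite p-group P.\<close>

lemma emat_cong_pm:
  assumes v: "v \<in> words" and t: "int p dvd t"
  shows "mat_cong (int p) (emat t v) (R.pm (lprodP v))"
  using v
proof (induction v)
  case Nil
  have "lprodP [] = \<one>\<^bsub>P\<^esub>" by (simp only: lprodP_eq list.map foldr.simps id_apply)
  then show ?case using R.pm_one by (simp only: emat_simps mat_cong_refl)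
next
  case (Cons l v)
  have v: "v \<in> words" "[l] \<in> words" using Cons.prems by (cases l, auto)+
  have lp: "lprodP v \<in> carrier P"
    using R.lprod_closed[OF set_\<theta>[OF v(1)]] by (simp only: lprodP_eq R.lprod_def)
  have tw: "mat_cong (int p) (R.twist s) (mat_one R.S)" if "int p dvd s" for s
    using that by (simp add: mat_cong_def R.twist_def)
  have "mat_cong (int p) (R.tpi t g) (R.mm (mat_one R.S) (R.mm (R.pm g) (mat_one R.S)))" for g
    unfolding R.tpi_def by (intro mat_cong_mult tw mat_cong_refl) (use t in simp_all)
  then have tpi: "mat_cong (int p) (R.tpi t g) (R.pm g)" for g
    by (simp add: mat_mult_one_right[OF R.finite_S pmat_in_mats] mat_mult_one_left[OF R.finite_S pmat_in_mats])
  have "mat_cong (int p) (emat t (l # v)) (R.mm (R.pm (\<theta> l)) (R.pm (lprodP v)))"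
    by (cases l) (use mat_cong_mult[OF tpi Cons.IH[OF v(1)]]
        mat_cong_mult[OF mat_cong_refl Cons.IH[OF v(1)]] in simp_all)
  moreover have "R.mm (R.pm (\<theta> l)) (R.pm (lprodP v)) = R.pm (lprodP (l # v))"
    using R.pm_mult[OF \<theta>_closed[OF v(2)] lp] by (simp only: lprodP_eq list.map foldr.simps o_apply)
  ultimately show ?case by simp
qed

end

lemma hom_monoid_nat_pow:
  assumes "group G" "monoid M" "\<rho> \<in> hom G M" "\<rho> \<one>\<^bsub>G\<^esub> = \<one>\<^bsub>M\<^esub>" "x \<in> carrier G"
  shows "\<rho> (x [^]\<^bsub>G\<^esub> (n::nat)) = \<rho> x [^]\<^bsub>M\<^esub> n"
proof -
  interpret G: group G by fact
  interpret M: monoid M by fact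
  show ?thesis using assms(3-5) by (induction n) (auto simp: hom_def)
qed

text \<open>This is the conclusion of \<open>conj_p_separable\<close> for a single pair, which can
  then be replaced by conjugates, interchanged or pulled back.\<close>

definition p_conj_separated :: "nat \<Rightarrow> ('a, 'b) monoid_scheme \<Rightarrow> 'a \<Rightarrow> 'a \<Rightarrow> bool" where
  "p_conj_separated p G a b \<longleftrightarrow> (\<exists>(Q :: nat monoid) \<psi>. finite_p_group p Q \<and> \<psi> \<in> hom G Q \<and>
     \<psi> ` carrier G = carrier Q \<and> \<not> conjugate_in Q (\<psi> a) (\<psi> b))"

context amalgam_rep
begin

text \<open>The matrices at t = \<open>p ^ e\<close>, reduced modulo a power m of p, form a finite
  p-group: some p-power of each element dies in P, hence is 1 modulo p, and a further p-power of it
  is 1 modulo m. Conjugate images would have traces congruent modulo m, but m exceeds the nonzero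
  difference of the traces.\<close>

lemma rep_separates:
  assumes p: "Factorial_Ring.prime p" and v: "v \<in> words"
    and neq: "poly_fun (length w) c (\<lambda>t. mat_trace R.S (emat t w) - mat_trace R.S (emat t v))" "c \<noteq> 0"
  shows "p_conj_separated p G (cl w) (cl v)"
proof -
  obtain e where e: "e > 0" "mat_trace R.S (emat (int p ^ e) w) - mat_trace R.S (emat (int p ^ e) v) \<noteq> 0"
    using poly_fun_nonzero_prime_power[OF neq prime_gt_1_nat[OF p]] by blast
  define t where "t = int p ^ e"
  have pt: "int p dvd t" using e(1) by (simp add: t_def dvd_power)
  define d where "d = mat_trace R.S (emat t w) - mat_trace R.S (emat t v)"
  \<comment> \<open>The absolute value of d is a sufficient exponent, because k < 2 ^ k \<le> p ^ k;
    so m is larger than |d| and cannot divide d.\<close>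
  define k where "k = nat \<bar>d\<bar>"
  define m where "m = int p ^ Suc k"
  have "k < 2 ^ k" by (rule less_exp)
  also have "\<dots> \<le> p ^ k" by (rule power_mono[OF prime_ge_2_nat[OF p]]) simp
  also have "\<dots> \<le> p ^ Suc k" by (rule power_increasing) (use prime_gt_0_nat[OF p] in simp_all)
  finally have "int k < int (p ^ Suc k)" by linarith
  then have dm: "\<bar>d\<bar> < m" by (simp add: k_def m_def)
  have d0: "d \<noteq> 0" using e(2) by (simp add: d_def t_def)
  have m0: "m > 0" using dm by linarith
  obtain \<rho> where \<rho>: "\<rho> \<in> hom G (mat_monoid R.S)" "\<rho> \<one>\<^bsub>G\<^esub> = mat_one R.S"
    "\<And>v. v \<in> words \<Longrightarrow> \<rho> (cl v) = emat t v"
    using rep_hom[of t] by blast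
  obtain \<Theta> where \<Theta>: "\<Theta> \<in> hom G P" "\<Theta> \<one>\<^bsub>G\<^esub> = \<one>\<^bsub>P\<^esub>" "\<And>w. w \<in> words \<Longrightarrow> \<Theta> (cl w) = lprodP w"
    using quotient_hom by blast
  interpret M: monoid "mat_monoid R.S" by (rule monoid_mat_monoid[OF R.finite_S])
  have closed: "\<rho> x \<in> mats R.S" if "x \<in> carrier G" for x
    using hom_in_carrier[OF \<rho>(1) that] by simp
  have mult: "\<rho> (x \<otimes>\<^bsub>G\<^esub> y) = R.mm (\<rho> x) (\<rho> y)" if "x \<in> carrier G" "y \<in> carrier G" for x y
    using hom_mult[OF \<rho>(1) that] by simp
  have cong: "mat_cong (int p) (\<rho> x) (R.pm (\<Theta> x))" if x: "x \<in> carrier G" for x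
  proof -
    have "x \<in> cl ` words" using x by (simp only: carrier_amalgam)
    then obtain v where "x = cl v" "v \<in> words" by (rule imageE)
    then show ?thesis using emat_cong_pm[OF _ pt] \<rho>(3) \<Theta>(3) by simp
  qed
  have "\<exists>(Q :: nat monoid) \<psi>. finite_p_group p Q \<and> \<psi> \<in> hom G Q \<and>
            \<psi> ` carrier G = carrier Q \<and> \<not> conjugate_in Q (\<psi> (cl w)) (\<psi> (cl v))"
  proof (rule G.finite_p_group_of_fun[OF p, of "\<lambda>x. mat_mod m (\<rho> x)"])
    have "(\<lambda>x. mat_mod m (\<rho> x)) ` carrier G \<subseteq> mat_mod m ` mats R.S" using closed by blast
    then show "finite ((\<lambda>x. mat_mod m (\<rho> x)) ` carrier G)"
      by (rule finite_subset) (rule finite_mat_mod[OF R.finite_S m0])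
  next
    fix x x' y y'
    assume "x \<in> carrier G" "x' \<in> carrier G" "y \<in> carrier G" "y' \<in> carrier G"
      and "mat_mod m (\<rho> x) = mat_mod m (\<rho> x')" "mat_mod m (\<rho> y) = mat_mod m (\<rho> y')"
    then show "mat_mod m (\<rho> (x \<otimes>\<^bsub>G\<^esub> y)) = mat_mod m (\<rho> (x' \<otimes>\<^bsub>G\<^esub> y'))"
      by (simp add: mat_mod_eq_iff mult mat_cong_mult)
  next
    fix x assume x: "x \<in> carrier G"
    obtain f where f: "\<Theta> x [^]\<^bsub>P\<^esub> (p ^ f) = \<one>\<^bsub>P\<^esub>" using P_power hom_in_carrier[OF \<Theta>(1) x] by blast
    let ?y = "x [^]\<^bsub>G\<^esub> (p ^ f)"
    have y: "?y \<in> carrier G" using x by (rule G.nat_pow_closed)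
    have "\<Theta> ?y = \<one>\<^bsub>P\<^esub>"
      using hom_monoid_nat_pow[OF G.is_group P.is_monoid \<Theta>(1,2) x] f by simp
    then have "mat_cong (int p) (\<rho> ?y) (mat_one R.S)" using cong[OF y] R.pm_one by (simp only:)
    then have "mat_cong m (\<rho> ?y [^]\<^bsub>mat_monoid R.S\<^esub> (p ^ k)) (mat_one R.S)"
      unfolding m_def by (rule mat_pow_prime_power_cong_one[OF R.finite_S closed[OF y]])
    moreover have "\<rho> ?y [^]\<^bsub>mat_monoid R.S\<^esub> (p ^ k) = \<rho> (?y [^]\<^bsub>G\<^esub> (p ^ k))"
      using hom_monoid_nat_pow[OF G.is_group M.monoid_axioms \<rho>(1) _ y] \<rho>(2) by simp
    moreover have "?y [^]\<^bsub>G\<^esub> (p ^ k) = x [^]\<^bsub>G\<^esub> (p ^ (f + k))"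
      using x by (simp add: G.nat_pow_pow power_add)
    ultimately have "mat_mod m (\<rho> (x [^]\<^bsub>G\<^esub> (p ^ (f + k)))) = mat_mod m (\<rho> \<one>\<^bsub>G\<^esub>)"
      by (simp only: mat_mod_eq_iff \<rho>(2))
    then show "\<exists>e. mat_mod m (\<rho> (x [^]\<^bsub>G\<^esub> (p ^ e))) = mat_mod m (\<rho> \<one>\<^bsub>G\<^esub>)" by blast
  next
    fix g assume g: "g \<in> carrier G"
    have a: "cl w \<in> carrier G" using w_words by (rule cl_closed)
    have i: "inv\<^bsub>G\<^esub> g \<in> carrier G" using g by (rule G.inv_closed)
    show "mat_mod m (\<rho> (inv\<^bsub>G\<^esub> g \<otimes>\<^bsub>G\<^esub> cl w \<otimes>\<^bsub>G\<^esub> g)) \<noteq> mat_mod m (\<rho> (cl v))"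
    proof
      assume "mat_mod m (\<rho> (inv\<^bsub>G\<^esub> g \<otimes>\<^bsub>G\<^esub> cl w \<otimes>\<^bsub>G\<^esub> g)) = mat_mod m (\<rho> (cl v))"
      then have "mat_cong m (R.mm (\<rho> (inv\<^bsub>G\<^esub> g \<otimes>\<^bsub>G\<^esub> cl w)) (\<rho> g)) (\<rho> (cl v))"
        using mult[OF G.m_closed[OF i a] g] by (simp only: mat_mod_eq_iff)
      \<comment> \<open>Cyclicity of the trace brings g next to its inverse, and they cancel inside
        the amalgam.\<close>
      from mat_cong_trace[OF this, of R.S]
      have "m dvd mat_trace R.S (R.mm (\<rho> g) (\<rho> (inv\<^bsub>G\<^esub> g \<otimes>\<^bsub>G\<^esub> cl w))) - mat_trace R.S (\<rho> (cl v))"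
        by (simp only: mat_trace_commute)
      moreover have "R.mm (\<rho> g) (\<rho> (inv\<^bsub>G\<^esub> g \<otimes>\<^bsub>G\<^esub> cl w)) = \<rho> (cl w)"
        using mult[OF g G.m_closed[OF i a]] G.mult_inv_cancel(1)[OF g a] by simp
      ultimately have "m dvd d" by (simp only: d_def \<rho>(3)[OF v] \<rho>(3)[OF w_words])
      then show False using dm d0 zdvd_imp_le[of m "\<bar>d\<bar>"] by simp
    qed
  qed (use v w_words in auto)
  then show ?thesis unfolding p_conj_separated_def .
qed

text \<open>In degree \<open>length w\<close> the trace of v has coefficient 0: single letters and
  shorter words have smaller degree, and a word of equal length without closed walks has nothing to
  count. The coefficient for w is nonzero by \<open>closed_walks_self\<close>.\<close>

lemma cyc_reduced_separated:
  assumes p: "Factorial_Ring.prime p" and v: "v \<in> words"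
    and cases: "length v = 1 \<or> cyc_reduced v \<and> (length v < length w \<or> length v = length w \<and> closed_walks v = {})"
  shows "p_conj_separated p G (cl w) (cl v)"
proof -
  have "poly_fun (length w) 0 (\<lambda>t. mat_trace R.S (emat t v))"
    using cases
  proof (elim disjE conjE)
    assume "length v = 1"
    then show ?thesis by (rule poly_fun_less[OF trace_single]) (rule w_length)
  next
    assume "cyc_reduced v" "length v < length w"
    then show ?thesis by (rule poly_fun_less[OF trace_cyc_reduced])
  next
    assume "cyc_reduced v" "length v = length w" "closed_walks v = {}"
    then show ?thesis using trace_cyc_reduced[of v] by simp
  qed
  from poly_fun_diff[OF trace_cyc_reduced[OF w] this] show ?thesis
    by (rule rep_separates[OF p v]) (simp add: closed_walks_self R.wsign_nonzero)
qed

end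

section \<open>Central discrepancies between words\<close>

context amalgam
begin

lemma A_commute: "a \<in> A \<Longrightarrow> h \<in> carrier H \<Longrightarrow> a \<otimes>\<^bsub>H\<^esub> h = h \<otimes>\<^bsub>H\<^esub> a"
  using A unfolding central_subgroup_def by blast

lemma B_commute: "b \<in> B \<Longrightarrow> k \<in> carrier K \<Longrightarrow> b \<otimes>\<^bsub>K\<^esub> k = k \<otimes>\<^bsub>K\<^esub> b"
  using B unfolding central_subgroup_def by blast

text \<open>An element of A commutes with letters of H directly and with letters of K after passing
  through \<phi>, so it is central in the whole amalgam.\<close>

lemma cl_A_commute:
  assumes "a \<in> A" "l \<in> words"
  shows "cl [Inl a] \<otimes>\<^bsub>G\<^esub> cl l = cl l \<otimes>\<^bsub>G\<^esub> cl [Inl a]"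
  using assms(2)
proof (induction l)
  case Nil
  then show ?case by (simp add: mult_amalgam)
next
  case (Cons x l)
  have aH: "a \<in> carrier H" and aK: "\<phi> a \<in> carrier K" using assms(1) A_subset \<phi>_in_K by auto
  have l: "l \<in> words" "[x] \<in> words" using Cons.prems by (cases x, auto)+
  have a: "cl [Inl a] \<in> carrier G" using aH by (intro cl_closed) simp
  have x: "cl [Inl a] \<otimes>\<^bsub>G\<^esub> cl [x] = cl [x] \<otimes>\<^bsub>G\<^esub> cl [Inl a]"
  proof (cases x)
    case (Inl h)
    then have "a \<otimes>\<^bsub>H\<^esub> h = h \<otimes>\<^bsub>H\<^esub> a" using A_commute[OF assms(1)] l(2) by simp
    then show ?thesis using Inl l(2) aH by (simp add: mult_amalgam cl_multH)
  next
    case (Inr k)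
    then have "\<phi> a \<otimes>\<^bsub>K\<^esub> k = k \<otimes>\<^bsub>K\<^esub> \<phi> a"
      using B_commute[OF \<phi>_in_B[OF assms(1)]] l(2) by simp
    then show ?thesis using Inr l(2) aK cl_amalg[OF assms(1), of "[]"]
      by (simp add: mult_amalgam cl_multK)
  qed
  have "cl (x # l) = cl [x] \<otimes>\<^bsub>G\<^esub> cl l" by (simp add: mult_amalgam)
  then show ?case
    using a x Cons.IH[OF l(1)] cl_closed[OF l(1)] cl_closed[OF l(2)] by (metis G.m_assoc)
qed

text \<open>As A is central in the amalgam, the discrepancies of the individual letters can be moved
  to the right end and multiplied into one element of A.\<close>

lemma cl_letterwise:
  assumes "length xs = length ys" "xs \<in> words" "ys \<in> words"
    and "\<And>m. m < length xs \<Longrightarrow> \<exists>a\<in>A. cl [ys ! m] = cl [xs ! m] \<otimes>\<^bsub>G\<^esub> cl [Inl a]"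
  shows "\<exists>a\<in>A. cl ys = cl xs \<otimes>\<^bsub>G\<^esub> cl [Inl a]"
  using assms
proof (induction xs ys rule: list_induct2)
  case Nil
  then show ?case
    by (intro bexI[of _ "\<one>\<^bsub>H\<^esub>"]) (simp_all add: mult_amalgam cl_oneH subgroup.one_closed[OF A_subgroup])
next
  case (Cons x xs y ys)
  have w: "[x] \<in> words" "xs \<in> words" "[y] \<in> words" "ys \<in> words"
    using Cons.prems by (cases x; cases y; simp)+
  obtain a where a: "a \<in> A" "cl [y] = cl [x] \<otimes>\<^bsub>G\<^esub> cl [Inl a]" using Cons.prems(3)[of 0] by auto
  have "\<exists>a\<in>A. cl [ys ! m] = cl [xs ! m] \<otimes>\<^bsub>G\<^esub> cl [Inl a]" if "m < length xs" for m
    using Cons.prems(3)[of "Suc m"] that by simp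
  then obtain b where b: "b \<in> A" "cl ys = cl xs \<otimes>\<^bsub>G\<^esub> cl [Inl b]" using Cons.IH w by blast
  have ab: "a \<in> carrier H" "b \<in> carrier H" using a b A_subset by auto
  then have c: "cl [Inl a] \<in> carrier G" "cl [Inl b] \<in> carrier G" by auto
  have "cl (y # ys) = cl [y] \<otimes>\<^bsub>G\<^esub> cl ys" by (simp add: mult_amalgam)
  also have "\<dots> = cl [x] \<otimes>\<^bsub>G\<^esub> (cl [Inl a] \<otimes>\<^bsub>G\<^esub> cl xs) \<otimes>\<^bsub>G\<^esub> cl [Inl b]"
    unfolding a(2) b(2) using c cl_closed[OF w(1)] cl_closed[OF w(2)] by (simp add: G.m_assoc)
  also have "\<dots> = (cl [x] \<otimes>\<^bsub>G\<^esub> cl xs) \<otimes>\<^bsub>G\<^esub> (cl [Inl a] \<otimes>\<^bsub>G\<^esub> cl [Inl b])"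
    unfolding cl_A_commute[OF a(1) w(2)] using c cl_closed[OF w(1)] cl_closed[OF w(2)] by (simp add: G.m_assoc)
  also have "\<dots> = cl (x # xs) \<otimes>\<^bsub>G\<^esub> cl [Inl (a \<otimes>\<^bsub>H\<^esub> b)]"
    using ab by (simp add: mult_amalgam cl_multH)
  finally show ?case using subgroup.m_closed[OF A_subgroup a(1) b(1)] by blast
qed

text \<open>If x and y came from different factors, one component of the quotient would be the
  inverse of the letter x, which would put x into A or B. So both come from one factor, where the
  discrepancy can be read off.\<close>

lemma emb_quotient_central:
  assumes l: "[x] \<in> words" "[y] \<in> words"
    and x: "emb x \<notin> A \<times> B"
    and xy: "inv\<^bsub>\<Gamma>\<^esub> emb x \<otimes>\<^bsub>\<Gamma>\<^esub> emb y \<in> A \<times> B"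
  shows "\<exists>a\<in>A. cl [y] = cl [x] \<otimes>\<^bsub>G\<^esub> cl [Inl a]"
proof (cases x)
  case x': (Inl h)
  have h: "h \<in> carrier H" "h \<notin> A" using l(1) x subgroup.one_closed[OF B_subgroup] by (auto simp: x')
  show ?thesis
  proof (cases y)
    case (Inl h')
    let ?a = "inv\<^bsub>H\<^esub> h \<otimes>\<^bsub>H\<^esub> h'"
    have h': "h' \<in> carrier H" using l(2) Inl by simp
    have a: "?a \<in> A" using xy h h' by (simp add: x' Inl inv_DirProd[OF H.is_group K.is_group])
    have "cl [x] \<otimes>\<^bsub>G\<^esub> cl [Inl ?a] = cl [y]" using h h' by (simp add: x' Inl mult_amalgam cl_multH)
    then show ?thesis using a by metis
  next
    case (Inr k)
    have "k \<in> carrier K" using l(2) Inr by simp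
    then have "inv\<^bsub>H\<^esub> h \<in> A" using xy h by (simp add: x' Inr inv_DirProd[OF H.is_group K.is_group])
    then have "inv\<^bsub>H\<^esub> (inv\<^bsub>H\<^esub> h) \<in> A" by (rule subgroup.m_inv_closed[OF A_subgroup])
    then show ?thesis using h by simp
  qed
next
  case x': (Inr k)
  have k: "k \<in> carrier K" "k \<notin> B" using l(1) x subgroup.one_closed[OF A_subgroup] by (auto simp: x')
  show ?thesis
  proof (cases y)
    case (Inr k')
    let ?b = "inv\<^bsub>K\<^esub> k \<otimes>\<^bsub>K\<^esub> k'"
    have k': "k' \<in> carrier K" using l(2) Inr by simp
    have "?b \<in> B" using xy k k' by (simp add: x' Inr inv_DirProd[OF H.is_group K.is_group])
    then obtain a where a: "a \<in> A" "?b = \<phi> a" using \<phi>_image by blast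
    have "cl [Inl a] = cl [Inr ?b]" using cl_amalg[OF a(1), of "[]"] a(2) by simp
    then have "cl [x] \<otimes>\<^bsub>G\<^esub> cl [Inl a] = cl [y]" using k k' by (simp add: x' Inr mult_amalgam cl_multK)
    then show ?thesis using a(1) by metis
  next
    case (Inl h)
    have "h \<in> carrier H" using l(2) Inl by simp
    then have "inv\<^bsub>K\<^esub> k \<in> B" using xy k by (simp add: x' Inl inv_DirProd[OF H.is_group K.is_group])
    then have "inv\<^bsub>K\<^esub> (inv\<^bsub>K\<^esub> k) \<in> B" by (rule subgroup.m_inv_closed[OF B_subgroup])
    then show ?thesis using k by simp
  qed
qed

end

context amalgam
begin

text \<open>N is chosen so that a closed walk for v would make v conjugate to w: agreement of
  letters modulo \<open>C\<close> in P becomes agreement modulo A, so v is a rotation of w times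
  some a in A, and equality of the products in P forces a = 1.\<close>

lemma cyc_reduced_pair_separated:
  assumes p: "Factorial_Ring.prime p" and res: "p_residual p"
    and w: "cyc_reduced w" and v: "v \<in> words" "length v = 1 \<or> cyc_reduced v" "length v \<le> length w"
    and nconj: "\<not> conjugate_in G (cl w) (cl v)"
  shows "p_conj_separated p G (cl w) (cl v)"
proof -
  let ?n = "length w"
  have ww: "w \<in> words" and n2: "?n \<ge> 2" using w by (auto simp: cyc_reduced_def)
  have n0: "j mod ?n < ?n" for j by (rule mod_less_divisor) (use n2 in linarith)
  have letter: "[u ! j] \<in> words" if "u \<in> words" "j < length u" for u :: "('h + 'k) list" and j
    using that nth_mem unfolding amal_words_def by fastforce
  have w_AB: "emb (w ! j) \<notin> A \<times> B" if "j < ?n" for j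
    using w that unfolding cyc_reduced_def by (cases "even j") (fastforce split: if_splits)+
  \<comment> \<open>These quotients decide whether v agrees letterwise with the i-th rotation of w;
    those outside A x B have to stay outside the image of A.\<close>
  define q where "q i m = inv\<^bsub>\<Gamma>\<^esub> emb (w ! ((i + m) mod ?n)) \<otimes>\<^bsub>\<Gamma>\<^esub> emb (v ! m)" for i m
  define Z where "Z = ((\<lambda>j. emb (w ! j)) ` {..<?n} \<union>
    (if length v = ?n then (\<lambda>(i, m). q i m) ` ({..<?n} \<times> {..<?n}) else {})) - A \<times> B"
  \<comment> \<open>For each rotation one possible discrepancy is fixed before N is known. If there
    is none, \<open>SOME\<close> yields an arbitrary value, and keeping it out of N does no
    harm.\<close>
  define \<alpha> where "\<alpha> i = (SOME a. a \<in> A \<and> cl v = cl (rotate i w) \<otimes>\<^bsub>G\<^esub> cl [Inl a])" for i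
  define W where "W = {a \<in> \<alpha> ` {..<?n}. a \<in> A \<and> a \<noteq> \<one>\<^bsub>H\<^esub>}"
  have wmod: "[w ! (j mod ?n)] \<in> words" for j by (rule letter[OF ww n0])
  have embw: "emb (w ! (j mod ?n)) \<in> carrier \<Gamma>" for j by (rule emb_closed[OF wmod])
  have embv: "emb (v ! m) \<in> carrier \<Gamma>" if "m < length v" for m by (rule emb_closed[OF letter[OF v(1) that]])
  have qc: "q i m \<in> carrier \<Gamma>" if "m < length v" for i m
    unfolding q_def by (rule \<Gamma>.m_closed[OF \<Gamma>.inv_closed[OF embw] embv[OF that]])
  have "emb (w ! j) \<in> carrier \<Gamma>" if "j < ?n" for j by (rule emb_closed[OF letter[OF ww that]])
  then have Z: "finite Z" "Z \<subseteq> carrier \<Gamma> - A \<times> B" using qc by (auto simp: Z_def simp del: carrier_DirProd split: if_splits)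
  have W: "finite W" "W \<subseteq> A - {\<one>\<^bsub>H\<^esub>}" by (auto simp: W_def)
  obtain N where N: "p_normal p N \<Gamma>" "antidiag \<subseteq> N"
    "\<And>z a. z \<in> Z \<Longrightarrow> a \<in> A \<Longrightarrow> N #>\<^bsub>\<Gamma>\<^esub> z \<noteq> N #>\<^bsub>\<Gamma>\<^esub> (a, \<one>\<^bsub>K\<^esub>)"
    "\<And>a. a \<in> W \<Longrightarrow> (a, \<one>\<^bsub>K\<^esub>) \<notin> N"
    using separating_p_normal[OF res Z W] by blast
  interpret q: amalgam_quotient H K A B \<phi> p N
    by unfold_locales (rule N(1), rule N(2))
  have Z_C: "N #>\<^bsub>\<Gamma>\<^esub> z \<notin> q.C" if "z \<in> Z" for z
    using N(3)[OF that] by (auto simp: q.C_def q.\<theta>_def)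
  interpret r: amalgam_rep H K A B \<phi> p N w
  proof
    fix j assume "j < length w"
    then have "emb (w ! j) \<in> Z" using w_AB by (auto simp: Z_def)
    then show "q.\<theta> (w ! j) \<notin> q.C" using Z_C by (simp add: q.\<theta>_def)
  qed (rule w)
  have "r.closed_walks v = {}" if len: "length v = ?n"
  proof (rule ccontr)
    assume "r.closed_walks v \<noteq> {}"
    then obtain x i where xi: "x \<in> carrier q.P" "i < ?n" "r.R.walk (map q.\<theta> v) (x, i) = Some (x, i)"
      unfolding r.closed_walks_def r.R.S_def by auto
    have cw: "(\<forall>m<?n. inv\<^bsub>q.P\<^esub> q.\<theta> (w ! ((i + m) mod ?n)) \<otimes>\<^bsub>q.P\<^esub> map q.\<theta> v ! m \<in> q.C) \<and>
      r.R.lprod (map q.\<theta> v) = r.R.lprod (map (\<lambda>m. q.\<theta> (w ! ((i + m) mod ?n))) [0..<?n])"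
      by (rule r.R.closed_walk[OF r.set_\<theta>[OF v(1)] _ xi]) (simp add: len)
    have rot: "map (\<lambda>m. w ! ((i + m) mod ?n)) [0..<?n] = rotate i w"
      by (rule nth_equalityI) (simp_all add: nth_rotate)
    have "\<exists>a\<in>A. cl v = cl (rotate i w) \<otimes>\<^bsub>G\<^esub> cl [Inl a]"
    proof (rule cl_letterwise)
      fix m assume "m < length (rotate i w)"
      then have m: "m < ?n" by simp
      have "N #>\<^bsub>\<Gamma>\<^esub> q i m = inv\<^bsub>q.P\<^esub> q.\<theta> (w ! ((i + m) mod ?n)) \<otimes>\<^bsub>q.P\<^esub> q.\<theta> (v ! m)"
        unfolding q_def q.\<theta>_def using q.f.hom_mult[OF \<Gamma>.inv_closed[OF embw] embv] q.f.hom_inv[OF embw] m len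
        by (simp only:)
      then have "N #>\<^bsub>\<Gamma>\<^esub> q i m \<in> q.C" using cw m len by (simp del: mult_FactGroup)
      then have "q i m \<notin> Z" using Z_C by blast
      then have "q i m \<in> A \<times> B" using xi(2) m len unfolding Z_def by force
      then have "\<exists>a\<in>A. cl [v ! m] = cl [w ! ((i + m) mod ?n)] \<otimes>\<^bsub>G\<^esub> cl [Inl a]"
        unfolding q_def by (intro emb_quotient_central wmod letter[OF v(1)] w_AB n0) (use m len in simp_all)
      then show "\<exists>a\<in>A. cl [v ! m] = cl [rotate i w ! m] \<otimes>\<^bsub>G\<^esub> cl [Inl a]"
        using m by (simp add: nth_rotate)
    qed (use len ww v(1) in simp_all)
    then have "\<exists>a. a \<in> A \<and> cl v = cl (rotate i w) \<otimes>\<^bsub>G\<^esub> cl [Inl a]" by blast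
    then have "\<alpha> i \<in> A \<and> cl v = cl (rotate i w) \<otimes>\<^bsub>G\<^esub> cl [Inl (\<alpha> i)]"
      unfolding \<alpha>_def by (rule someI_ex)
    then have a: "\<alpha> i \<in> A" "cl v = cl (rotate i w) \<otimes>\<^bsub>G\<^esub> cl [Inl (\<alpha> i)]" by auto
    have aw: "[Inl (\<alpha> i)] \<in> words" and aH: "\<alpha> i \<in> carrier H" using a(1) A_subset by auto
    obtain \<Theta> where \<Theta>: "\<Theta> \<in> hom G q.P" "\<Theta> \<one>\<^bsub>G\<^esub> = \<one>\<^bsub>q.P\<^esub>"
      "\<And>w. w \<in> words \<Longrightarrow> \<Theta> (cl w) = q.lprodP w"
      using q.quotient_hom by blast
    have rw: "rotate i w \<in> words" using ww by simp
    have "\<Theta> (cl v) = \<Theta> (cl (rotate i w))"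
    proof -
      have "map (\<lambda>m. q.\<theta> (w ! ((i + m) mod ?n))) [0..<?n] = map q.\<theta> (rotate i w)"
        unfolding rot[symmetric] by simp
      then show ?thesis
        using cw unfolding \<Theta>(3)[OF v(1)] \<Theta>(3)[OF rw] q.lprodP_eq r.R.lprod_def by (simp only:)
    qed
    \<comment> \<open>Equal products in P force the discrepancy into N, from which all nontrivial
      candidates were excluded.\<close>
    moreover have "\<Theta> (cl v) = \<Theta> (cl (rotate i w)) \<otimes>\<^bsub>q.P\<^esub> \<Theta> (cl [Inl (\<alpha> i)])"
      unfolding a(2) by (rule hom_mult[OF \<Theta>(1) cl_closed[OF rw] cl_closed[OF aw]])
    ultimately have "\<Theta> (cl (rotate i w)) \<otimes>\<^bsub>q.P\<^esub> \<Theta> (cl [Inl (\<alpha> i)])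
        = \<Theta> (cl (rotate i w)) \<otimes>\<^bsub>q.P\<^esub> \<one>\<^bsub>q.P\<^esub>"
      using q.P.r_one[OF hom_in_carrier[OF \<Theta>(1) cl_closed[OF rw]]] by (simp only:)
    then have "\<Theta> (cl [Inl (\<alpha> i)]) = \<one>\<^bsub>q.P\<^esub>"
      by (simp only: q.P.l_cancel hom_in_carrier[OF \<Theta>(1) cl_closed[OF rw]]
          hom_in_carrier[OF \<Theta>(1) cl_closed[OF aw]] q.P.one_closed)
    moreover have "\<Theta> (cl [Inl (\<alpha> i)]) = N #>\<^bsub>\<Gamma>\<^esub> (\<alpha> i, \<one>\<^bsub>K\<^esub>)"
      using q.P.r_one[OF q.\<theta>_closed[OF aw]] unfolding \<Theta>(3)[OF aw] q.lprodP_eq by (simp add: q.\<theta>_def)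
    moreover have "(\<alpha> i, \<one>\<^bsub>K\<^esub>) \<in> carrier \<Gamma>" using aH by simp
    ultimately have "(\<alpha> i, \<one>\<^bsub>K\<^esub>) \<in> N" using q.N.Mod_eq_one_iff by simp
    then have "\<alpha> i \<notin> W" using N(4) by blast
    then have one: "\<alpha> i = \<one>\<^bsub>H\<^esub>" using xi(2) a(1) unfolding W_def by blast
    have "cl v = cl (rotate i w @ [Inl \<one>\<^bsub>H\<^esub>])" using a(2) unfolding one by (simp only: mult_amalgam)
    also have "\<dots> = cl (rotate i w) \<otimes>\<^bsub>G\<^esub> cl []" unfolding mult_amalgam[symmetric] using cl_oneH[of "[]"] by simp
    also have "\<dots> = cl (rotate i w)" by (simp add: mult_amalgam)
    finally have "conjugate_in G (cl w) (cl v)" using conjugate_rotate[OF ww, of i] by simp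
    then show False using nconj by blast
  qed
  then show ?thesis using r.cyc_reduced_separated[OF p v(1)] v(2,3) by fastforce
qed

end

section \<open>Amalgams of nilpotent groups\<close>

lemma DirProd_nat_pow:
  "(h, k) [^]\<^bsub>H \<times>\<times> K\<^esub> (n::nat) = (h [^]\<^bsub>H\<^esub> n, k [^]\<^bsub>K\<^esub> n)"
  by (induction n) (simp_all add: nat_pow_def DirProd_def)

lemma DirProd_commutator:
  assumes "group H" "group K" "h \<in> carrier H" "h' \<in> carrier H" "k \<in> carrier K" "k' \<in> carrier K"
  shows "commutator (H \<times>\<times> K) (h, k) (h', k') = (commutator H h h', commutator K k k')"
  using assms by (simp add: commutator_def)

lemma fin_gen_DirProd:
  assumes "fin_gen_group H" "fin_gen_group K"
  shows "fin_gen_group (H \<times>\<times> K)"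
proof -
  obtain S where S: "finite S" "S \<subseteq> carrier H" "generate H S = carrier H"
    using assms(1) unfolding fin_gen_group_def by blast
  obtain T where T: "finite T" "T \<subseteq> carrier K" "generate K T = carrier K"
    using assms(2) unfolding fin_gen_group_def by blast
  interpret H: group H using assms(1) by (simp add: fin_gen_group_def)
  interpret K: group K using assms(2) by (simp add: fin_gen_group_def)
  interpret D: group "H \<times>\<times> K" by (rule DirProd_group[OF H.is_group K.is_group])
  let ?i = "\<lambda>h. (h, \<one>\<^bsub>K\<^esub>)" and ?j = "\<lambda>k. (\<one>\<^bsub>H\<^esub>, k)"
  interpret i: group_hom H "H \<times>\<times> K" ?i by unfold_locales (auto simp: hom_def)
  interpret j: group_hom K "H \<times>\<times> K" ?j by unfold_locales (auto simp: hom_def)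
  let ?U = "?i ` S \<union> ?j ` T"
  have U: "finite ?U" "?U \<subseteq> carrier (H \<times>\<times> K)" using S T by auto
  have "?i ` carrier H \<subseteq> generate (H \<times>\<times> K) ?U"
    using i.generate_img[OF S(2)] S(3) D.mono_generate[of "?i ` S" ?U] by simp
  moreover have "?j ` carrier K \<subseteq> generate (H \<times>\<times> K) ?U"
    using j.generate_img[OF T(2)] T(3) D.mono_generate[of "?j ` T" ?U] by simp
  ultimately have "(h, k) \<in> generate (H \<times>\<times> K) ?U" if "h \<in> carrier H" "k \<in> carrier K" for h k
    using generate.eng[of "?i h" "H \<times>\<times> K" ?U "?j k"] that by auto
  then have "generate (H \<times>\<times> K) ?U = carrier (H \<times>\<times> K)"
    using D.generate_incl[OF U(2)] by (intro equalityI) auto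
  then show ?thesis unfolding fin_gen_group_def using U D.is_group by blast
qed

lemma (in group) lower_central_antimono: "i \<le> j \<Longrightarrow> lower_central G j \<subseteq> lower_central G i"
  by (induction rule: dec_induct) (use lower_central_Suc_subset in blast)+

lemma nilpotent_DirProd:
  assumes "nilpotent_group H" "nilpotent_group K"
  shows "nilpotent_group (H \<times>\<times> K)"
proof -
  interpret H: group H using assms(1) by (simp add: nilpotent_group_def)
  interpret K: group K using assms(2) by (simp add: nilpotent_group_def)
  interpret D: group "H \<times>\<times> K" by (rule DirProd_group[OF H.is_group K.is_group])
  have sub: "lower_central (H \<times>\<times> K) i \<subseteq> lower_central H i \<times> lower_central K i" for i
  proof (induction i)
    case (Suc i)
    show ?case unfolding D.lower_central_Suc
    proof (rule D.generate_subgroup_incl)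
      show "subgroup (lower_central H (Suc i) \<times> lower_central K (Suc i)) (H \<times>\<times> K)"
        by (rule DirProd_subgroups[OF H.is_group H.lower_central_subgroup K.is_group K.lower_central_subgroup])
      show "{commutator (H \<times>\<times> K) x y | x y. x \<in> lower_central (H \<times>\<times> K) i \<and> y \<in> carrier (H \<times>\<times> K)}
          \<subseteq> lower_central H (Suc i) \<times> lower_central K (Suc i)"
      proof
        fix z assume "z \<in> {commutator (H \<times>\<times> K) x y | x y. x \<in> lower_central (H \<times>\<times> K) i \<and> y \<in> carrier (H \<times>\<times> K)}"
        then obtain h k h' k' where z: "z = commutator (H \<times>\<times> K) (h, k) (h', k')"
          and hk: "(h, k) \<in> lower_central (H \<times>\<times> K) i" and y: "(h', k') \<in> carrier (H \<times>\<times> K)"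
          by (auto simp del: carrier_DirProd)
        from hk have x: "h \<in> lower_central H i" "k \<in> lower_central K i" using Suc by auto
        have c: "h \<in> carrier H" "k \<in> carrier K" "h' \<in> carrier H" "k' \<in> carrier K"
          using subsetD[OF H.lower_central_subset x(1)] subsetD[OF K.lower_central_subset x(2)] y by auto
        show "z \<in> lower_central H (Suc i) \<times> lower_central K (Suc i)"
          unfolding z DirProd_commutator[OF H.is_group K.is_group c(1,3,2,4)]
          using H.commutator_in_lower_central[OF x(1) c(3)] K.commutator_in_lower_central[OF x(2) c(4)]
          by simp
      qed
    qed
  qed simp
  obtain m where m: "lower_central H m = {\<one>\<^bsub>H\<^esub>}" using assms(1) unfolding nilpotent_group_def by blast
  obtain n where n: "lower_central K n = {\<one>\<^bsub>K\<^esub>}" using assms(2) unfolding nilpotent_group_def by blast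
  have "lower_central (H \<times>\<times> K) (max m n) \<subseteq> {\<one>\<^bsub>H\<^esub>} \<times> {\<one>\<^bsub>K\<^esub>}"
    using sub[of "max m n"] H.lower_central_antimono[of m "max m n"] K.lower_central_antimono[of n "max m n"] m n
    by auto
  moreover have "\<one>\<^bsub>H \<times>\<times> K\<^esub> \<in> lower_central (H \<times>\<times> K) (max m n)"
    by (rule subgroup.one_closed[OF D.lower_central_subgroup])
  ultimately have "lower_central (H \<times>\<times> K) (max m n) = {\<one>\<^bsub>H \<times>\<times> K\<^esub>}" by auto
  then show ?thesis unfolding nilpotent_group_def using D.is_group by blast
qed

text \<open>The order of the image of y divides both q and a power of p. Consequently kernels of
  homomorphisms to finite p-groups are p'-isolated.\<close>

lemma p_power_hom_isolated:
  assumes G: "group G" and p: "Factorial_Ring.prime p" and Q: "finite_p_group p Q" and \<psi>: "\<psi> \<in> hom G Q"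
    and y: "y \<in> carrier G" and q: "Factorial_Ring.prime q" "q \<noteq> p" "\<psi> (y [^]\<^bsub>G\<^esub> q) = \<one>\<^bsub>Q\<^esub>"
  shows "\<psi> y = \<one>\<^bsub>Q\<^esub>"
proof -
  interpret Q: group Q using Q by (simp add: finite_p_group_def)
  interpret \<psi>: group_hom G Q \<psi> using G \<psi> by (simp add: group_hom_def group_hom_axioms_def Q.is_group)
  obtain k where k: "Coset.order Q = p ^ k"
    using Q unfolding finite_p_group_def Coset.order_def by blast
  have c: "\<psi> y \<in> carrier Q" using y by simp
  have "Q.ord (\<psi> y) dvd p ^ k" using Q.ord_dvd_group_order[OF c] k by simp
  moreover have "Q.ord (\<psi> y) dvd q" using q(3) Q.pow_eq_id[OF c, of q] \<psi>.hom_nat_pow[OF y] by simp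
  moreover have "coprime (p ^ k) q" using primes_coprime[OF p q(1)] q(2) by simp
  ultimately have "Q.ord (\<psi> y) = 1" using coprime_common_divisor_nat by blast
  then show ?thesis using Q.pow_ord_eq_1[OF c] c by simp
qed

section \<open>Isolated normal subgroups of the direct product\<close>

locale nilpotent_amalgam = amalgam H K A B \<phi>
  for H :: "('h, 'c) monoid_scheme" and K :: "('k, 'd) monoid_scheme" and A B \<phi> +
  fixes p :: nat
  assumes p: "Factorial_Ring.prime p"
    and fg: "fin_gen_group H" "fin_gen_group K"
    and nil: "nilpotent_group H" "nilpotent_group K"
    and sep: "conj_p_separable p H" "conj_p_separable p K"
    and iso: "p'_isolated p A H" "p'_isolated p B K"
begin

lemma \<Gamma>_separation:
  assumes "M \<lhd> \<Gamma>" "p'_isolated p M \<Gamma>" "z \<in> carrier \<Gamma>" "z \<notin> M"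
  shows "\<exists>N. p_normal p N \<Gamma> \<and> M \<subseteq> N \<and> z \<notin> N"
  by (rule \<Gamma>.p_normal_separation[OF p fin_gen_DirProd[OF fg] nilpotent_DirProd[OF nil] assms]) blast

lemma \<Gamma>_isolated:
  assumes "p'_isolated p R H" "p'_isolated p T K"
  shows "p'_isolated p (R \<times> T) \<Gamma>"
  using assms unfolding p'_isolated_def q_isolated_def by (auto simp: DirProd_nat_pow)

lemma A_normal: "A \<lhd> H" and B_normal: "B \<lhd> K"
proof -
  have "A \<subseteq> center H" using A_commute A_subset by (auto intro!: centerI)
  then show "A \<lhd> H" by (rule H.normal_if_central[OF A_subgroup])
  have "B \<subseteq> center K" using B_commute B_subset by (auto intro!: centerI)
  then show "B \<lhd> K" by (rule K.normal_if_central[OF B_subgroup])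
qed

lemma normal_DirProd:
  assumes "R \<lhd> H" "T \<lhd> K"
  shows "R \<times> T \<lhd> \<Gamma>"
  by (rule H.DirProd_normal[OF K.is_group assms])

text \<open>The subgroup generated by \<open>R \<times> {1}\<close> and \<open>antidiag\<close>; the quotient of \<open>\<Gamma>\<close> by it is the amalgamated
  central product, into which \<open>H / R\<close> embeds.\<close>
definition twisted :: "'h set \<Rightarrow> ('h \<times> 'k) set" where
  "twisted R = {(h, k) \<in> carrier \<Gamma>. \<exists>a\<in>A. k = inv\<^bsub>K\<^esub> \<phi> a \<and> h \<otimes>\<^bsub>H\<^esub> inv\<^bsub>H\<^esub> a \<in> R}"

lemma \<phi>_one: "\<phi> \<one>\<^bsub>H\<^esub> = \<one>\<^bsub>K\<^esub>"
  using \<phi>_mult[of "\<one>\<^bsub>H\<^esub>" "\<one>\<^bsub>H\<^esub>"] \<phi>_in_K subgroup.one_closed[OF A_subgroup]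
  by (simp add: K.l_cancel_one')

lemma \<phi>_inv:
  assumes a: "a \<in> A"
  shows "\<phi> (inv\<^bsub>H\<^esub> a) = inv\<^bsub>K\<^esub> \<phi> a"
proof -
  have i: "inv\<^bsub>H\<^esub> a \<in> A" by (rule subgroup.m_inv_closed[OF A_subgroup a])
  have "\<phi> (inv\<^bsub>H\<^esub> a) \<otimes>\<^bsub>K\<^esub> \<phi> a = \<one>\<^bsub>K\<^esub>"
    using \<phi>_mult[OF i a] subsetD[OF A_subset a] by (simp add: \<phi>_one)
  then show ?thesis using K.inv_equality \<phi>_in_K a i by metis
qed

lemma \<phi>_pow:
  assumes "a \<in> A"
  shows "\<phi> (a [^]\<^bsub>H\<^esub> (n::nat)) = \<phi> a [^]\<^bsub>K\<^esub> n"
proof (induction n)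
  case (Suc n)
  then show ?case using \<phi>_mult[OF H.nat_pow_mem[OF A_subgroup assms, of n] assms] by simp
qed (simp add: \<phi>_one)

text \<open>Conjugation keeps the witness a: the second component is central, and the first changes
  by conjugating its part in R, since a is central in H.\<close>

lemma twisted_normal:
  assumes R: "R \<lhd> H"
  shows "twisted R \<lhd> \<Gamma>"
proof -
  interpret R: normal R H by (rule R)
  have A': "a \<in> carrier H" "inv\<^bsub>H\<^esub> a \<in> A" "inv\<^bsub>H\<^esub> a \<in> carrier H" if "a \<in> A" for a
    using that A_subset subgroup.m_inv_closed[OF A_subgroup] by auto
  have ac: "inv\<^bsub>H\<^esub> a \<otimes>\<^bsub>H\<^esub> h = h \<otimes>\<^bsub>H\<^esub> inv\<^bsub>H\<^esub> a" if "a \<in> A" "h \<in> carrier H" for a h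
    by (rule A_commute[OF A'(2)[OF that(1)] that(2)])
  have memI: "(h, inv\<^bsub>K\<^esub> \<phi> a) \<in> twisted R" if "h \<in> carrier H" "a \<in> A" "h \<otimes>\<^bsub>H\<^esub> inv\<^bsub>H\<^esub> a \<in> R" for h a
    using that \<phi>_in_K unfolding twisted_def by auto
  have memE: "\<exists>h a. z = (h, inv\<^bsub>K\<^esub> \<phi> a) \<and> h \<in> carrier H \<and> a \<in> A \<and> h \<otimes>\<^bsub>H\<^esub> inv\<^bsub>H\<^esub> a \<in> R" if "z \<in> twisted R" for z
    using that unfolding twisted_def by auto
  show ?thesis unfolding \<Gamma>.normal_inv_iff
  proof (intro conjI ballI)
    show "subgroup (twisted R) \<Gamma>"
    proof
      show "twisted R \<subseteq> carrier \<Gamma>" by (auto simp: twisted_def)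
      show "\<one>\<^bsub>\<Gamma>\<^esub> \<in> twisted R"
        using memI[of "\<one>\<^bsub>H\<^esub>" "\<one>\<^bsub>H\<^esub>"] subgroup.one_closed[OF A_subgroup] R.one_closed by (simp add: \<phi>_one)
    next
      fix x y assume "x \<in> twisted R" "y \<in> twisted R"
      then obtain h a h' a' where x: "x = (h, inv\<^bsub>K\<^esub> \<phi> a)" "h \<in> carrier H" "a \<in> A" "h \<otimes>\<^bsub>H\<^esub> inv\<^bsub>H\<^esub> a \<in> R"
        and y: "y = (h', inv\<^bsub>K\<^esub> \<phi> a')" "h' \<in> carrier H" "a' \<in> A" "h' \<otimes>\<^bsub>H\<^esub> inv\<^bsub>H\<^esub> a' \<in> R"
        using memE by blast
      note aa = subgroup.m_closed[OF A_subgroup x(3) y(3)]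
      have "inv\<^bsub>K\<^esub> \<phi> a \<otimes>\<^bsub>K\<^esub> inv\<^bsub>K\<^esub> \<phi> a' = inv\<^bsub>K\<^esub> \<phi> (a \<otimes>\<^bsub>H\<^esub> a')"
        using \<phi>_in_K[OF x(3)] \<phi>_in_K[OF y(3)] B_commute[OF \<phi>_in_B[OF x(3)] \<phi>_in_K[OF y(3)]]
        by (simp add: \<phi>_mult[OF x(3) y(3)] K.inv_mult_group)
      moreover have "(h \<otimes>\<^bsub>H\<^esub> inv\<^bsub>H\<^esub> a) \<otimes>\<^bsub>H\<^esub> (h' \<otimes>\<^bsub>H\<^esub> inv\<^bsub>H\<^esub> a') = (h \<otimes>\<^bsub>H\<^esub> h') \<otimes>\<^bsub>H\<^esub> inv\<^bsub>H\<^esub> (a \<otimes>\<^bsub>H\<^esub> a')"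
      proof -
        have "(h \<otimes>\<^bsub>H\<^esub> inv\<^bsub>H\<^esub> a) \<otimes>\<^bsub>H\<^esub> (h' \<otimes>\<^bsub>H\<^esub> inv\<^bsub>H\<^esub> a') = h \<otimes>\<^bsub>H\<^esub> (inv\<^bsub>H\<^esub> a \<otimes>\<^bsub>H\<^esub> (h' \<otimes>\<^bsub>H\<^esub> inv\<^bsub>H\<^esub> a'))"
          using x(2) y(2) A'[OF x(3)] A'[OF y(3)] by (simp add: H.m_assoc)
        also have "\<dots> = h \<otimes>\<^bsub>H\<^esub> ((h' \<otimes>\<^bsub>H\<^esub> inv\<^bsub>H\<^esub> a') \<otimes>\<^bsub>H\<^esub> inv\<^bsub>H\<^esub> a)"
          using ac[OF x(3), of "h' \<otimes>\<^bsub>H\<^esub> inv\<^bsub>H\<^esub> a'"] y(2) A'[OF y(3)] by simp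
        finally show ?thesis
          using x(2) y(2) A'[OF x(3)] A'[OF y(3)] by (simp add: H.m_assoc H.inv_mult_group)
      qed
      ultimately show "x \<otimes>\<^bsub>\<Gamma>\<^esub> y \<in> twisted R"
        using memI[of "h \<otimes>\<^bsub>H\<^esub> h'" "a \<otimes>\<^bsub>H\<^esub> a'"] x y aa R.m_closed[OF x(4) y(4)]
        by (simp add: mult_DirProd)
    next
      fix x assume "x \<in> twisted R"
      then obtain h a where x: "x = (h, inv\<^bsub>K\<^esub> \<phi> a)" "h \<in> carrier H" "a \<in> A" "h \<otimes>\<^bsub>H\<^esub> inv\<^bsub>H\<^esub> a \<in> R"
        using memE by blast
      have "inv\<^bsub>H\<^esub> (h \<otimes>\<^bsub>H\<^esub> inv\<^bsub>H\<^esub> a) = inv\<^bsub>H\<^esub> h \<otimes>\<^bsub>H\<^esub> inv\<^bsub>H\<^esub> (inv\<^bsub>H\<^esub> a)"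
        using x(2) A'[OF x(3)] A_commute[OF x(3), of "inv\<^bsub>H\<^esub> h"] by (simp add: H.inv_mult_group)
      then have "inv\<^bsub>H\<^esub> h \<otimes>\<^bsub>H\<^esub> inv\<^bsub>H\<^esub> (inv\<^bsub>H\<^esub> a) \<in> R" using R.m_inv_closed[OF x(4)] by simp
      then show "inv\<^bsub>\<Gamma>\<^esub> x \<in> twisted R"
        using memI[of "inv\<^bsub>H\<^esub> h" "inv\<^bsub>H\<^esub> a"] x A'[OF x(3)] \<phi>_in_K[OF x(3)]
        by (simp add: \<phi>_inv inv_DirProd[OF H.is_group K.is_group])
    qed
  next
    fix g x assume g: "g \<in> carrier \<Gamma>" and "x \<in> twisted R"
    then obtain h a where x: "x = (h, inv\<^bsub>K\<^esub> \<phi> a)" "h \<in> carrier H" "a \<in> A" "h \<otimes>\<^bsub>H\<^esub> inv\<^bsub>H\<^esub> a \<in> R"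
      using memE by blast
    obtain u k where gk: "g = (u, k)" "u \<in> carrier H" "k \<in> carrier K" using g by auto
    have iB: "inv\<^bsub>K\<^esub> \<phi> a \<in> B" "inv\<^bsub>K\<^esub> \<phi> a \<in> carrier K"
      using subgroup.m_inv_closed[OF B_subgroup \<phi>_in_B[OF x(3)]] \<phi>_in_K[OF x(3)] by auto
    have "k \<otimes>\<^bsub>K\<^esub> inv\<^bsub>K\<^esub> \<phi> a \<otimes>\<^bsub>K\<^esub> inv\<^bsub>K\<^esub> k = inv\<^bsub>K\<^esub> \<phi> a"
      using gk(3) iB(2) B_commute[OF iB(1) gk(3), symmetric] by (simp add: K.m_assoc)
    moreover have "u \<otimes>\<^bsub>H\<^esub> (h \<otimes>\<^bsub>H\<^esub> inv\<^bsub>H\<^esub> a) \<otimes>\<^bsub>H\<^esub> inv\<^bsub>H\<^esub> u = (u \<otimes>\<^bsub>H\<^esub> h \<otimes>\<^bsub>H\<^esub> inv\<^bsub>H\<^esub> u) \<otimes>\<^bsub>H\<^esub> inv\<^bsub>H\<^esub> a"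
      using gk(2) x(2) A'[OF x(3)] ac[OF x(3), of "inv\<^bsub>H\<^esub> u"] by (simp add: H.m_assoc)
    ultimately show "g \<otimes>\<^bsub>\<Gamma>\<^esub> x \<otimes>\<^bsub>\<Gamma>\<^esub> inv\<^bsub>\<Gamma>\<^esub> g \<in> twisted R"
      using memI[of "u \<otimes>\<^bsub>H\<^esub> h \<otimes>\<^bsub>H\<^esub> inv\<^bsub>H\<^esub> u" a] x gk R.inv_op_closed2[OF gk(2) x(4)]
      by (simp add: inv_DirProd[OF H.is_group K.is_group])
  qed
qed

text \<open>Isolation of B puts the second component of a q-th root into B, so it is the inverse of
  some \<phi> b. Injectivity of \<phi> gives \<open>b [^] q\<close> = a, and as b is central, the
  q-th power of h b^(-1) lies in R.\<close>

lemma twisted_isolated: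
  assumes "p'_isolated p R H"
  shows "p'_isolated p (twisted R) \<Gamma>"
  unfolding p'_isolated_def q_isolated_def
proof (intro allI impI ballI)
  fix q z assume q: "Factorial_Ring.prime q \<and> q \<noteq> p" and z: "z \<in> carrier \<Gamma>" "z [^]\<^bsub>\<Gamma>\<^esub> q \<in> twisted R"
  obtain h k where hk: "z = (h, k)" "h \<in> carrier H" "k \<in> carrier K" using z(1) by auto
  obtain a where a: "a \<in> A" "k [^]\<^bsub>K\<^esub> q = inv\<^bsub>K\<^esub> \<phi> a" "h [^]\<^bsub>H\<^esub> q \<otimes>\<^bsub>H\<^esub> inv\<^bsub>H\<^esub> a \<in> R"
    using z(2) unfolding hk(1) DirProd_nat_pow twisted_def by auto
  have "k [^]\<^bsub>K\<^esub> q \<in> B" unfolding a(2) by (rule subgroup.m_inv_closed[OF B_subgroup \<phi>_in_B[OF a(1)]])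
  then have "k \<in> B" using iso(2) q hk(3) unfolding p'_isolated_def q_isolated_def by blast
  then have "inv\<^bsub>K\<^esub> k \<in> B" by (rule subgroup.m_inv_closed[OF B_subgroup])
  then obtain b where b: "b \<in> A" "inv\<^bsub>K\<^esub> k = \<phi> b" using \<phi>_image by blast
  have k: "k = inv\<^bsub>K\<^esub> \<phi> b" using hk(3) b(2)[symmetric] by simp
  have bH: "b \<in> carrier H" "inv\<^bsub>H\<^esub> b \<in> A" "inv\<^bsub>H\<^esub> b \<in> carrier H"
    using b(1) A_subset subgroup.m_inv_closed[OF A_subgroup] by auto
  have bq: "b [^]\<^bsub>H\<^esub> q \<in> A" by (rule H.nat_pow_mem[OF A_subgroup b(1)])
  have "inv\<^bsub>K\<^esub> \<phi> (b [^]\<^bsub>H\<^esub> q) = inv\<^bsub>K\<^esub> \<phi> a"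
    using a(2) \<phi>_in_K[OF b(1)] by (simp add: k \<phi>_pow[OF b(1)] K.nat_pow_inv)
  then have "\<phi> (b [^]\<^bsub>H\<^esub> q) = \<phi> a"
    using \<phi>_in_K[OF bq] \<phi>_in_K[OF a(1)] by (metis K.inv_inv)
  then have "b [^]\<^bsub>H\<^esub> q = a" using inj_onD[OF \<phi>_inj _ bq a(1)] by blast
  moreover have "(h \<otimes>\<^bsub>H\<^esub> inv\<^bsub>H\<^esub> b) [^]\<^bsub>H\<^esub> q = h [^]\<^bsub>H\<^esub> q \<otimes>\<^bsub>H\<^esub> inv\<^bsub>H\<^esub> (b [^]\<^bsub>H\<^esub> q)"
    using H.pow_mult_distrib[OF A_commute[OF bH(2) hk(2), symmetric] hk(2) bH(3), of q] bH(1)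
    by (simp add: H.nat_pow_inv)
  ultimately have "(h \<otimes>\<^bsub>H\<^esub> inv\<^bsub>H\<^esub> b) [^]\<^bsub>H\<^esub> q \<in> R" using a(3) by simp
  then have "h \<otimes>\<^bsub>H\<^esub> inv\<^bsub>H\<^esub> b \<in> R"
    using assms q H.m_closed[OF hk(2) bH(3)] unfolding p'_isolated_def q_isolated_def by blast
  then show "z \<in> twisted R" unfolding twisted_def hk(1) using hk(2,3) b(1) k by auto
qed

lemma antidiag_twisted:
  assumes "\<one>\<^bsub>H\<^esub> \<in> R"
  shows "antidiag \<subseteq> twisted R"
proof
  fix z assume "z \<in> antidiag"
  then obtain a where a: "z = (a, inv\<^bsub>K\<^esub> \<phi> a)" "a \<in> A" unfolding antidiag_def by blast
  then show "z \<in> twisted R"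
    using assms subsetD[OF A_subset a(2)] \<phi>_in_K[OF a(2)] unfolding twisted_def by auto
qed

lemma twisted_H:
  assumes "h \<in> carrier H"
  shows "(h, \<one>\<^bsub>K\<^esub>) \<in> twisted R \<longleftrightarrow> h \<in> R"
proof
  assume "(h, \<one>\<^bsub>K\<^esub>) \<in> twisted R"
  then obtain a where a: "a \<in> A" "\<one>\<^bsub>K\<^esub> = inv\<^bsub>K\<^esub> \<phi> a" "h \<otimes>\<^bsub>H\<^esub> inv\<^bsub>H\<^esub> a \<in> R"
    unfolding twisted_def by auto
  have "\<phi> a = \<phi> \<one>\<^bsub>H\<^esub>" using a(2) \<phi>_in_K[OF a(1)] unfolding \<phi>_one by (metis K.inv_inv K.inv_one)
  then have "a = \<one>\<^bsub>H\<^esub>" using inj_onD[OF \<phi>_inj _ a(1) subgroup.one_closed[OF A_subgroup]] by blast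
  then show "h \<in> R" using a(3) assms by simp
next
  assume "h \<in> R"
  then show "(h, \<one>\<^bsub>K\<^esub>) \<in> twisted R"
    using assms subgroup.one_closed[OF A_subgroup] unfolding twisted_def
    by (auto intro!: bexI[of _ "\<one>\<^bsub>H\<^esub>"] simp: \<phi>_one)
qed

end

text \<open>Every element of P is the coset of some z, so conjugacy of the images of two letters
  reduces to conjugacy in H x K modulo N.\<close>

lemma (in amalgam_quotient) quotient_separates:
  assumes p: "Factorial_Ring.prime p" and xy: "[x] \<in> words" "[y] \<in> words"
    and neq: "\<And>z. z \<in> carrier \<Gamma> \<Longrightarrow> N #>\<^bsub>\<Gamma>\<^esub> (inv\<^bsub>\<Gamma>\<^esub> z \<otimes>\<^bsub>\<Gamma>\<^esub> emb x \<otimes>\<^bsub>\<Gamma>\<^esub> z) \<noteq> N #>\<^bsub>\<Gamma>\<^esub> emb y"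
  shows "p_conj_separated p G (cl [x]) (cl [y])"
proof -
  obtain \<Theta> where \<Theta>: "\<Theta> \<in> hom G P" "\<Theta> \<one>\<^bsub>G\<^esub> = \<one>\<^bsub>P\<^esub>" "\<And>w. w \<in> words \<Longrightarrow> \<Theta> (cl w) = lprodP w"
    using quotient_hom by blast
  interpret t: group_hom G P \<Theta> using \<Theta>(1) by unfold_locales
  have single: "\<Theta> (cl [l]) = N #>\<^bsub>\<Gamma>\<^esub> emb l" if "[l] \<in> words" for l
    using P.r_one[OF \<theta>_closed[OF that]] unfolding \<Theta>(3)[OF that] lprodP_eq by (simp add: \<theta>_def)
  have x: "cl [x] \<in> carrier G" and y: "cl [y] \<in> carrier G" using xy by (auto intro: cl_closed)
  show ?thesis unfolding p_conj_separated_def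
  proof (rule G.finite_p_group_of_fun[OF p, of \<Theta>])
    show "finite (\<Theta> ` carrier G)"
      by (rule finite_subset[OF _ finite_P]) (use t.hom_closed in blast)
  next
    fix a a' b b' assume "a \<in> carrier G" "a' \<in> carrier G" "b \<in> carrier G" "b' \<in> carrier G"
      "\<Theta> a = \<Theta> a'" "\<Theta> b = \<Theta> b'"
    then show "\<Theta> (a \<otimes>\<^bsub>G\<^esub> b) = \<Theta> (a' \<otimes>\<^bsub>G\<^esub> b')" by (simp only: t.hom_mult)
  next
    fix a assume a: "a \<in> carrier G"
    then show "\<exists>e. \<Theta> (a [^]\<^bsub>G\<^esub> (p ^ e)) = \<Theta> \<one>\<^bsub>G\<^esub>"
      using P_power[OF t.hom_closed[OF a]] by (simp only: t.hom_nat_pow[OF a] \<Theta>(2))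
  next
    fix g assume g: "g \<in> carrier G"
    have "\<Theta> g \<in> (\<lambda>z. N #>\<^bsub>\<Gamma>\<^esub> z) ` carrier \<Gamma>" using t.hom_closed[OF g] by (simp only: carrier_FactGroup)
    then obtain z where z: "\<Theta> g = N #>\<^bsub>\<Gamma>\<^esub> z" "z \<in> carrier \<Gamma>" by (rule imageE)
    note e = emb_closed[OF xy(1)]
    have "\<Theta> (inv\<^bsub>G\<^esub> g \<otimes>\<^bsub>G\<^esub> cl [x] \<otimes>\<^bsub>G\<^esub> g) = inv\<^bsub>P\<^esub> \<Theta> g \<otimes>\<^bsub>P\<^esub> \<Theta> (cl [x]) \<otimes>\<^bsub>P\<^esub> \<Theta> g"
      using g x by (simp only: t.hom_mult t.hom_inv G.m_closed G.inv_closed)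
    also have "\<dots> = N #>\<^bsub>\<Gamma>\<^esub> (inv\<^bsub>\<Gamma>\<^esub> z \<otimes>\<^bsub>\<Gamma>\<^esub> emb x \<otimes>\<^bsub>\<Gamma>\<^esub> z)"
      using z e by (simp only: z(1) single[OF xy(1)] f.hom_mult f.hom_inv \<Gamma>.m_closed \<Gamma>.inv_closed)
    finally show "\<Theta> (inv\<^bsub>G\<^esub> g \<otimes>\<^bsub>G\<^esub> cl [x] \<otimes>\<^bsub>G\<^esub> g) \<noteq> \<Theta> (cl [y])"
      using neq[OF z(2)] by (simp only: single[OF xy(2)] not_False_eq_True)
  qed (rule x, rule y)
qed

section \<open>Transport of separation along homomorphisms and conjugation\<close>

lemma p_conj_separated_vimage:
  assumes "f \<in> hom G G'" "f ` carrier G = carrier G'" "p_conj_separated p G' (f a) (f b)"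
  shows "p_conj_separated p G a b"
proof -
  obtain Q :: "nat monoid" and \<psi> where Q: "finite_p_group p Q" "\<psi> \<in> hom G' Q"
    "\<psi> ` carrier G' = carrier Q" "\<not> conjugate_in Q (\<psi> (f a)) (\<psi> (f b))"
    using assms(3) unfolding p_conj_separated_def by blast
  have "\<psi> \<circ> f \<in> hom G Q" by (rule hom_compose[OF assms(1) Q(2)])
  moreover have "(\<psi> \<circ> f) ` carrier G = carrier Q" using assms(2) Q(3) by (metis image_comp)
  ultimately show ?thesis unfolding p_conj_separated_def using Q(1,4) by (metis comp_apply)
qed

lemma (in group_hom) conjugate_in_img:
  assumes "a \<in> carrier G" "conjugate_in G a b"
  shows "conjugate_in H (h a) (h b)"
proof -
  obtain g where "g \<in> carrier G" "b = inv g \<otimes> a \<otimes> g" using assms(2) unfolding conjugate_in_def by blast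
  then show ?thesis unfolding conjugate_in_def using assms(1) by (intro bexI[of _ "h g"]) simp_all
qed

lemma p_conj_separated_conjugate:
  assumes G: "group G" and c: "a \<in> carrier G" "b \<in> carrier G" "a' \<in> carrier G" "b' \<in> carrier G"
    and conj: "conjugate_in G a a'" "conjugate_in G b b'" and sep: "p_conj_separated p G a' b'"
  shows "p_conj_separated p G a b"
proof -
  obtain Q :: "nat monoid" and \<psi> where Q: "finite_p_group p Q" "\<psi> \<in> hom G Q"
    "\<psi> ` carrier G = carrier Q" "\<not> conjugate_in Q (\<psi> a') (\<psi> b')"
    using sep unfolding p_conj_separated_def by blast
  interpret f: group_hom G Q \<psi>
    using Q(1,2) G by (simp add: group_hom_def group_hom_axioms_def finite_p_group_def)
  have "\<not> conjugate_in Q (\<psi> a) (\<psi> b)"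
  proof
    assume ab: "conjugate_in Q (\<psi> a) (\<psi> b)"
    have "conjugate_in Q (\<psi> a') (\<psi> a)"
      by (rule f.H.conjugate_in_sym[OF f.hom_closed[OF c(1)] f.conjugate_in_img[OF c(1) conj(1)]])
    moreover have "conjugate_in Q (\<psi> a) (\<psi> b')"
      by (rule f.H.conjugate_in_trans[OF f.hom_closed[OF c(1)] ab f.conjugate_in_img[OF c(2) conj(2)]])
    ultimately show False using f.H.conjugate_in_trans[OF f.hom_closed[OF c(3)]] Q(4) by blast
  qed
  then show ?thesis unfolding p_conj_separated_def using Q(1-3) by blast
qed

lemma p_conj_separated_sym:
  assumes "b \<in> carrier G" "p_conj_separated p G a b"
  shows "p_conj_separated p G b a"
proof -
  obtain Q :: "nat monoid" and \<psi> where Q: "finite_p_group p Q" "\<psi> \<in> hom G Q"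
    "\<psi> ` carrier G = carrier Q" "\<not> conjugate_in Q (\<psi> a) (\<psi> b)"
    using assms(2) unfolding p_conj_separated_def by blast
  interpret group Q using Q(1) by (simp add: finite_p_group_def)
  have "\<not> conjugate_in Q (\<psi> b) (\<psi> a)" using conjugate_in_sym[OF hom_in_carrier[OF Q(2) assms(1)]] Q(4) by blast
  then show ?thesis unfolding p_conj_separated_def using Q(1-3) by blast
qed

section \<open>Interchange of the two factors\<close>

context amalgam
begin

lemma conjugate_factor:
  assumes "h \<in> carrier H" "conjugate_in H h h'"
  shows "conjugate_in G (cl [Inl h]) (cl [Inl h'])"
proof -
  interpret i: group_hom H G "\<lambda>h. cl [Inl h]"
    by unfold_locales (auto simp: hom_def mult_amalgam cl_multH)
  show ?thesis by (rule i.conjugate_in_img[OF assms])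
qed

lemma amalgam_swap: "amalgam K H B A (inv_into A \<phi>)"
proof unfold_locales
  show "central_subgroup B K" "central_subgroup A H" by (rule B, rule A)
  interpret a: group "H\<lparr>carrier := A\<rparr>" by (rule H.subgroup_imp_group[OF A_subgroup])
  show "inv_into A \<phi> \<in> iso (K\<lparr>carrier := B\<rparr>) (H\<lparr>carrier := A\<rparr>)"
    using a.iso_set_sym[OF \<phi>] by simp
qed

text \<open>Exchanging the factors lets results about \<open>H\<close> be transferred to \<open>K\<close>.\<close>
lemma swap_hom:
  "\<exists>f. f \<in> hom G (amalgamated_product K H B (inv_into A \<phi>)) \<and>
    f ` carrier G = carrier (amalgamated_product K H B (inv_into A \<phi>)) \<and>
    (\<forall>k\<in>carrier K. f (cl [Inr k]) = amal_class K H B (inv_into A \<phi>) [Inl k])"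
proof -
  interpret S: amalgam K H B A "inv_into A \<phi>" by (rule amalgam_swap)
  let ?\<alpha> = "\<lambda>h. S.cl [Inr h]" and ?\<beta> = "\<lambda>k. S.cl [Inl k]"
  have a: "?\<alpha> \<in> hom H S.G" "?\<alpha> \<one>\<^bsub>H\<^esub> = \<one>\<^bsub>S.G\<^esub>"
    by (auto simp: hom_def S.mult_amalgam S.cl_multK S.cl_oneK S.one_amalgam)
  have b: "?\<beta> \<in> hom K S.G" "?\<beta> \<one>\<^bsub>K\<^esub> = \<one>\<^bsub>S.G\<^esub>"
    by (auto simp: hom_def S.mult_amalgam S.cl_multH S.cl_oneH S.one_amalgam)
  have eq: "?\<alpha> a = ?\<beta> (\<phi> a)" if "a \<in> A" for a
    using S.cl_amalg[OF \<phi>_in_B[OF that], of "[]"] inv_into_f_f[OF \<phi>_inj that] by simp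
  obtain f where f: "f \<in> hom G S.G" "f \<one>\<^bsub>G\<^esub> = \<one>\<^bsub>S.G\<^esub>" "\<And>w. w \<in> words \<Longrightarrow> f (cl w) = ev S.G ?\<alpha> ?\<beta> w"
    using amalgam_universal[OF S.G.is_monoid a b eq] by blast
  \<comment> \<open>Exchanging the tags of all letters is inverse to its counterpart for the swapped
    amalgam, which gives surjectivity.\<close>
  let ?sw = "map (case_sum Inr Inl)"
  have ev: "ev S.G ?\<alpha> ?\<beta> w = S.cl (?sw w)" for w
  proof (induction w)
    case (Cons l w)
    then show ?case by (cases l) (simp_all add: S.mult_amalgam)
  qed (simp add: S.one_amalgam)
  have sw: "?sw w \<in> words" if "w \<in> S.words" for w
    using that unfolding amal_words_def by auto
  have "S.cl w \<in> f ` carrier G" if w: "w \<in> S.words" for w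
  proof -
    have "case_sum Inr Inl \<circ> (case_sum Inr Inl :: 'k + 'h \<Rightarrow> 'h + 'k) = id"
      by (rule ext) (simp split: sum.split)
    then have "?sw (?sw w) = w" by simp
    then have "f (cl (?sw w)) = S.cl w" using f(3)[OF sw[OF w]] ev by simp
    then show ?thesis using sw[OF w] by (metis cl_closed imageI)
  qed
  then have "f ` carrier G = carrier S.G"
    unfolding S.carrier_amalgam using hom_in_carrier[OF f(1), unfolded S.carrier_amalgam]
    by (intro equalityI subsetI) auto
  moreover have "f (cl [Inr k]) = S.cl [Inl k]" if "k \<in> carrier K" for k
    using f(3)[of "[Inr k]"] that unfolding ev by simp
  ultimately show ?thesis using f(1) by (intro exI[of _ f]) simp
qed

end

section \<open>Separating elements of the factors\<close>

context nilpotent_amalgam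
begin

text \<open>Only the unit is conjugate to the unit, so separability makes a nontrivial y survive in
  some finite p-group, where its q-th power cannot become trivial.\<close>

lemma trivial_isolated: "p'_isolated p {\<one>\<^bsub>H\<^esub>} H"
  unfolding p'_isolated_def q_isolated_def
proof (intro allI impI ballI)
  fix q y assume q: "Factorial_Ring.prime q \<and> q \<noteq> p" and y: "y \<in> carrier H" "y [^]\<^bsub>H\<^esub> q \<in> {\<one>\<^bsub>H\<^esub>}"
  show "y \<in> {\<one>\<^bsub>H\<^esub>}"
  proof (rule ccontr)
    assume n: "y \<notin> {\<one>\<^bsub>H\<^esub>}"
    have "\<not> conjugate_in H y \<one>\<^bsub>H\<^esub>"
    proof
      assume "conjugate_in H y \<one>\<^bsub>H\<^esub>"
      then have "conjugate_in H \<one>\<^bsub>H\<^esub> y" by (rule H.conjugate_in_sym[OF y(1)])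
      then show False using n unfolding conjugate_in_def by auto
    qed
    then obtain Q :: "nat monoid" and \<psi> where Q: "finite_p_group p Q" "\<psi> \<in> hom H Q"
      "\<not> conjugate_in Q (\<psi> y) (\<psi> \<one>\<^bsub>H\<^esub>)"
      using sep(1) y(1) H.one_closed unfolding conj_p_separable_def by blast
    interpret Q: group Q using Q(1) by (simp add: finite_p_group_def)
    have one: "\<psi> \<one>\<^bsub>H\<^esub> = \<one>\<^bsub>Q\<^esub>" by (rule hom_one[OF Q(2) H.is_group Q.is_group])
    have "\<psi> y = \<one>\<^bsub>Q\<^esub>"
      by (rule p_power_hom_isolated[OF H.is_group p Q(1,2) y(1)]) (use q y(2) one in auto)
    then show False using Q(3) Q.conjugate_in_refl[of "\<one>\<^bsub>Q\<^esub>"] one by simp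
  qed
qed

text \<open>The two families belong to the p'-isolated normal subgroups A x B and the antidiagonal,
  the latter being \<open>twisted\<close> of the trivial subgroup.\<close>

lemma p_residual: "p_residual p"
  unfolding p_residual_def
proof (intro conjI ballI)
  fix z assume "z \<in> carrier \<Gamma> - A \<times> B"
  then show "\<exists>N. p_normal p N \<Gamma> \<and> A \<times> B \<subseteq> N \<and> z \<notin> N"
    by (intro \<Gamma>_separation normal_DirProd A_normal B_normal \<Gamma>_isolated iso) auto
next
  fix a assume a: "a \<in> A - {\<one>\<^bsub>H\<^esub>}"
  then have aH: "a \<in> carrier H" using A_subset by blast
  then have "(a, \<one>\<^bsub>K\<^esub>) \<in> carrier \<Gamma>" "(a, \<one>\<^bsub>K\<^esub>) \<notin> twisted {\<one>\<^bsub>H\<^esub>}"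
    using a by (auto simp: twisted_H)
  then obtain N where "p_normal p N \<Gamma>" "twisted {\<one>\<^bsub>H\<^esub>} \<subseteq> N" "(a, \<one>\<^bsub>K\<^esub>) \<notin> N"
    using \<Gamma>_separation[OF twisted_normal[OF H.one_is_normal] twisted_isolated[OF trivial_isolated]] by blast
  then show "\<exists>N. p_normal p N \<Gamma> \<and> antidiag \<subseteq> N \<and> (a, \<one>\<^bsub>K\<^esub>) \<notin> N"
    using antidiag_twisted[of "{\<one>\<^bsub>H\<^esub>}"] by blast
qed

text \<open>A finite p-group Q already separates h and h'. The subgroup N contains the kernel R of
  the map to Q and meets H in nothing more, because it avoids one preimage of each of the finitely
  many nontrivial elements of Q. Hence conjugacy modulo N would descend to Q.\<close>

lemma factor_separated:
  assumes h: "h \<in> carrier H" "h' \<in> carrier H" and nconj: "\<not> conjugate_in H h h'"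
  shows "p_conj_separated p G (cl [Inl h]) (cl [Inl h'])"
proof -
  obtain Q :: "nat monoid" and \<psi> where Q: "finite_p_group p Q" "\<psi> \<in> hom H Q"
    "\<psi> ` carrier H = carrier Q" "\<not> conjugate_in Q (\<psi> h) (\<psi> h')"
    using sep(1) h nconj unfolding conj_p_separable_def by blast
  interpret \<psi>: group_hom H Q \<psi>
    using Q(1,2) H.is_group by (simp add: group_hom_def group_hom_axioms_def finite_p_group_def)
  define R where "R = kernel H Q \<psi>"
  have R_iff: "x \<in> R \<longleftrightarrow> x \<in> carrier H \<and> \<psi> x = \<one>\<^bsub>Q\<^esub>" for x by (simp add: R_def kernel_def)
  have R: "R \<lhd> H" unfolding R_def by (rule \<psi>.normal_kernel)
  have R_iso: "p'_isolated p R H"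
    unfolding p'_isolated_def q_isolated_def R_iff
    using p_power_hom_isolated[OF H.is_group p Q(1,2)] by blast
  define d where "d c = inv_into (carrier H) \<psi> c" for c
  have d: "d c \<in> carrier H" "\<psi> (d c) = c" if "c \<in> carrier Q" for c
    unfolding d_def using that Q(3) by (auto intro: inv_into_into f_inv_into_f)
  have "\<exists>N. p_normal p N \<Gamma> \<and> twisted R \<subseteq> N \<and> (d c, \<one>\<^bsub>K\<^esub>) \<notin> N" if c: "c \<in> carrier Q - {\<one>\<^bsub>Q\<^esub>}" for c
  proof -
    have "(d c, \<one>\<^bsub>K\<^esub>) \<in> carrier \<Gamma>" "(d c, \<one>\<^bsub>K\<^esub>) \<notin> twisted R"
      using c d by (auto simp: twisted_H R_iff)
    then show ?thesis using \<Gamma>_separation[OF twisted_normal[OF R] twisted_isolated[OF R_iso]] by blast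
  qed
  then obtain F where F: "\<And>c. c \<in> carrier Q - {\<one>\<^bsub>Q\<^esub>} \<Longrightarrow>
      p_normal p (F c) \<Gamma> \<and> twisted R \<subseteq> F c \<and> (d c, \<one>\<^bsub>K\<^esub>) \<notin> F c" by metis
  have fin: "finite (F ` (carrier Q - {\<one>\<^bsub>Q\<^esub>}))" using Q(1) by (simp add: finite_p_group_def)
  have "twisted R \<subseteq> carrier \<Gamma>" unfolding twisted_def by blast
  then obtain N where N: "p_normal p N \<Gamma>" "twisted R \<subseteq> N" "\<And>M. M \<in> F ` (carrier Q - {\<one>\<^bsub>Q\<^esub>}) \<Longrightarrow> N \<subseteq> M"
    using \<Gamma>.p_normal_finite_Inter[OF fin, of p "twisted R"] F by blast
  have oneR: "\<one>\<^bsub>H\<^esub> \<in> R" by (simp add: R_iff)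
  interpret q: amalgam_quotient H K A B \<phi> p N
    by unfold_locales (rule N(1), rule order_trans[OF antidiag_twisted[OF oneR] N(2)])
  \<comment> \<open>An element of H in N differs by an element of R from the chosen preimage of its
    image in Q; if it were outside R, an excluded preimage would lie in N.\<close>
  have NR: "x \<in> R" if x: "x \<in> carrier H" "(x, \<one>\<^bsub>K\<^esub>) \<in> N" for x
  proof (rule ccontr)
    assume "x \<notin> R"
    then have c: "\<psi> x \<in> carrier Q - {\<one>\<^bsub>Q\<^esub>}" using x(1) by (simp add: R_iff)
    then have dx: "d (\<psi> x) \<in> carrier H" "\<psi> (d (\<psi> x)) = \<psi> x" using d by auto
    let ?r = "d (\<psi> x) \<otimes>\<^bsub>H\<^esub> inv\<^bsub>H\<^esub> x"
    have "?r \<in> R" using x(1) dx by (simp add: R_iff)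
    then have "(?r, \<one>\<^bsub>K\<^esub>) \<in> N" using N(2) twisted_H[of ?r R] x(1) dx(1) by auto
    then have "(?r, \<one>\<^bsub>K\<^esub>) \<otimes>\<^bsub>\<Gamma>\<^esub> (x, \<one>\<^bsub>K\<^esub>) \<in> N" using x(2) by (rule q.N.m_closed)
    then have "(d (\<psi> x), \<one>\<^bsub>K\<^esub>) \<in> N" using x(1) dx(1) by (simp add: H.m_assoc)
    then show False using F[OF c] N(3) c by blast
  qed
  show ?thesis
  proof (rule q.quotient_separates[OF p])
    show "[Inl h] \<in> words" "[Inl h'] \<in> words" using h by auto
    fix z assume "z \<in> carrier \<Gamma>"
    then obtain g k where z: "z = (g, k)" "g \<in> carrier H" "k \<in> carrier K" by auto
    \<comment> \<open>The K component of the conjugating element cancels, since a letter of H has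
      trivial K component.\<close>
    let ?c = "inv\<^bsub>H\<^esub> g \<otimes>\<^bsub>H\<^esub> h \<otimes>\<^bsub>H\<^esub> g"
    have c: "?c \<in> carrier H" using z(2) h(1) by simp
    have e: "inv\<^bsub>\<Gamma>\<^esub> z \<otimes>\<^bsub>\<Gamma>\<^esub> emb (Inl h) \<otimes>\<^bsub>\<Gamma>\<^esub> z = (?c, \<one>\<^bsub>K\<^esub>)"
      using z h(1) by (simp add: inv_DirProd[OF H.is_group K.is_group])
    show "N #>\<^bsub>\<Gamma>\<^esub> (inv\<^bsub>\<Gamma>\<^esub> z \<otimes>\<^bsub>\<Gamma>\<^esub> emb (Inl h) \<otimes>\<^bsub>\<Gamma>\<^esub> z) \<noteq> N #>\<^bsub>\<Gamma>\<^esub> emb (Inl h')"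
    proof
      assume "N #>\<^bsub>\<Gamma>\<^esub> (inv\<^bsub>\<Gamma>\<^esub> z \<otimes>\<^bsub>\<Gamma>\<^esub> emb (Inl h) \<otimes>\<^bsub>\<Gamma>\<^esub> z) = N #>\<^bsub>\<Gamma>\<^esub> emb (Inl h')"
      then have eq: "N #>\<^bsub>\<Gamma>\<^esub> (?c, \<one>\<^bsub>K\<^esub>) = N #>\<^bsub>\<Gamma>\<^esub> (h', \<one>\<^bsub>K\<^esub>)" unfolding e by simp
      have "(?c, \<one>\<^bsub>K\<^esub>) \<in> N #>\<^bsub>\<Gamma>\<^esub> (?c, \<one>\<^bsub>K\<^esub>)"
        by (rule \<Gamma>.rcos_self[OF _ q.N.subgroup_axioms]) (use c in simp)
      then have "\<exists>m\<in>N. (?c, \<one>\<^bsub>K\<^esub>) = m \<otimes>\<^bsub>\<Gamma>\<^esub> (h', \<one>\<^bsub>K\<^esub>)"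
        unfolding eq by (simp only: r_coset_def UN_iff singleton_iff)
      then obtain m where m: "m \<in> N" "(?c, \<one>\<^bsub>K\<^esub>) = m \<otimes>\<^bsub>\<Gamma>\<^esub> (h', \<one>\<^bsub>K\<^esub>)" by (rule bexE)
      have "m \<in> carrier \<Gamma>" using m(1) q.N.subset by blast
      then obtain m1 m2 where mm: "m = (m1, m2)" "m1 \<in> carrier H" "m2 \<in> carrier K" by auto
      have "m2 = \<one>\<^bsub>K\<^esub>" "?c = m1 \<otimes>\<^bsub>H\<^esub> h'" using m(2) mm by auto
      then have "m1 \<in> R" using NR[OF mm(2)] m(1) mm(1) by simp
      then have "\<psi> ?c = \<psi> h'" unfolding \<open>?c = m1 \<otimes>\<^bsub>H\<^esub> h'\<close> using h(2) by (simp add: R_iff)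
      then have "\<psi> h' = inv\<^bsub>Q\<^esub> \<psi> g \<otimes>\<^bsub>Q\<^esub> \<psi> h \<otimes>\<^bsub>Q\<^esub> \<psi> g" using z(2) h(1) by simp
      then have "conjugate_in Q (\<psi> h) (\<psi> h')" unfolding conjugate_in_def by (rule bexI) (use z(2) in simp)
      then show False using Q(4) by blast
    qed
  qed
qed

text \<open>Modulo a subgroup N containing A x K the letter k becomes trivial, while h survives
  because A x K is p'-isolated; a conjugate of a nontrivial element is nontrivial.\<close>

lemma mixed_separated:
  assumes h: "h \<in> carrier H" "h \<notin> A" and k: "k \<in> carrier K"
  shows "p_conj_separated p G (cl [Inl h]) (cl [Inr k])"
proof -
  have "p'_isolated p (carrier K) K" by (simp add: p'_isolated_def q_isolated_def)
  moreover have "(h, \<one>\<^bsub>K\<^esub>) \<in> carrier \<Gamma>" "(h, \<one>\<^bsub>K\<^esub>) \<notin> A \<times> carrier K" using h by auto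
  ultimately obtain N where N: "p_normal p N \<Gamma>" "A \<times> carrier K \<subseteq> N" "(h, \<one>\<^bsub>K\<^esub>) \<notin> N"
    using \<Gamma>_separation[OF normal_DirProd[OF A_normal K.normal_self] \<Gamma>_isolated[OF iso(1)]] by blast
  have "antidiag \<subseteq> A \<times> carrier K" using antidiag_subset B_subset by blast
  interpret q: amalgam_quotient H K A B \<phi> p N
    by unfold_locales (rule N(1), rule order_trans[OF \<open>antidiag \<subseteq> A \<times> carrier K\<close> N(2)])
  show ?thesis
  proof (rule q.quotient_separates[OF p])
    show "[Inl h] \<in> words" "[Inr k] \<in> words" using h k by auto
    fix z assume z: "z \<in> carrier \<Gamma>"
    have e: "emb (Inl h) \<in> carrier \<Gamma>" using h by simp
    show "N #>\<^bsub>\<Gamma>\<^esub> (inv\<^bsub>\<Gamma>\<^esub> z \<otimes>\<^bsub>\<Gamma>\<^esub> emb (Inl h) \<otimes>\<^bsub>\<Gamma>\<^esub> z) \<noteq> N #>\<^bsub>\<Gamma>\<^esub> emb (Inr k)"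
    proof
      assume eq: "N #>\<^bsub>\<Gamma>\<^esub> (inv\<^bsub>\<Gamma>\<^esub> z \<otimes>\<^bsub>\<Gamma>\<^esub> emb (Inl h) \<otimes>\<^bsub>\<Gamma>\<^esub> z) = N #>\<^bsub>\<Gamma>\<^esub> emb (Inr k)"
      have "emb (Inr k) \<in> N" using N(2) k subgroup.one_closed[OF A_subgroup] by auto
      then have "N #>\<^bsub>\<Gamma>\<^esub> emb (Inr k) = N" by (rule q.N.rcos_const[OF \<Gamma>.is_group])
      then have "inv\<^bsub>\<Gamma>\<^esub> z \<otimes>\<^bsub>\<Gamma>\<^esub> emb (Inl h) \<otimes>\<^bsub>\<Gamma>\<^esub> z \<in> N"
        using eq q.N.Mod_eq_one_iff[OF \<Gamma>.m_closed[OF \<Gamma>.m_closed[OF \<Gamma>.inv_closed[OF z] e] z]] by simp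
      from q.N.inv_op_closed2[OF z this]
      have "z \<otimes>\<^bsub>\<Gamma>\<^esub> (inv\<^bsub>\<Gamma>\<^esub> z \<otimes>\<^bsub>\<Gamma>\<^esub> emb (Inl h) \<otimes>\<^bsub>\<Gamma>\<^esub> z) \<otimes>\<^bsub>\<Gamma>\<^esub> inv\<^bsub>\<Gamma>\<^esub> z \<in> N" .
      moreover have "z \<otimes>\<^bsub>\<Gamma>\<^esub> (inv\<^bsub>\<Gamma>\<^esub> z \<otimes>\<^bsub>\<Gamma>\<^esub> emb (Inl h) \<otimes>\<^bsub>\<Gamma>\<^esub> z) \<otimes>\<^bsub>\<Gamma>\<^esub> inv\<^bsub>\<Gamma>\<^esub> z = emb (Inl h)"
        using z e by (simp only: \<Gamma>.m_assoc \<Gamma>.m_closed \<Gamma>.inv_closed \<Gamma>.mult_inv_cancel \<Gamma>.r_inv \<Gamma>.r_one)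
      ultimately show False using N(3) by simp
    qed
  qed
qed

end

section \<open>Conjugacy separability of the amalgam\<close>

lemma (in nilpotent_amalgam) swap: "nilpotent_amalgam K H B A (inv_into A \<phi>) p"
  by (intro nilpotent_amalgam.intro amalgam_swap nilpotent_amalgam_axioms.intro p fg nil sep iso)

theorem (in nilpotent_amalgam) conj_p_separable_amalgam: "conj_p_separable p G"
proof -
  interpret S: nilpotent_amalgam K H B A "inv_into A \<phi>" p by (rule swap)
  have swapped: "p_conj_separated p G (cl [Inr k]) (cl [Inr k'])"
    if k: "k \<in> carrier K" "k' \<in> carrier K" and n: "\<not> conjugate_in G (cl [Inr k]) (cl [Inr k'])" for k k'
  proof -
    obtain f where f: "f \<in> hom G S.G" "f ` carrier G = carrier S.G"
      "\<forall>k\<in>carrier K. f (cl [Inr k]) = S.cl [Inl k]"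
      using swap_hom by (elim exE conjE)
    interpret j: group_hom K G "\<lambda>k. cl [Inr k]"
      by unfold_locales (auto simp: hom_def mult_amalgam cl_multK)
    have "\<not> conjugate_in K k k'" using j.conjugate_in_img[OF k(1)] n by blast
    then have "p_conj_separated p S.G (S.cl [Inl k]) (S.cl [Inl k'])" by (rule S.factor_separated[OF k])
    then show ?thesis using p_conj_separated_vimage[OF f(1,2), of p "cl [Inr k]" "cl [Inr k']"] f(3) k by simp
  qed
  have letters: "p_conj_separated p G (cl [x]) (cl [y])"
    if xy: "[x] \<in> words" "[y] \<in> words" and n: "\<not> conjugate_in G (cl [x]) (cl [y])" for x y
  proof -
    have HH: "p_conj_separated p G (cl [Inl h]) (cl [Inl h'])"
      if "h \<in> carrier H" "h' \<in> carrier H" "\<not> conjugate_in G (cl [Inl h]) (cl [Inl h'])" for h h'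
      using factor_separated conjugate_factor that by blast
    have HK: "p_conj_separated p G (cl [Inl h]) (cl [Inr k])"
      if hk: "h \<in> carrier H" "k \<in> carrier K" and n: "\<not> conjugate_in G (cl [Inl h]) (cl [Inr k])" for h k
    proof (cases "h \<in> A")
      case True
      \<comment> \<open>An element of A is also represented by a letter of K, so both letters come
        from K.\<close>
      then have "cl [Inl h] = cl [Inr (\<phi> h)]" by (rule cl_amalg)
      then show ?thesis using swapped[OF \<phi>_in_K[OF True] hk(2)] n by simp
    next
      case False
      then show ?thesis using mixed_separated hk by blast
    qed
    show ?thesis
    proof (cases x; cases y)
      fix h h' assume "x = Inl h" "y = Inl h'"
      then show ?thesis using HH xy n by simp
    next
      fix h k assume "x = Inl h" "y = Inr k"
      then show ?thesis using HK xy n by simp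
    next
      fix k h assume *: "x = Inr k" "y = Inl h"
      have "\<not> conjugate_in G (cl [y]) (cl [x])" using n G.conjugate_in_sym[OF cl_closed[OF xy(2)]] by blast
      then have "p_conj_separated p G (cl [y]) (cl [x])" using HK xy * by simp
      then show ?thesis by (rule p_conj_separated_sym[OF cl_closed[OF xy(1)]])
    next
      fix k k' assume "x = Inr k" "y = Inr k'"
      then show ?thesis using swapped xy n by simp
    qed
  qed
  have main: "p_conj_separated p G (cl u) (cl v)"
    if u: "u \<in> words" "length u = 1 \<or> cyc_reduced u" and v: "v \<in> words" "length v = 1 \<or> cyc_reduced v"
      and le: "length v \<le> length u" and n: "\<not> conjugate_in G (cl u) (cl v)" for u v
  proof (cases "cyc_reduced u")
    case True
    then show ?thesis by (rule cyc_reduced_pair_separated[OF p p_residual _ v le n])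
  next
    case False
    then have "length u = 1" using u(2) by blast
    moreover from this have "length v = 1" using v(2) le by (auto simp: cyc_reduced_def)
    ultimately obtain x y where "u = [x]" "v = [y]" by (metis One_nat_def length_0_conv length_Suc_conv)
    then show ?thesis using letters u(1) v(1) n by simp
  qed
  have "p_conj_separated p G a b" if ab: "a \<in> carrier G" "b \<in> carrier G" and n: "\<not> conjugate_in G a b" for a b
  proof -
    obtain u where u: "u \<in> words" "conjugate_in G a (cl u)" "length u = 1 \<or> cyc_reduced u"
      using conjugate_to_cyc_reduced[OF ab(1)] by blast
    obtain v where v: "v \<in> words" "conjugate_in G b (cl v)" "length v = 1 \<or> cyc_reduced v"
      using conjugate_to_cyc_reduced[OF ab(2)] by blast
    have uc: "cl u \<in> carrier G" and vc: "cl v \<in> carrier G" using u(1) v(1) by (auto intro: cl_closed)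
    have uv: "\<not> conjugate_in G (cl u) (cl v)"
    proof
      assume "conjugate_in G (cl u) (cl v)"
      then have "conjugate_in G a (cl v)" by (rule G.conjugate_in_trans[OF ab(1) u(2)])
      moreover have "conjugate_in G (cl v) b" by (rule G.conjugate_in_sym[OF ab(2) v(2)])
      ultimately show False using G.conjugate_in_trans[OF ab(1)] n by blast
    qed
    have "p_conj_separated p G (cl u) (cl v)"
    proof (cases "length v \<le> length u")
      case True
      then show ?thesis using main u v uv by blast
    next
      case False
      \<comment> \<open>Separation is symmetric, so the longer word may always take the place of the
        reference word.\<close>
      have "\<not> conjugate_in G (cl v) (cl u)" using uv G.conjugate_in_sym[OF vc] by blast
      then have "p_conj_separated p G (cl v) (cl u)" using main u v False by simp
      then show ?thesis by (rule p_conj_separated_sym[OF uc])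
    qed
    then show ?thesis by (rule p_conj_separated_conjugate[OF G.is_group ab uc vc u(2) v(2)])
  qed
  then show ?thesis unfolding conj_p_separable_def p_conj_separated_def by blast
qed

theorem theorem3:
  fixes p :: nat
    and H :: "('h, 'c) monoid_scheme" and K :: "('k, 'd) monoid_scheme"
    and A :: "'h set" and B :: "'k set" and \<phi> :: "'h \<Rightarrow> 'k"
  assumes "Factorial_Ring.prime p"
    and "group H" and "group K"
    and "fin_gen_group H" and "fin_gen_group K"
    and "nilpotent_group H" and "nilpotent_group K"
    and "conj_p_separable p H" and "conj_p_separable p K"
    and "central_subgroup A H" and "central_subgroup B K"
    and "p'_isolated p A H" and "p'_isolated p B K"
    and "\<phi> \<in> iso (H\<lparr>carrier := A\<rparr>) (K\<lparr>carrier := B\<rparr>)"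
  shows "conj_p_separable p (amalgamated_product H K A \<phi>)"
proof -
  interpret nilpotent_amalgam H K A B \<phi> p
    using assms by (intro nilpotent_amalgam.intro amalgam.intro amalgam_axioms.intro nilpotent_amalgam_axioms.intro)
  show ?thesis by (rule conj_p_separable_amalgam)
qed

end
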